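(* Let $p\geq 2$ be an integer and $\mathfrak{q}=e^{i\pi/p}$. Let $\overline{\mathscr{U}}_{\mathfrak{q}}s\ell(2)$ be the $2p^3$-dimensional quantum group and $\overline{\mathscr{H}}_{\mathfrak{q}}s\ell(2)$ the $2p^3$-dimensional algebra defined in the context. With the $\overline{\mathscr{U}}_{\mathfrak{q}}s\ell(2)$-action determined by $$E\triangleright\lambda^n=\mathfrak{q}^{-\frac n2}\left[\tfrac n2\right]\lambda^n z,\qquad K\triangleright\lambda^n=\mathfrak{q}^{-n}\lambda^n,\qquad F\triangleright\lambda^n=-\mathfrak{q}^{\frac n2}\left[\tfrac n2\right]\lambda^n\partial,$$ $$E\triangleright z^n=-\mathfrak{q}^n[n]z^{n+1},\qquad K\triangleright z^n=\mathfrak{q}^{2n}z^n,\qquad F\triangleright z^n=[n]\mathfrak{q}^{1-n}z^{n-1},$$ $$E\triangleright\partial^n=\mathfrak{q}^{1-n}[n]\partial^{n-1},\qquad K\triangleright\partial^n=\mathfrak{q}^{-2n}\partial^n,\qquad F\triangleright\partial^n=-\mathfrak{q}^n[n]\partial^{n+1}$$ (extended to products by the module algebra property) and the coaction $\delta:\overline{\mathscr{H}}_{\mathfrak{q}}s\ell(2)\to\overline{\mathscr{U}}_{\mathfrak{q}}s\ell(2)\otimes\overline{\mathscr{H}}_{\mathfrak{q}}s\ell(2)$ determined (as an algebra morphism) by $$\lambda\mapsto 1\otimes\lambda,$$ $$z^m\mapsto\sum_{s=0}^m(-1)^s\mathfrak{q}^{s(1-m)}(\mathfrak{q}-\mathfrak{q}^{-1})^s\begin{bmatrix}m\\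 s\end{bmatrix}E^sK^{-m}\otimes z^{m-s},$$ $$\partial^m\mapsto\sum_{s=0}^m\mathfrak{q}^{s(m-s)}(\mathfrak{q}-\mathfrak{q}^{-1})^s\begin{bmatrix}m\\ s\end{bmatrix}F^sK^{-(m-s)}\otimes\partial^{m-s},$$ $\overline{\mathscr{H}}_{\mathfrak{q}}s\ell(2)$ is a braided commutative Yetter--Drinfeld $\overline{\mathscr{U}}_{\mathfrak{q}}s\ell(2)$-module algebra. In particular, $\mathbb{C}_{\mathfrak{q}}[z,\partial]$ is also a braided commutative Yetter--Drinfeld $\overline{\mathscr{U}}_{\mathfrak{q}}s\ell(2)$-module algebra.
   Context: $\overline{\mathscr{U}}_{\mathfrak{q}}s\ell(2)$ is the Hopf algebra over $\mathbb{C}$ with generators $E,K,F$ and relations $KEK^{-1}=\mathfrak{q}^2E$, $KFK^{-1}=\mathfrak{q}^{-2}F$, $[E,F]=\frac{K-K^{-1}}{\mathfrak{q}-\mathfrak{q}^{-1}}$, $E^p=F^p=0$, $K^{2p}=1$, and $\Delta(E)=E\otimes K+1\otimes E$, $\Delta(K)=K\otimes K$, $\Delta(F)=F\otimes 1+K^{-1}\otimes F$, $\epsilon(E)=\epsilon(F)=0$, $\epsilon(K)=1$, $S(E)=-EK^{-1}$, $S(K)=K^{-1}$, $S(F)=-KF$. $\mathbb{C}_{\mathfrak{q}}[z,\partial]$ is the $p^2$-dimensional unital associative algebra with generators $z,\partial$ and relations $z^p=0$, $\partial^p=0$, $\partial z=(\mathfrak{q}-\mathfrak{q}^{-1})1+\mathfrak{q}^{-2}z\partial$.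 As an associative algebra, $\overline{\mathscr{H}}_{\mathfrak{q}}s\ell(2)=\mathbb{C}_{\mathfrak{q}}[z,\partial]\otimes\bigl(\mathbb{C}[\lambda]/(\lambda^{2p}-1)\bigr)$; in particular $\lambda$ is central. Here $\mathfrak{q}^{x}=e^{i\pi x/p}$, $[x]=\frac{\mathfrak{q}^x-\mathfrak{q}^{-x}}{\mathfrak{q}-\mathfrak{q}^{-1}}$, $[n]!=[1][2]\cdots[n]$, and $\begin{bmatrix}m\\ s\end{bmatrix}=\frac{[m]!}{[s]!\,[m-s]!}$ (for $0\le s\le m\le p-1$). For a Hopf algebra $H$, write left coactions as $\delta(u)=u_{(-1)}\otimes u_{(0)}$ and coproducts as $\Delta(h)=h'\otimes h''$. A (left--left) Yetter--Drinfeld $H$-module algebra is an algebra $X$ that is a left $H$-module algebra ($h\triangleright(xy)=(h'\triangleright x)(h''\triangleright y)$, $h\triangleright1=\epsilon(h)1$) and a left $H$-comodule algebra ($\delta$ is an algebra morphism) with $(h'\triangleright x)_{(-1)}h''\otimes(h'\triangleright x)_{(0)}=h'x_{(-1)}\otimes(h''\triangleright x_{(0)})$ for all $h\in H$, $x\in X$. It is braided commutative if $yx=(y_{(-1)}\triangleright x)y_{(0)}$ for all $x,y\in X$. *)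

theory Defs
  imports Complex_Main "HOL-Library.Poly_Mapping" "HOL-Library.Cardinality"
begin

section \<open>Complex vector spaces and unital associative complex algebras\<close>

class scaleC =
  fixes scaleC :: "complex \<Rightarrow> 'a \<Rightarrow> 'a"  (infixr \<open>*\<^sub>C\<close> 75)

class complex_vector = scaleC + ab_group_add +
  assumes scaleC_add_right: "c *\<^sub>C (x + y) = c *\<^sub>C x + c *\<^sub>C y"
    and scaleC_add_left: "(c + d) *\<^sub>C x = c *\<^sub>C x + d *\<^sub>C x"
    and scaleC_scaleC [simp]: "c *\<^sub>C d *\<^sub>C x = (c * d) *\<^sub>C x"
    and scaleC_one [simp]: "1 *\<^sub>C x = x"

text \<open>Algebras are unital. The class \<^class>\<open>ring_1\<close> is avoided because it also demands
  \<open>0 \<noteq> 1\<close>, which is not an axiom for algebras given by generators and relations.\<close>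

class complex_algebra = complex_vector + ring + monoid_mult +
  assumes mult_scaleC_left [simp]: "(c *\<^sub>C x) * y = c *\<^sub>C (x * y)"
    and mult_scaleC_right [simp]: "x * (c *\<^sub>C y) = c *\<^sub>C (x * y)"

instantiation complex :: complex_algebra
begin
definition scaleC_complex :: "complex \<Rightarrow> complex \<Rightarrow> complex" where
  "scaleC_complex c x = c * x"
instance
  by standard (simp_all add: scaleC_complex_def algebra_simps)
end

context complex_vector
begin

lemma scaleC_zero_left [simp]: "0 *\<^sub>C x = 0"
  using scaleC_add_left [of 0 0 x] by simp

lemma scaleC_zero_right [simp]: "c *\<^sub>C 0 = 0"
  using scaleC_add_right [of c 0 0] by simp

lemma scaleC_minus_left [simp]: "(- c) *\<^sub>C x = - (c *\<^sub>C x)"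
  using scaleC_add_left [of c "- c" x] by (simp add: eq_neg_iff_add_eq_0 add.commute)

lemma scaleC_minus_right [simp]: "c *\<^sub>C (- x) = - (c *\<^sub>C x)"
  using scaleC_add_right [of c x "- x"] by (simp add: eq_neg_iff_add_eq_0 add.commute)

lemma scaleC_diff_right: "c *\<^sub>C (x - y) = c *\<^sub>C x - c *\<^sub>C y"
  using scaleC_add_right [of c x "- y"] by simp

lemma scaleC_diff_left: "(c - d) *\<^sub>C x = c *\<^sub>C x - d *\<^sub>C x"
  using scaleC_add_left [of c "- d" x] by simp

lemma scaleC_sum_right: "c *\<^sub>C sum f A = (\<Sum>x\<in>A. c *\<^sub>C f x)"
  by (induction A rule: infinite_finite_induct) (simp_all add: scaleC_add_right)

end

definition clinear :: "('a::complex_vector \<Rightarrow> 'b::complex_vector) \<Rightarrow> bool" where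
  "clinear f \<longleftrightarrow> (\<forall>x y. f (x + y) = f x + f y) \<and> (\<forall>c x. f (c *\<^sub>C x) = c *\<^sub>C f x)"

definition cbilinear :: "('a::complex_vector \<Rightarrow> 'b::complex_vector \<Rightarrow> 'c::complex_vector) \<Rightarrow> bool" where
  "cbilinear f \<longleftrightarrow> (\<forall>y. clinear (\<lambda>x. f x y)) \<and> (\<forall>x. clinear (f x))"

definition alg_hom :: "('a::complex_algebra \<Rightarrow> 'b::complex_algebra) \<Rightarrow> bool" where
  "alg_hom f \<longleftrightarrow> clinear f \<and> f 1 = 1 \<and> (\<forall>x y. f (x * y) = f x * f y)"

lemma clinear_add: "clinear f \<Longrightarrow> f (x + y) = f x + f y"
  and clinear_scaleC: "clinear f \<Longrightarrow> f (c *\<^sub>C x) = c *\<^sub>C f x"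
  by (simp_all add: clinear_def)

lemma clinear_zero: "clinear f \<Longrightarrow> f 0 = 0"
  using clinear_scaleC [of f 0 0] by simp

lemma clinear_minus: "clinear f \<Longrightarrow> f (- x) = - f x"
  using clinear_scaleC [of f "-1" x] by simp

lemma clinear_diff: "clinear f \<Longrightarrow> f (x - y) = f x - f y"
  using clinear_add [of f x "- y"] by (simp add: clinear_minus)

lemma clinear_compose: "clinear f \<Longrightarrow> clinear g \<Longrightarrow> clinear (\<lambda>x. f (g x))"
  by (simp add: clinear_def)

lemma alg_hom_power: "alg_hom f \<Longrightarrow> f (x ^ n) = f x ^ n"
  by (induction n) (simp_all add: alg_hom_def)

section \<open>Linear extension from a free vector space\<close>

instantiation poly_mapping :: (type, complex_vector) complex_vector
begin
definition scaleC_poly_mapping :: "complex \<Rightarrow> ('a \<Rightarrow>\<^sub>0 'b) \<Rightarrow> 'a \<Rightarrow>\<^sub>0 'b" where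
  "scaleC_poly_mapping c = Poly_Mapping.map (scaleC c)"
lemma lookup_scaleC [simp]: "Poly_Mapping.lookup (c *\<^sub>C x) k = c *\<^sub>C Poly_Mapping.lookup x k"
  by (simp add: scaleC_poly_mapping_def Poly_Mapping.map.rep_eq when_def)
instance
  by standard
    (auto intro!: poly_mapping_eqI simp: lookup_add scaleC_add_right scaleC_add_left)
end

lemma scaleC_single [simp]: "c *\<^sub>C Poly_Mapping.single k v = Poly_Mapping.single k (c *\<^sub>C v)"
  by (intro poly_mapping_eqI) (simp add: lookup_single when_def)

lemma poly_mapping_single_induct [case_names zero add]:
  assumes "P 0" and "\<And>k v x. P x \<Longrightarrow> P (Poly_Mapping.single k v + x)"
  shows "P x"
proof (induction x rule: update_induct)
  case const
  show ?case using assms(1) .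
next
  case (update f a b)
  have "Poly_Mapping.update a b f = Poly_Mapping.single a b + f"
    using update(1) by (intro poly_mapping_eqI)
      (auto simp: lookup_update lookup_add lookup_single when_def in_keys_iff)
  then show ?case using assms(2) update by simp
qed

instance poly_mapping :: (monoid_add, "{complex_algebra, ring_1}") complex_algebra
proof
  fix c :: complex and x y :: "'a \<Rightarrow>\<^sub>0 'b"
  have *: "c *\<^sub>C x = Poly_Mapping.single 0 (c *\<^sub>C 1) * x" for x :: "'a \<Rightarrow>\<^sub>0 'b"
    by (induction x rule: poly_mapping_single_induct)
      (simp_all add: scaleC_add_right distrib_left mult_single)
  have **: "x * Poly_Mapping.single 0 (c *\<^sub>C 1) = Poly_Mapping.single 0 (c *\<^sub>C 1) * x" for x :: "'a \<Rightarrow>\<^sub>0 'b"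
    by (induction x rule: poly_mapping_single_induct)
      (simp_all add: distrib_left distrib_right mult_single)
  show "(c *\<^sub>C x) * y = c *\<^sub>C (x * y)"
    by (simp only: * mult.assoc)
  have "x * (c *\<^sub>C y) = (x * Poly_Mapping.single 0 (c *\<^sub>C 1)) * y"
    by (simp only: * [of y] mult.assoc)
  also have "\<dots> = c *\<^sub>C (x * y)"
    by (simp only: ** [of x] * [of "x * y"] mult.assoc)
  finally show "x * (c *\<^sub>C y) = c *\<^sub>C (x * y)" .
qed

definition lin_ext :: "('k \<Rightarrow> 'v::complex_vector) \<Rightarrow> ('k \<Rightarrow>\<^sub>0 complex) \<Rightarrow> 'v" where
  "lin_ext f x = (\<Sum>k\<in>Poly_Mapping.keys x. Poly_Mapping.lookup x k *\<^sub>C f k)"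

lemma lin_ext_superset:
  "finite A \<Longrightarrow> Poly_Mapping.keys x \<subseteq> A \<Longrightarrow> lin_ext f x = (\<Sum>k\<in>A. Poly_Mapping.lookup x k *\<^sub>C f k)"
  unfolding lin_ext_def by (rule sum.mono_neutral_left) (auto simp: in_keys_iff)

lemma lin_ext_single [simp]: "lin_ext f (Poly_Mapping.single k c) = c *\<^sub>C f k"
  by (simp add: lin_ext_def)

lemma clinear_lin_ext: "clinear (lin_ext f)"
proof -
  have "lin_ext f (x + y) = lin_ext f x + lin_ext f y" for x y
    using keys_add [of x y]
    by (simp add: lin_ext_superset [of "Poly_Mapping.keys x \<union> Poly_Mapping.keys y"] lookup_add scaleC_add_left sum.distrib)
  moreover have "lin_ext f (c *\<^sub>C x) = c *\<^sub>C lin_ext f x" for c x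
  proof -
    have "Poly_Mapping.keys (c *\<^sub>C x) \<subseteq> Poly_Mapping.keys x"
      by (auto simp: in_keys_iff)
    then show ?thesis
      by (simp add: lin_ext_superset [of "Poly_Mapping.keys x"] scaleC_sum_right scaleC_complex_def)
  qed
  ultimately show ?thesis
    by (simp add: clinear_def)
qed

lemmas lin_ext_linear [simp] =
  clinear_add [OF clinear_lin_ext] clinear_scaleC [OF clinear_lin_ext]
  clinear_zero [OF clinear_lin_ext] clinear_minus [OF clinear_lin_ext]
  clinear_diff [OF clinear_lin_ext]

section \<open>Tensor products\<close>

inductive_set tensor_null :: "('a::complex_vector \<times> 'b::complex_vector \<Rightarrow>\<^sub>0 complex) set" where
  null_add_left: "Poly_Mapping.single (a + a', b) 1 - Poly_Mapping.single (a, b) 1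
    - Poly_Mapping.single (a', b) 1 \<in> tensor_null"
| null_add_right: "Poly_Mapping.single (a, b + b') 1 - Poly_Mapping.single (a, b) 1
    - Poly_Mapping.single (a, b') 1 \<in> tensor_null"
| null_scaleC_left: "Poly_Mapping.single (c *\<^sub>C a, b) 1 - Poly_Mapping.single (a, b) c \<in> tensor_null"
| null_scaleC_right: "Poly_Mapping.single (a, c *\<^sub>C b) 1 - Poly_Mapping.single (a, b) c \<in> tensor_null"
| null_zero: "0 \<in> tensor_null"
| null_add: "x \<in> tensor_null \<Longrightarrow> y \<in> tensor_null \<Longrightarrow> x + y \<in> tensor_null"
| null_scaleC: "x \<in> tensor_null \<Longrightarrow> c *\<^sub>C x \<in> tensor_null"

lemma null_minus: "x \<in> tensor_null \<Longrightarrow> - x \<in> tensor_null"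
  using null_scaleC [of x "-1"] by simp

quotient_type (overloaded) ('a, 'b) tensor =
  "'a::complex_vector \<times> 'b::complex_vector \<Rightarrow>\<^sub>0 complex" / "\<lambda>x y. x - y \<in> tensor_null"
proof (rule equivpI)
  show "reflp (\<lambda>x y :: 'a \<times> 'b \<Rightarrow>\<^sub>0 complex. x - y \<in> tensor_null)"
    by (simp add: reflp_def null_zero)
  show "symp (\<lambda>x y :: 'a \<times> 'b \<Rightarrow>\<^sub>0 complex. x - y \<in> tensor_null)"
    by (rule sympI) (drule null_minus, simp)
  show "transp (\<lambda>x y :: 'a \<times> 'b \<Rightarrow>\<^sub>0 complex. x - y \<in> tensor_null)"
    by (rule transpI) (drule (1) null_add, simp)
qed

instantiation tensor :: (complex_vector, complex_vector) complex_vector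
begin

lift_definition zero_tensor :: "('a, 'b) tensor" is 0 .

lift_definition plus_tensor :: "('a, 'b) tensor \<Rightarrow> ('a, 'b) tensor \<Rightarrow> ('a, 'b) tensor" is "(+)"
  by (simp only: add_diff_add null_add)

lift_definition uminus_tensor :: "('a, 'b) tensor \<Rightarrow> ('a, 'b) tensor" is uminus
  by (drule null_minus) simp

lift_definition minus_tensor :: "('a, 'b) tensor \<Rightarrow> ('a, 'b) tensor \<Rightarrow> ('a, 'b) tensor" is "(-)"
proof -
  fix x y u v :: "'a \<times> 'b \<Rightarrow>\<^sub>0 complex"
  assume "x - y \<in> tensor_null" "u - v \<in> tensor_null"
  then have "(x - y) + - (u - v) \<in> tensor_null"
    by (intro null_add null_minus)
  then show "x - u - (y - v) \<in> tensor_null"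
    by (simp add: algebra_simps)
qed

lift_definition scaleC_tensor :: "complex \<Rightarrow> ('a, 'b) tensor \<Rightarrow> ('a, 'b) tensor" is scaleC
  by (simp add: null_scaleC flip: scaleC_diff_right)

instance
  by standard (transfer; simp add: null_zero scaleC_add_left scaleC_add_right algebra_simps)+

end

lift_definition tens :: "'a::complex_vector \<Rightarrow> 'b::complex_vector \<Rightarrow> ('a, 'b) tensor"  (infixr \<open>\<otimes>\<close> 72)
  is "\<lambda>a b. Poly_Mapping.single (a, b) 1" .

text \<open>For bilinear \<open>f\<close> this is the linear map with \<open>a \<otimes> b \<mapsto> f a b\<close>; the value is
  meaningful only for bilinear \<open>f\<close>. Sweedler-type expressions are written with it:
  \<open>f h' h''\<close> for \<open>\<Delta>(h) = h' \<otimes> h''\<close> is \<open>tensor_lift f (\<Delta> h)\<close>.\<close>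

definition tensor_lift ::
  "('a::complex_vector \<Rightarrow> 'b::complex_vector \<Rightarrow> 'c::complex_vector) \<Rightarrow> ('a, 'b) tensor \<Rightarrow> 'c" where
  "tensor_lift f t = lin_ext (\<lambda>(a, b). f a b) (rep_tensor t)"

lemma cbilinear_tens: "cbilinear (\<otimes>)"
proof -
  have "(a + a') \<otimes> b = a \<otimes> b + a' \<otimes> b" for a a' :: 'a and b :: 'b
    by transfer (use null_add_left in \<open>simp add: diff_diff_eq\<close>)
  moreover have "a \<otimes> (b + b') = a \<otimes> b + a \<otimes> b'" for a :: 'a and b b' :: 'b
    by transfer (use null_add_right in \<open>simp add: diff_diff_eq\<close>)
  moreover have "(c *\<^sub>C a) \<otimes> b = c *\<^sub>C (a \<otimes> b)" for c and a :: 'a and b :: 'b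
    by transfer (simp add: null_scaleC_left scaleC_complex_def)
  moreover have "a \<otimes> (c *\<^sub>C b) = c *\<^sub>C (a \<otimes> b)" for c and a :: 'a and b :: 'b
    by transfer (simp add: null_scaleC_right scaleC_complex_def)
  ultimately show ?thesis
    by (simp add: cbilinear_def clinear_def)
qed

lemma clinear_tens_left: "clinear (\<lambda>a. a \<otimes> b)"
  and clinear_tens_right: "clinear ((\<otimes>) a)"
  by (rule cbilinear_tens [unfolded cbilinear_def, THEN conjunct1, THEN spec]
      cbilinear_tens [unfolded cbilinear_def, THEN conjunct2, THEN spec])+

lemmas tens_linear =
  clinear_add [OF clinear_tens_left] clinear_add [OF clinear_tens_right]
  clinear_diff [OF clinear_tens_left] clinear_diff [OF clinear_tens_right]
  clinear_scaleC [OF clinear_tens_left] clinear_scaleC [OF clinear_tens_right]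
  clinear_minus [OF clinear_tens_left] clinear_minus [OF clinear_tens_right]
  clinear_zero [OF clinear_tens_left] clinear_zero [OF clinear_tens_right]

lemma abs_rep_tensor: "abs_tensor (rep_tensor t) = t"
  by (rule Quotient_abs_rep [OF Quotient_tensor])

lemma tensor_induct [case_names tens add, induct type: tensor]:
  assumes "\<And>a b. P (a \<otimes> b)" and "\<And>x y. P x \<Longrightarrow> P y \<Longrightarrow> P (x + y)"
  shows "P t"
proof -
  have "P (abs_tensor x)" for x
  proof (induction x rule: poly_mapping_single_induct)
    case zero
    show ?case using assms(1) [of 0 0] by (simp add: tens_linear zero_tensor_def)
  next
    case (add k v x)
    have "abs_tensor (Poly_Mapping.single k v + x) = abs_tensor (v *\<^sub>C Poly_Mapping.single k 1) + abs_tensor x"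
      by (simp add: plus_tensor.abs_eq scaleC_complex_def)
    also have "abs_tensor (v *\<^sub>C Poly_Mapping.single k 1) = v *\<^sub>C (fst k \<otimes> snd k)"
      by (simp add: scaleC_tensor.abs_eq tens.abs_eq)
    also have "\<dots> = (v *\<^sub>C fst k) \<otimes> snd k"
      by (rule tens_linear(5) [symmetric])
    finally show ?case using assms add by metis
  qed
  from this [of "rep_tensor t"] show ?thesis
    by (simp add: abs_rep_tensor)
qed

lemma lin_ext_tensor_null:
  assumes "cbilinear f" and "x \<in> tensor_null"
  shows "lin_ext (\<lambda>(a, b). f a b) x = 0"
proof -
  have *: "clinear (\<lambda>a. f a b)" "clinear (f a)" for a b
    using assms(1) by (auto simp: cbilinear_def)
  show ?thesis
    using assms(2) by induction
      (simp_all add: clinear_add [OF *(1)] clinear_add [OF *(2)]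
        clinear_scaleC [OF *(1)] clinear_scaleC [OF *(2)])
qed

lemma tensor_lift_abs:
  assumes "cbilinear f"
  shows "tensor_lift f (abs_tensor x) = lin_ext (\<lambda>(a, b). f a b) x"
proof -
  have "rep_tensor (abs_tensor x) - x \<in> tensor_null"
    by (rule Quotient_rep_abs [OF Quotient_tensor]) (simp add: null_zero)
  from lin_ext_tensor_null [OF assms this] show ?thesis
    by (simp add: tensor_lift_def)
qed

lemma tensor_lift_tens [simp]: "cbilinear f \<Longrightarrow> tensor_lift f (a \<otimes> b) = f a b"
  by (simp add: tens.abs_eq tensor_lift_abs)

lemma clinear_tensor_lift: 
  assumes "cbilinear f"
  shows "clinear (tensor_lift f)"
proof -
  have "tensor_lift f (x + y) = tensor_lift f x + tensor_lift f y" for x y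
    using tensor_lift_abs [OF assms, of "rep_tensor x + rep_tensor y"]
    by (simp add: tensor_lift_def abs_rep_tensor flip: plus_tensor.abs_eq)
  moreover have "tensor_lift f (c *\<^sub>C x) = c *\<^sub>C tensor_lift f x" for c x
    using tensor_lift_abs [OF assms, of "c *\<^sub>C rep_tensor x"]
    by (simp add: tensor_lift_def abs_rep_tensor flip: scaleC_tensor.abs_eq)
  ultimately show ?thesis
    by (simp add: clinear_def)
qed

lemma clinear_eq_on_tens:
  assumes "clinear f" "clinear g" "\<And>a b. f (a \<otimes> b) = g (a \<otimes> b)"
  shows "f t = g t"
  by (induction t)
    (simp_all add: assms(3) clinear_add [OF assms(1)] clinear_add [OF assms(2)])

lemma tensor_lift_unique:
  assumes "clinear g" "\<And>a b. g (a \<otimes> b) = f a b"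
  shows "tensor_lift f t = g t"
proof -
  have "f = (\<lambda>a b. g (a \<otimes> b))"
    by (simp add: assms(2))
  moreover have "cbilinear (\<lambda>a b. g (a \<otimes> b))"
    unfolding cbilinear_def
    using clinear_compose [OF assms(1) clinear_tens_left] clinear_compose [OF assms(1) clinear_tens_right]
    by blast
  ultimately have f: "cbilinear f"
    by simp
  show ?thesis
    by (rule clinear_eq_on_tens [OF clinear_tensor_lift [OF f] assms(1)]) (simp add: f assms(2))
qed

lemma tensor_lift_add: "cbilinear f \<Longrightarrow> tensor_lift f (x + y) = tensor_lift f x + tensor_lift f y"
  and tensor_lift_scaleC: "cbilinear f \<Longrightarrow> tensor_lift f (c *\<^sub>C x) = c *\<^sub>C tensor_lift f x"
  by (rule clinear_add [OF clinear_tensor_lift] clinear_scaleC [OF clinear_tensor_lift]; assumption)+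


instantiation tensor :: (complex_algebra, complex_algebra) complex_algebra
begin

definition one_tensor :: "('a, 'b) tensor" where
  "one_tensor = 1 \<otimes> 1"

definition times_tensor :: "('a, 'b) tensor \<Rightarrow> ('a, 'b) tensor \<Rightarrow> ('a, 'b) tensor" where
  "times_tensor x y = tensor_lift (\<lambda>a b. tensor_lift (\<lambda>c d. (a * c) \<otimes> (b * d)) y) x"

lemma cbilinear_tens_mult: "cbilinear (\<lambda>c d. (a * c) \<otimes> (b * d))" for a :: 'a and b :: 'b
  by (simp add: cbilinear_def clinear_def distrib_left tens_linear)

lemma cbilinear_tens_mult2:
  "cbilinear (\<lambda>a b. tensor_lift (\<lambda>c d. (a * c) \<otimes> (b * d)) y)" for y :: "('a, 'b) tensor"
  by (induction y)
    (simp_all add: cbilinear_def clinear_def distrib_right tens_linear cbilinear_tens_mult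
      tensor_lift_add [OF cbilinear_tens_mult] scaleC_add_right algebra_simps)

lemma tens_mult_left: "(a \<otimes> b) * y = tensor_lift (\<lambda>c d. (a * c) \<otimes> (b * d)) y"
  for a :: 'a and b :: 'b
  unfolding times_tensor_def by (rule tensor_lift_tens [OF cbilinear_tens_mult2])

lemma tens_mult [simp]: "(a \<otimes> b) * (c \<otimes> d) = (a * c) \<otimes> (b * d)" for a c :: 'a and b d :: 'b
  unfolding tens_mult_left by (rule tensor_lift_tens [OF cbilinear_tens_mult])

instance
proof
  fix x y z :: "('a, 'b) tensor" and c :: complex
  show distr: "(x + y) * z = x * z + y * z" for x y z :: "('a, 'b) tensor"
    by (simp add: times_tensor_def tensor_lift_add cbilinear_tens_mult2)
  show scl: "(c *\<^sub>C x) * y = c *\<^sub>C (x * y)" for x y :: "('a, 'b) tensor"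
    by (simp add: times_tensor_def tensor_lift_scaleC cbilinear_tens_mult2)
  show distl: "x * (y + z) = x * y + x * z" for x y z :: "('a, 'b) tensor"
  proof (induction x)
    case (tens a b)
    then show ?case
      by (simp add: tens_mult_left cbilinear_tens_mult tensor_lift_add)
  qed (simp add: distr algebra_simps)
  show "x * (c *\<^sub>C y) = c *\<^sub>C (x * y)"
  proof (induction x)
    case (tens a b)
    then show ?case
      by (simp add: tens_mult_left cbilinear_tens_mult tensor_lift_scaleC)
  qed (simp add: distr scaleC_add_right)
  show "x * y * z = x * (y * z)"
  proof (induction x)
    case x: (tens a b)
    show ?case
    proof (induction y)
      case y: (tens c d)
      show ?case
        by (induction z) (simp_all add: mult.assoc distl)
    qed (simp add: distl distr)
  qed (simp add: distr)
  show "1 * x = x"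
    by (induction x) (simp_all add: one_tensor_def distl [unfolded one_tensor_def])
  show "x * 1 = x"
    by (induction x) (simp_all add: one_tensor_def distr [unfolded one_tensor_def])
qed

end

lemma tens_power: "(a \<otimes> b) ^ n = a ^ n \<otimes> b ^ n"
  for a :: "'a::complex_algebra" and b :: "'b::complex_algebra"
  by (induction n) (simp_all add: one_tensor_def)

section \<open>Algebras given by generators and relations\<close>

datatype 'g free_monoid = Word (letters: "'g list")

instantiation free_monoid :: (type) monoid_add
begin
definition "0 = Word []"
definition "u + v = Word (letters u @ letters v)"
instance
  by standard (simp_all add: zero_free_monoid_def plus_free_monoid_def)
end

type_synonym 'g free_algebra = "'g free_monoid \<Rightarrow>\<^sub>0 complex"

definition free_gen :: "'g \<Rightarrow> 'g free_algebra" where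
  "free_gen g = Poly_Mapping.single (Word [g]) 1"

inductive_set ideal_gen :: "'a::complex_algebra set \<Rightarrow> 'a set" for R where
  ideal_gen_base: "r \<in> R \<Longrightarrow> r \<in> ideal_gen R"
| ideal_gen_zero: "0 \<in> ideal_gen R"
| ideal_gen_add: "x \<in> ideal_gen R \<Longrightarrow> y \<in> ideal_gen R \<Longrightarrow> x + y \<in> ideal_gen R"
| ideal_gen_left: "x \<in> ideal_gen R \<Longrightarrow> a * x \<in> ideal_gen R"
| ideal_gen_right: "x \<in> ideal_gen R \<Longrightarrow> x * a \<in> ideal_gen R"

lemma ideal_gen_scaleC: "x \<in> ideal_gen R \<Longrightarrow> c *\<^sub>C x \<in> ideal_gen R"
  using ideal_gen_left [of x R "c *\<^sub>C 1"] by simp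

lemma ideal_gen_minus: "x \<in> ideal_gen R \<Longrightarrow> - x \<in> ideal_gen R"
  using ideal_gen_scaleC [of x R "-1"] by simp

text \<open>A type of generators determines its relators, so that one quotient construction
  serves all presentations.\<close>

class presentation =
  fixes relators :: "'a free_algebra set"

quotient_type (overloaded) 'g presented =
  "'g::presentation free_algebra" / "\<lambda>x y. x - y \<in> ideal_gen relators"
proof (rule equivpI)
  show "reflp (\<lambda>x y :: 'g free_algebra. x - y \<in> ideal_gen relators)"
    by (simp add: reflp_def ideal_gen_zero)
  show "symp (\<lambda>x y :: 'g free_algebra. x - y \<in> ideal_gen relators)"
    by (rule sympI) (drule ideal_gen_minus, simp)
  show "transp (\<lambda>x y :: 'g free_algebra. x - y \<in> ideal_gen relators)"
    by (rule transpI) (drule (1) ideal_gen_add, simp)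
qed

instantiation presented :: (presentation) complex_algebra
begin

lift_definition zero_presented :: "'a presented" is 0 .
lift_definition one_presented :: "'a presented" is 1 .

lift_definition plus_presented :: "'a presented \<Rightarrow> 'a presented \<Rightarrow> 'a presented" is "(+)"
  by (simp only: add_diff_add ideal_gen_add)

lift_definition uminus_presented :: "'a presented \<Rightarrow> 'a presented" is uminus
  by (drule ideal_gen_minus) simp

lift_definition minus_presented :: "'a presented \<Rightarrow> 'a presented \<Rightarrow> 'a presented" is "(-)"
proof -
  fix x y u v :: "'a free_algebra"
  assume "x - y \<in> ideal_gen relators" "u - v \<in> ideal_gen relators"
  then have "(x - y) + - (u - v) \<in> ideal_gen relators"
    by (intro ideal_gen_add ideal_gen_minus)
  then show "x - u - (y - v) \<in> ideal_gen relators"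
    by (simp add: algebra_simps)
qed

lift_definition times_presented :: "'a presented \<Rightarrow> 'a presented \<Rightarrow> 'a presented" is "(*)"
proof -
  fix x y u v :: "'a free_algebra"
  assume "x - y \<in> ideal_gen relators" "u - v \<in> ideal_gen relators"
  then have "(x - y) * u + y * (u - v) \<in> ideal_gen relators"
    by (intro ideal_gen_add ideal_gen_left ideal_gen_right)
  then show "x * u - y * v \<in> ideal_gen relators"
    by (simp add: algebra_simps)
qed

lift_definition scaleC_presented :: "complex \<Rightarrow> 'a presented \<Rightarrow> 'a presented" is scaleC
  by (simp add: ideal_gen_scaleC flip: scaleC_diff_right)

instance
  by standard
    (transfer; simp add: ideal_gen_zero scaleC_add_left scaleC_add_right algebra_simps)+

end

lift_definition gen :: "'g::presentation \<Rightarrow> 'g presented" is free_gen .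

text \<open>Extending an assignment of the generators to an algebra morphism, or to a linear
  antimultiplicative map. Both are meaningful only if the relators are sent to \<open>0\<close>.\<close>

definition free_lift :: "('g \<Rightarrow> 'b::complex_algebra) \<Rightarrow> 'g free_algebra \<Rightarrow> 'b" where
  "free_lift f = lin_ext (\<lambda>w. prod_list (map f (letters w)))"

definition free_antilift :: "('g \<Rightarrow> 'b::complex_algebra) \<Rightarrow> 'g free_algebra \<Rightarrow> 'b" where
  "free_antilift f = lin_ext (\<lambda>w. prod_list (map f (rev (letters w))))"

definition presented_lift :: "('g::presentation \<Rightarrow> 'b::complex_algebra) \<Rightarrow> 'g presented \<Rightarrow> 'b" where
  "presented_lift f x = free_lift f (rep_presented x)"

definition presented_antilift :: "('g::presentation \<Rightarrow> 'b::complex_algebra) \<Rightarrow> 'g presented \<Rightarrow> 'b" where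
  "presented_antilift f x = free_antilift f (rep_presented x)"

lemma alg_hom_free_lift: "alg_hom (free_lift f)"
proof -
  let ?F = "lin_ext (\<lambda>w. prod_list (map f (letters w)))"
  have single: "?F (Poly_Mapping.single u c * y) = ?F (Poly_Mapping.single u c) * ?F y" for u c y
    by (induction y rule: poly_mapping_single_induct)
      (simp_all add: distrib_left mult_single plus_free_monoid_def mult.commute)
  have "?F (x * y) = ?F x * ?F y" for x y
    by (induction x rule: poly_mapping_single_induct) (simp_all add: distrib_right single)
  moreover have "?F 1 = 1"
    by (simp add: zero_free_monoid_def flip: single_one)
  ultimately show ?thesis
    by (simp add: alg_hom_def free_lift_def clinear_lin_ext)
qed

lemma clinear_free_lift: "clinear (free_lift f)"
  and free_lift_one: "free_lift f 1 = 1"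
  and free_lift_mult: "free_lift f (x * y) = free_lift f x * free_lift f y"
  using alg_hom_free_lift [of f] by (simp_all add: alg_hom_def)

lemma clinear_free_antilift: "clinear (free_antilift f)"
  by (simp add: free_antilift_def clinear_lin_ext)

lemma free_antilift_one: "free_antilift f 1 = 1"
  by (simp add: free_antilift_def zero_free_monoid_def flip: single_one)

lemma free_antilift_mult: "free_antilift f (x * y) = free_antilift f y * free_antilift f x"
proof -
  let ?F = "lin_ext (\<lambda>w. prod_list (map f (rev (letters w))))"
  have single: "?F (Poly_Mapping.single u c * y) = ?F y * ?F (Poly_Mapping.single u c)" for u c y
    by (induction y rule: poly_mapping_single_induct)
      (simp_all add: distrib_left distrib_right mult_single plus_free_monoid_def mult.commute
        scaleC_add_right)
  have "?F (x * y) = ?F y * ?F x"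
    by (induction x rule: poly_mapping_single_induct) (simp_all add: distrib_right distrib_left single)
  then show ?thesis
    by (simp add: free_antilift_def)
qed

lemma free_lift_gen [simp]: "free_lift f (free_gen g) = f g"
  and free_antilift_gen [simp]: "free_antilift f (free_gen g) = f g"
  by (simp_all add: free_lift_def free_antilift_def free_gen_def)

lemmas free_lift_simps =
  free_lift_one free_lift_mult alg_hom_power [OF alg_hom_free_lift]
  clinear_add [OF clinear_free_lift] clinear_diff [OF clinear_free_lift]
  clinear_scaleC [OF clinear_free_lift]

lemma free_antilift_power: "free_antilift f (x ^ n) = free_antilift f x ^ n"
  by (induction n) (simp_all add: free_antilift_one free_antilift_mult power_commutes)

lemmas free_antilift_simps =
  free_antilift_one free_antilift_mult free_antilift_power
  clinear_add [OF clinear_free_antilift] clinear_diff [OF clinear_free_antilift]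
  clinear_scaleC [OF clinear_free_antilift]

lemma rep_abs_presented: "rep_presented (abs_presented x) - x \<in> ideal_gen relators"
  by (rule Quotient_rep_abs [OF Quotient_presented]) (simp add: ideal_gen_zero)

lemma abs_rep_presented: "abs_presented (rep_presented x) = x"
  by (rule Quotient_abs_rep [OF Quotient_presented])

lemma presented_relator: "r \<in> relators \<Longrightarrow> abs_presented r = 0"
  by (simp add: zero_presented_def Quotient_rel_abs [OF Quotient_presented] ideal_gen_base)

context
  fixes f :: "'g::presentation \<Rightarrow> 'b::complex_algebra"
begin

lemma presented_lift_abs:
  assumes "\<And>r. r \<in> relators \<Longrightarrow> free_lift f r = 0"
  shows "presented_lift f (abs_presented x) = free_lift f x"
proof -
  have "free_lift f r = 0" if "r \<in> ideal_gen relators" for r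
    using that
    by induction (simp_all add: assms free_lift_simps clinear_zero [OF clinear_free_lift])
  from this [OF rep_abs_presented [of x]] show ?thesis
    by (simp add: presented_lift_def free_lift_simps)
qed

lemma presented_antilift_abs:
  assumes "\<And>r. r \<in> relators \<Longrightarrow> free_antilift f r = 0"
  shows "presented_antilift f (abs_presented x) = free_antilift f x"
proof -
  have "free_antilift f r = 0" if "r \<in> ideal_gen relators" for r
    using that
    by induction (simp_all add: assms free_antilift_simps clinear_zero [OF clinear_free_antilift])
  from this [OF rep_abs_presented [of x]] show ?thesis
    by (simp add: presented_antilift_def free_antilift_simps)
qed

lemma alg_hom_presented_lift:
  assumes "\<And>r. r \<in> relators \<Longrightarrow> free_lift f r = 0"
  shows "alg_hom (presented_lift f)"
proof -
  note abs = presented_lift_abs [OF assms]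
  have *: "presented_lift f (abs_presented x + abs_presented y)
      = presented_lift f (abs_presented x) + presented_lift f (abs_presented y)"
    "presented_lift f (abs_presented x * abs_presented y)
      = presented_lift f (abs_presented x) * presented_lift f (abs_presented y)"
    "presented_lift f (c *\<^sub>C abs_presented x) = c *\<^sub>C presented_lift f (abs_presented x)" for x y c
    by (simp_all add: abs free_lift_simps plus_presented.abs_eq times_presented.abs_eq
        scaleC_presented.abs_eq)
  have "presented_lift f (x + y) = presented_lift f x + presented_lift f y" for x y
    using *(1) [of "rep_presented x" "rep_presented y"] by (simp add: abs_rep_presented)
  moreover have "presented_lift f (x * y) = presented_lift f x * presented_lift f y" for x y
    using *(2) [of "rep_presented x" "rep_presented y"] by (simp add: abs_rep_presented)
  moreover have "presented_lift f (c *\<^sub>C x) = c *\<^sub>C presented_lift f x" for c x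
    using *(3) [of c "rep_presented x"] by (simp add: abs_rep_presented)
  moreover have "presented_lift f 1 = 1"
    by (simp add: one_presented_def abs free_lift_simps)
  ultimately show ?thesis
    by (simp add: alg_hom_def clinear_def)
qed

lemma presented_lift_gen:
  assumes "\<And>r. r \<in> relators \<Longrightarrow> free_lift f r = 0"
  shows "presented_lift f (gen g) = f g"
  by (simp add: gen.abs_eq presented_lift_abs [OF assms])

lemma presented_antilift_gen:
  assumes "\<And>r. r \<in> relators \<Longrightarrow> free_antilift f r = 0"
  shows "presented_antilift f (gen g) = f g"
  by (simp add: gen.abs_eq presented_antilift_abs [OF assms])

lemma presented_antilift_antihom:
  assumes "\<And>r. r \<in> relators \<Longrightarrow> free_antilift f r = 0"
  shows "clinear (presented_antilift f)" and "presented_antilift f 1 = 1"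
    and "presented_antilift f (x * y) = presented_antilift f y * presented_antilift f x"
proof -
  note abs = presented_antilift_abs [OF assms]
  have *: "presented_antilift f (abs_presented x + abs_presented y)
      = presented_antilift f (abs_presented x) + presented_antilift f (abs_presented y)"
    "presented_antilift f (abs_presented x * abs_presented y)
      = presented_antilift f (abs_presented y) * presented_antilift f (abs_presented x)"
    "presented_antilift f (c *\<^sub>C abs_presented x) = c *\<^sub>C presented_antilift f (abs_presented x)" for x y c
    by (simp_all add: abs free_antilift_simps plus_presented.abs_eq times_presented.abs_eq
        scaleC_presented.abs_eq)
  show "presented_antilift f 1 = 1"
    by (simp add: one_presented_def abs free_antilift_simps)
  show "presented_antilift f (x * y) = presented_antilift f y * presented_antilift f x"
    using *(2) [of "rep_presented x" "rep_presented y"] by (simp add: abs_rep_presented)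
  have "presented_antilift f (x + y) = presented_antilift f x + presented_antilift f y" for x y
    using *(1) [of "rep_presented x" "rep_presented y"] by (simp add: abs_rep_presented)
  moreover have "presented_antilift f (c *\<^sub>C x) = c *\<^sub>C presented_antilift f x" for c x
    using *(3) [of c "rep_presented x"] by (simp add: abs_rep_presented)
  ultimately show "clinear (presented_antilift f)"
    by (simp add: clinear_def)
qed

end


section \<open>Hopf algebras and Yetter--Drinfeld module algebras\<close>

locale hopf_algebra =
  fixes comult :: "'h::complex_algebra \<Rightarrow> ('h, 'h) tensor"
    and counit :: "'h \<Rightarrow> complex"
    and antipode :: "'h \<Rightarrow> 'h"
  assumes comult_hom: "alg_hom comult"
    and counit_hom: "alg_hom counit"
    and antipode_linear: "clinear antipode"
    and coassoc: "tensor_lift (\<lambda>a b. tensor_lift (\<lambda>c d. c \<otimes> (d \<otimes> b)) (comult a)) (comult h)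
      = tensor_lift (\<lambda>a b. a \<otimes> comult b) (comult h)"
    and counit_left: "tensor_lift (\<lambda>a b. counit a *\<^sub>C b) (comult h) = h"
    and counit_right: "tensor_lift (\<lambda>a b. counit b *\<^sub>C a) (comult h) = h"
    and antipode_left: "tensor_lift (\<lambda>a b. antipode a * b) (comult h) = counit h *\<^sub>C 1"
    and antipode_right: "tensor_lift (\<lambda>a b. a * antipode b) (comult h) = counit h *\<^sub>C 1"

locale left_module_algebra =
  fixes comult :: "'h::complex_algebra \<Rightarrow> ('h, 'h) tensor"
    and counit :: "'h \<Rightarrow> complex"
    and act :: "'h \<Rightarrow> 'x::complex_algebra \<Rightarrow> 'x"
  assumes act_bilinear: "cbilinear act"
    and act_one_left: "act 1 x = x"
    and act_mult_left: "act (g * h) x = act g (act h x)"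
    and act_mult: "act h (x * y) = tensor_lift (\<lambda>h' h''. act h' x * act h'' y) (comult h)"
    and act_one: "act h 1 = counit h *\<^sub>C 1"

locale left_comodule_algebra =
  fixes comult :: "'h::complex_algebra \<Rightarrow> ('h, 'h) tensor"
    and counit :: "'h \<Rightarrow> complex"
    and coact :: "'x::complex_algebra \<Rightarrow> ('h, 'x) tensor"
  assumes coact_hom: "alg_hom coact"
    and coact_coassoc:
      "tensor_lift (\<lambda>a y. tensor_lift (\<lambda>c d. c \<otimes> (d \<otimes> y)) (comult a)) (coact x)
      = tensor_lift (\<lambda>a y. a \<otimes> coact y) (coact x)"
    and coact_counit: "tensor_lift (\<lambda>a y. counit a *\<^sub>C y) (coact x) = x"

locale yetter_drinfeld_module_algebra =
  hopf_algebra comult counit antipode +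
  left_module_algebra comult counit act +
  left_comodule_algebra comult counit coact
  for comult :: "'h::complex_algebra \<Rightarrow> ('h, 'h) tensor"
    and counit :: "'h \<Rightarrow> complex"
    and antipode :: "'h \<Rightarrow> 'h"
    and act :: "'h \<Rightarrow> 'x::complex_algebra \<Rightarrow> 'x"
    and coact :: "'x \<Rightarrow> ('h, 'x) tensor" +
  assumes yetter_drinfeld:
    "tensor_lift (\<lambda>h' h''. tensor_lift (\<lambda>a y. (a * h'') \<otimes> y) (coact (act h' x))) (comult h)
      = tensor_lift (\<lambda>h' h''. tensor_lift (\<lambda>a y. (h' * a) \<otimes> act h'' y) (coact x)) (comult h)"

locale braided_commutative_yetter_drinfeld_module_algebra =
  yetter_drinfeld_module_algebra +
  assumes braided_commutative: "y * x = tensor_lift (\<lambda>a y\<^sub>0. act a x * y\<^sub>0) (coact y)"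

section \<open>The quantum group\<close>

definition qpow :: "nat \<Rightarrow> real \<Rightarrow> complex" where
  "qpow p x = cis (pi * x / real p)"

definition qnum :: "nat \<Rightarrow> real \<Rightarrow> complex" where
  "qnum p x = (qpow p x - qpow p (- x)) / (qpow p 1 - qpow p (- 1))"

definition qfact :: "nat \<Rightarrow> nat \<Rightarrow> complex" where
  "qfact p n = (\<Prod>k=1..n. qnum p (real k))"

definition qbinom :: "nat \<Rightarrow> nat \<Rightarrow> nat \<Rightarrow> complex" where
  "qbinom p m s = qfact p m / (qfact p s * qfact p (m - s))"

lemma qpow_zero [simp]: "qpow p 0 = 1"
  and qpow_add: "qpow p (x + y) = qpow p x * qpow p y"
  by (simp_all add: qpow_def cis_mult add_divide_distrib distrib_left)

lemma qpow_mult_minus [simp]: "qpow p x * qpow p (- x) = 1" "qpow p (- x) * qpow p x = 1"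
  by (simp_all flip: qpow_add)

lemma qpow_nonzero [simp]: "qpow p x \<noteq> 0"
  by (simp add: qpow_def)

lemma qpow_power: "qpow p x ^ n = qpow p (real n * x)"
  by (simp add: qpow_def DeMoivre mult_ac)

text \<open>The parameter \<open>p\<close> of the quantum group is \<open>CARD('p)\<close>.\<close>

datatype 'p Uq_gen = Gen_E | Gen_F | Gen_K | Gen_Kinv

instantiation Uq_gen :: (finite) presentation
begin
definition relators_Uq_gen :: "'a Uq_gen free_algebra set" where
  "relators_Uq_gen =
    (let p = CARD('a); E = free_gen Gen_E; F = free_gen Gen_F; K = free_gen Gen_K;
         Kinv = free_gen Gen_Kinv
     in {K * Kinv - 1, Kinv * K - 1,
         K * E * Kinv - qpow p 2 *\<^sub>C E,
         K * F * Kinv - qpow p (- 2) *\<^sub>C F,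
         E * F - F * E - (1 / (qpow p 1 - qpow p (- 1))) *\<^sub>C (K - Kinv),
         E ^ p, F ^ p, K ^ (2 * p) - 1})"
instance ..
end

type_synonym 'p Uq = "'p Uq_gen presented"

abbreviation Uq_E :: "'p::finite Uq" where "Uq_E \<equiv> gen Gen_E"
abbreviation Uq_F :: "'p::finite Uq" where "Uq_F \<equiv> gen Gen_F"
abbreviation Uq_K :: "'p::finite Uq" where "Uq_K \<equiv> gen Gen_K"
abbreviation Uq_Kinv :: "'p::finite Uq" where "Uq_Kinv \<equiv> gen Gen_Kinv"

definition Uq_comult :: "'p::finite Uq \<Rightarrow> ('p Uq, 'p Uq) tensor" where
  "Uq_comult = presented_lift (\<lambda>g. case g of
      Gen_E \<Rightarrow> Uq_E \<otimes> Uq_K + 1 \<otimes> Uq_E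
    | Gen_F \<Rightarrow> Uq_F \<otimes> 1 + Uq_Kinv \<otimes> Uq_F
    | Gen_K \<Rightarrow> Uq_K \<otimes> Uq_K
    | Gen_Kinv \<Rightarrow> Uq_Kinv \<otimes> Uq_Kinv)"

definition Uq_counit :: "'p::finite Uq \<Rightarrow> complex" where
  "Uq_counit = presented_lift (\<lambda>g. case g of
      Gen_E \<Rightarrow> 0 | Gen_F \<Rightarrow> 0 | Gen_K \<Rightarrow> 1 | Gen_Kinv \<Rightarrow> 1)"

definition Uq_antipode :: "'p::finite Uq \<Rightarrow> 'p Uq" where
  "Uq_antipode = presented_antilift (\<lambda>g. case g of
      Gen_E \<Rightarrow> - (Uq_E * Uq_Kinv)
    | Gen_F \<Rightarrow> - (Uq_K * Uq_F)
    | Gen_K \<Rightarrow> Uq_Kinv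
    | Gen_Kinv \<Rightarrow> Uq_K)"

subsection \<open>The structure maps are well defined\<close>

lemma Uq_relations:
  fixes E F K Kinv :: "'p::finite Uq"
  defines "E \<equiv> Uq_E" and "F \<equiv> Uq_F" and "K \<equiv> Uq_K" and "Kinv \<equiv> Uq_Kinv"
  shows "K * Kinv = 1" "Kinv * K = 1"
    "K * E * Kinv = qpow CARD('p) 2 *\<^sub>C E"
    "K * F * Kinv = qpow CARD('p) (- 2) *\<^sub>C F"
    "E * F - F * E = (1 / (qpow CARD('p) 1 - qpow CARD('p) (- 1))) *\<^sub>C (K - Kinv)"
    "E ^ CARD('p) = 0" "F ^ CARD('p) = 0" "K ^ (2 * CARD('p)) = 1"
proof -
  have power: "abs_presented x ^ n = abs_presented (x ^ n)"
    for x :: "'p Uq_gen free_algebra" and n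
    by (induction n) (simp_all add: one_presented_def times_presented.abs_eq)
  note abs = gen.abs_eq power one_presented_def minus_presented.abs_eq
    times_presented.abs_eq scaleC_presented.abs_eq
  have rel: "abs_presented r = 0" if "r \<in> relators" for r :: "'p Uq_gen free_algebra"
    using that by (rule presented_relator)
  note rel = rel [unfolded relators_Uq_gen_def Let_def]
  have "K * Kinv - 1 = 0" "Kinv * K - 1 = 0"
    "K * E * Kinv - qpow CARD('p) 2 *\<^sub>C E = 0"
    "K * F * Kinv - qpow CARD('p) (- 2) *\<^sub>C F = 0"
    "E * F - F * E - (1 / (qpow CARD('p) 1 - qpow CARD('p) (- 1))) *\<^sub>C (K - Kinv) = 0"
    "E ^ CARD('p) = 0" "F ^ CARD('p) = 0" "K ^ (2 * CARD('p)) - 1 = 0"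
    unfolding E_def F_def K_def Kinv_def abs by (rule rel; blast)+
  then show "K * Kinv = 1" "Kinv * K = 1"
    "K * E * Kinv = qpow CARD('p) 2 *\<^sub>C E"
    "K * F * Kinv = qpow CARD('p) (- 2) *\<^sub>C F"
    "E * F - F * E = (1 / (qpow CARD('p) 1 - qpow CARD('p) (- 1))) *\<^sub>C (K - Kinv)"
    "E ^ CARD('p) = 0" "F ^ CARD('p) = 0" "K ^ (2 * CARD('p)) = 1"
    by (simp_all only: right_minus_eq)
qed

text \<open>The \<open>q\<close>-binomial theorem at a root of unity of exact order \<open>p\<close>.\<close>

fun gauss_coeff :: "complex \<Rightarrow> nat \<Rightarrow> nat \<Rightarrow> complex" where
  "gauss_coeff r n 0 = 1"
| "gauss_coeff r 0 (Suc k) = 0"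
| "gauss_coeff r (Suc n) (Suc k) = gauss_coeff r n k + r ^ Suc k * gauss_coeff r n (Suc k)"

lemma gauss_coeff_0: "n < k \<Longrightarrow> gauss_coeff r n k = 0"
  by (induction r n k rule: gauss_coeff.induct) auto

lemma gauss_coeff_diag [simp]: "gauss_coeff r n n = 1"
  by (induction n) (simp_all add: gauss_coeff_0)

lemma gauss_coeff_absorb:
  "k \<le> n \<Longrightarrow> (1 - r ^ Suc k) * gauss_coeff r n (Suc k) = (1 - r ^ (n - k)) * gauss_coeff r n k"
proof (induction n arbitrary: k)
  case 0
  then show ?case by simp
next
  case (Suc n)
  show ?case
  proof (cases k)
    case 0
    then have "(1 - r ^ Suc k) * gauss_coeff r (Suc n) (Suc k)
      = (1 - r) + r * ((1 - r ^ Suc 0) * gauss_coeff r n (Suc 0))"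
      by (simp add: algebra_simps)
    also have "\<dots> = 1 - r ^ Suc n"
      by (subst Suc.IH) (simp_all add: algebra_simps)
    finally show ?thesis using 0 by simp
  next
    case (Suc j)
    show ?thesis
    proof (cases "k \<le> n")
      case True
      define a b where "a = gauss_coeff r n j" and "b = gauss_coeff r n k"
      obtain m where m: "n = k + m" using True le_iff_add by blast
      have 1: "(1 - r ^ k) * b = (1 - r ^ Suc m) * a"
        using Suc.IH [of j] True Suc m by (simp add: a_def b_def)
      have 2: "(1 - r ^ Suc k) * gauss_coeff r n (Suc k) = (1 - r ^ m) * b"
        using Suc.IH [of k] True m by (simp add: b_def)
      have "(1 - r ^ Suc k) * gauss_coeff r (Suc n) (Suc k)
        = (1 - r ^ Suc k) * b + r ^ Suc k * ((1 - r ^ Suc k) * gauss_coeff r n (Suc k))"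
        by (simp add: b_def algebra_simps)
      also have "\<dots> = (1 - r ^ Suc k) * b + r ^ Suc k * ((1 - r ^ m) * b)"
        by (simp only: 2)
      also have "\<dots> = (1 - r ^ k) * b + r ^ k * ((1 - r ^ Suc m) * b)"
        by (simp add: algebra_simps)
      also have "\<dots> = (1 - r ^ Suc m) * (a + r ^ k * b)"
        unfolding 1 by (simp only: algebra_simps)
      also have "\<dots> = (1 - r ^ (Suc n - k)) * gauss_coeff r (Suc n) k"
        using m Suc by (simp add: a_def b_def Suc_diff_le)
      finally show ?thesis .
    next
      case False
      then have "k = Suc n" using Suc.prems by simp
      then show ?thesis by (simp add: gauss_coeff_0)
    qed
  qed
qed

lemma gauss_coeff_root:
  assumes "r ^ p = 1" and "\<And>k. 0 < k \<Longrightarrow> k < p \<Longrightarrow> r ^ k \<noteq> 1" and "0 < k" "k < p"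
  shows "gauss_coeff r p k = 0"
  using assms(3,4)
proof (induction k)
  case (Suc k)
  have "(1 - r ^ (p - k)) * gauss_coeff r p k = 0"
    using assms(1) Suc by (cases "k = 0") simp_all
  then have "(1 - r ^ Suc k) * gauss_coeff r p (Suc k) = 0"
    using gauss_coeff_absorb [of k p r] Suc.prems by simp
  then show ?case
    using assms(2) [of "Suc k"] Suc.prems by simp
qed simp

lemma q_commute_power:
  fixes A B :: "'a::complex_algebra"
  assumes "B * A = r *\<^sub>C (A * B)"
  shows "B * A ^ n = r ^ n *\<^sub>C (A ^ n * B)"
proof (induction n)
  case (Suc n)
  have "B * A ^ Suc n = (B * A) * A ^ n"
    by (simp add: mult.assoc)
  also have "\<dots> = r *\<^sub>C (A * (B * A ^ n))"
    by (simp add: assms mult.assoc)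
  finally show ?case
    by (simp add: Suc mult.assoc)
qed simp

lemma q_binomial:
  fixes A B :: "'a::complex_algebra"
  assumes "B * A = r *\<^sub>C (A * B)"
  shows "(A + B) ^ n = (\<Sum>k\<le>n. gauss_coeff r n k *\<^sub>C (A ^ k * B ^ (n - k)))"
proof (induction n)
  case (Suc n)
  let ?G = "gauss_coeff r"
  have B: "B * (A ^ k * B ^ (n - k)) = r ^ k *\<^sub>C (A ^ k * B ^ (Suc n - k))" if "k \<le> n" for k
    using q_commute_power [OF assms, of k] that by (simp add: Suc_diff_le flip: mult.assoc)
  have "(A + B) ^ Suc n = (\<Sum>k\<le>n. ?G n k *\<^sub>C (A ^ Suc k * B ^ (n - k)))
      + (\<Sum>k\<le>n. ?G n k *\<^sub>C (B * (A ^ k * B ^ (n - k))))"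
    by (simp add: Suc distrib_right sum_distrib_left mult.assoc scaleC_add_right sum.distrib)
  also have "(\<Sum>k\<le>n. ?G n k *\<^sub>C (B * (A ^ k * B ^ (n - k))))
      = (\<Sum>k\<le>n. (r ^ k * ?G n k) *\<^sub>C (A ^ k * B ^ (Suc n - k)))"
    by (intro sum.cong refl) (simp add: B mult.commute)
  also have "\<dots> = (\<Sum>k\<le>Suc n. (r ^ k * ?G n k) *\<^sub>C (A ^ k * B ^ (Suc n - k)))"
    by (simp add: gauss_coeff_0)
  also have "\<dots> = B ^ Suc n + (\<Sum>k\<le>n. (r ^ Suc k * ?G n (Suc k)) *\<^sub>C (A ^ Suc k * B ^ (n - k)))"
    by (subst sum.atMost_Suc_shift) simp
  finally show ?case
    by (subst sum.atMost_Suc_shift) (simp add: sum.distrib scaleC_add_left algebra_simps)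
qed simp

lemma q_freshman:
  fixes A B :: "'a::complex_algebra"
  assumes "B * A = r *\<^sub>C (A * B)" and "r ^ p = 1" and "\<And>k. 0 < k \<Longrightarrow> k < p \<Longrightarrow> r ^ k \<noteq> 1"
    and "0 < p"
  shows "(A + B) ^ p = A ^ p + B ^ p"
proof -
  have "(A + B) ^ p = (\<Sum>k\<le>p. gauss_coeff r p k *\<^sub>C (A ^ k * B ^ (p - k)))"
    by (rule q_binomial [OF assms(1)])
  also have "\<dots> = (\<Sum>k\<in>{0, p}. gauss_coeff r p k *\<^sub>C (A ^ k * B ^ (p - k)))"
  proof (rule sum.mono_neutral_right)
    show "\<forall>k\<in>{..p} - {0, p}. gauss_coeff r p k *\<^sub>C (A ^ k * B ^ (p - k)) = 0"
      by (auto simp: gauss_coeff_root [OF assms(2,3)])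
  qed auto
  finally show ?thesis
    using assms(4) by (simp add: add.commute)
qed

lemma q_commute_mult_power:
  fixes A B :: "'a::complex_algebra"
  assumes "B * A = r *\<^sub>C (A * B)"
  shows "\<exists>c. (A * B) ^ n = c *\<^sub>C (A ^ n * B ^ n)"
proof (induction n)
  case 0
  show ?case by (rule exI [of _ 1]) simp
next
  case (Suc n)
  then obtain c where c: "(A * B) ^ n = c *\<^sub>C (A ^ n * B ^ n)" by blast
  have "(A * B) ^ Suc n = c *\<^sub>C (A * (B * A ^ n) * B ^ n)"
    by (simp add: c mult.assoc)
  also have "\<dots> = (c * r ^ n) *\<^sub>C (A ^ Suc n * B ^ Suc n)"
    by (simp add: q_commute_power [OF assms] mult.assoc)
  finally show ?case by blast
qed

lemma qpow_2_order:
  assumes "0 < p"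
  shows "qpow p 2 ^ p = 1" "qpow p (- 2) ^ p = 1"
    and "0 < k \<Longrightarrow> k < p \<Longrightarrow> qpow p 2 ^ k \<noteq> 1"
    and "0 < k \<Longrightarrow> k < p \<Longrightarrow> qpow p (- 2) ^ k \<noteq> 1"
proof -
  show 1: "qpow p 2 ^ p = 1"
    using assms by (simp add: qpow_power) (simp add: qpow_def mult.commute [of pi])
  have inv: "qpow p (- 2) ^ n = inverse (qpow p 2 ^ n)" for n
    using qpow_mult_minus(1) [of p 2] by (metis inverse_unique power_inverse)
  then show "qpow p (- 2) ^ p = 1"
    by (simp add: 1)
  show 2: "qpow p 2 ^ k \<noteq> 1" if "0 < k" "k < p" for k
  proof
    assume "qpow p 2 ^ k = 1"
    then have "cis (2 * pi * (real k / real p)) = 1"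
      by (simp add: qpow_power) (simp add: qpow_def mult_ac)
    then have "cos (2 * pi * (real k / real p)) = 1"
      by (metis cis.simps(1) one_complex.simps(1))
    then obtain n :: int where "2 * pi * (real k / real p) = of_int n * 2 * pi"
      using cos_one_2pi_int by blast
    then have "2 * pi * (real k / real p) = 2 * pi * of_int n"
      by (simp only: mult_ac)
    then have "real k / real p = of_int n"
      using pi_gt_zero by (simp only: mult_cancel_left) simp
    moreover have "0 < real k / real p" "real k / real p < 1"
      using that by simp_all
    ultimately have "0 < n" "n < 1"
      by (simp_all only: of_int_0_less_iff of_int_less_1_iff)
    then show False
      by simp
  qed
  then show "qpow p (- 2) ^ k \<noteq> 1" if "0 < k" "k < p" for k
    using that by (simp add: inv)
qed

lemma Uq_commute:
  fixes E F K Kinv :: "'p::finite Uq"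
  defines "E \<equiv> Uq_E" and "F \<equiv> Uq_F" and "K \<equiv> Uq_K" and "Kinv \<equiv> Uq_Kinv"
  shows "K * E = qpow CARD('p) 2 *\<^sub>C (E * K)" "K * F = qpow CARD('p) (- 2) *\<^sub>C (F * K)"
    "E * K = qpow CARD('p) (- 2) *\<^sub>C (K * E)" "F * K = qpow CARD('p) 2 *\<^sub>C (K * F)"
    "Kinv * E = qpow CARD('p) (- 2) *\<^sub>C (E * Kinv)" "Kinv * F = qpow CARD('p) 2 *\<^sub>C (F * Kinv)"
    "E * Kinv = qpow CARD('p) 2 *\<^sub>C (Kinv * E)" 
proof -
  note rel = Uq_relations [where 'p = 'p, folded E_def F_def K_def Kinv_def]
  show 1: "K * E = qpow CARD('p) 2 *\<^sub>C (E * K)" "K * F = qpow CARD('p) (- 2) *\<^sub>C (F * K)"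
    using arg_cong [OF rel(3), of "\<lambda>x. x * K"] arg_cong [OF rel(4), of "\<lambda>x. x * K"]
    by (simp_all add: mult.assoc rel(2))
  show "E * K = qpow CARD('p) (- 2) *\<^sub>C (K * E)" "F * K = qpow CARD('p) 2 *\<^sub>C (K * F)"
    by (simp_all add: 1)
  show 2: "E * Kinv = qpow CARD('p) 2 *\<^sub>C (Kinv * E)"
    using arg_cong [OF rel(3), of "\<lambda>x. Kinv * x"] 
    by (simp add: rel(2) flip: mult.assoc)
  have 3: "F * Kinv = qpow CARD('p) (- 2) *\<^sub>C (Kinv * F)"
    using arg_cong [OF rel(4), of "\<lambda>x. Kinv * x"] 
    by (simp add: rel(2) flip: mult.assoc)
  show "Kinv * E = qpow CARD('p) (- 2) *\<^sub>C (E * Kinv)" "Kinv * F = qpow CARD('p) 2 *\<^sub>C (F * Kinv)"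
    by (simp_all add: 2 3)
qed

lemma Uq_counit_well_defined:
  shows "alg_hom (Uq_counit :: 'p::finite Uq \<Rightarrow> complex)"
    and "Uq_counit (Uq_E :: 'p Uq) = 0" "Uq_counit (Uq_F :: 'p Uq) = 0"
    and "Uq_counit (Uq_K :: 'p Uq) = 1" "Uq_counit (Uq_Kinv :: 'p Uq) = 1"
proof -
  let ?f = "\<lambda>g :: 'p Uq_gen. case g of
      Gen_E \<Rightarrow> 0 :: complex | Gen_F \<Rightarrow> 0 | Gen_K \<Rightarrow> 1 | Gen_Kinv \<Rightarrow> 1"
  have *: "free_lift ?f r = 0" if "r \<in> relators" for r
    using that by (auto simp: relators_Uq_gen_def Let_def free_lift_simps)
  show "alg_hom (Uq_counit :: 'p::finite Uq \<Rightarrow> complex)"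
    unfolding Uq_counit_def by (rule alg_hom_presented_lift [OF *])
  show "Uq_counit (Uq_E :: 'p Uq) = 0" "Uq_counit (Uq_F :: 'p Uq) = 0"
    "Uq_counit (Uq_K :: 'p Uq) = 1" "Uq_counit (Uq_Kinv :: 'p Uq) = 1"
    unfolding Uq_counit_def by (simp_all add: presented_lift_gen [OF *])
qed

lemma Uq_comult_well_defined:
  shows "alg_hom (Uq_comult :: 'p::finite Uq \<Rightarrow> _)"
    and "Uq_comult (Uq_E :: 'p Uq) = Uq_E \<otimes> Uq_K + 1 \<otimes> Uq_E"
    and "Uq_comult (Uq_F :: 'p Uq) = Uq_F \<otimes> 1 + Uq_Kinv \<otimes> Uq_F"
    and "Uq_comult (Uq_K :: 'p Uq) = Uq_K \<otimes> Uq_K"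
    and "Uq_comult (Uq_Kinv :: 'p Uq) = Uq_Kinv \<otimes> Uq_Kinv"
proof -
  define E F K Kinv :: "'p Uq" where "E = Uq_E" "F = Uq_F" "K = Uq_K" "Kinv = Uq_Kinv"
  note defs = this
  note rel = Uq_relations [where 'p = 'p, folded defs] Uq_commute [where 'p = 'p, folded defs]
  define p where "p = CARD('p)"
  have p: "0 < p" by (simp add: p_def)
  let ?E = "E \<otimes> K + 1 \<otimes> E" and ?F = "F \<otimes> 1 + Kinv \<otimes> F"
    and ?K = "K \<otimes> K" and ?Kinv = "Kinv \<otimes> Kinv"
  let ?f = "\<lambda>g :: 'p Uq_gen. case g of
      Gen_E \<Rightarrow> ?E | Gen_F \<Rightarrow> ?F | Gen_K \<Rightarrow> ?K | Gen_Kinv \<Rightarrow> ?Kinv"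
  have KKKinv: "K * K * Kinv = K"
    by (simp add: rel(1) mult.assoc)
  have "?K * ?Kinv = 1" "?Kinv * ?K = 1"
    by (simp_all add: rel one_tensor_def)
  moreover have "?K * ?E * ?Kinv = qpow p 2 *\<^sub>C ?E" "?K * ?F * ?Kinv = qpow p (- 2) *\<^sub>C ?F"
    by (simp_all add: rel(1-4) KKKinv distrib_left distrib_right tens_linear scaleC_add_right p_def)
  moreover have "?E * ?F - ?F * ?E = (1 / (qpow p 1 - qpow p (- 1))) *\<^sub>C (?K - ?Kinv)"
  proof -
    let ?c = "1 / (qpow p 1 - qpow p (- 1))"
    have "(E * Kinv) \<otimes> (K * F) = (Kinv * E) \<otimes> (F * K)"
      by (simp add: rel(10,15) tens_linear)
    then have "?E * ?F - ?F * ?E = (E * F - F * E) \<otimes> K + Kinv \<otimes> (E * F - F * E)"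
      by (simp add: distrib_left distrib_right tens_linear)
    also have "\<dots> = ?c *\<^sub>C (?K - ?Kinv)"
      by (simp add: rel(5) tens_linear scaleC_diff_right p_def)
    finally show ?thesis .
  qed
  moreover have "?E ^ p = 0"
  proof -
    have "?E ^ p = (E \<otimes> K) ^ p + (1 \<otimes> E) ^ p"
      by (rule q_freshman [where r = "qpow p (- 2)"])
        (simp_all add: rel(11) tens_linear p qpow_2_order flip: p_def)
    also have "\<dots> = 0"
      using p rel(6) by (simp add: tens_power tens_linear p_def)
    finally show ?thesis .
  qed
  moreover have "?F ^ p = 0"
  proof -
    have "?F ^ p = (F \<otimes> 1) ^ p + (Kinv \<otimes> F) ^ p"
      by (rule q_freshman [where r = "qpow p 2"])
        (simp_all add: rel(14) tens_linear p qpow_2_order flip: p_def)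
    also have "\<dots> = 0"
      using p rel(7) by (simp add: tens_power tens_linear p_def)
    finally show ?thesis .
  qed
  moreover have "?K ^ (2 * p) = 1"
    using rel(8) by (simp add: tens_power one_tensor_def p_def)
  ultimately have *: "free_lift ?f r = 0" if "r \<in> relators" for r
    using that unfolding relators_Uq_gen_def Let_def p_def
    by (auto simp: free_lift_simps)
  have def: "Uq_comult = presented_lift ?f"
    unfolding Uq_comult_def defs by (rule refl)
  show "alg_hom (Uq_comult :: 'p::finite Uq \<Rightarrow> _)"
    unfolding def by (rule alg_hom_presented_lift [OF *])
  have val: "presented_lift ?f (gen g) = ?f g" for g
    by (rule presented_lift_gen [OF *])
  show "Uq_comult (Uq_E :: 'p Uq) = Uq_E \<otimes> Uq_K + 1 \<otimes> Uq_E"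
    "Uq_comult (Uq_F :: 'p Uq) = Uq_F \<otimes> 1 + Uq_Kinv \<otimes> Uq_F"
    "Uq_comult (Uq_K :: 'p Uq) = Uq_K \<otimes> Uq_K"
    "Uq_comult (Uq_Kinv :: 'p Uq) = Uq_Kinv \<otimes> Uq_Kinv"
    using val [of Gen_E] val [of Gen_F] val [of Gen_K] val [of Gen_Kinv]
    unfolding def by (simp_all only: defs Uq_gen.case)
qed

lemma Uq_antipode_well_defined:
  shows "clinear (Uq_antipode :: 'p::finite Uq \<Rightarrow> _)"
    and "Uq_antipode (1 :: 'p Uq) = 1"
    and "Uq_antipode (x * y :: 'p Uq) = Uq_antipode y * Uq_antipode x"
    and "Uq_antipode (Uq_E :: 'p Uq) = - (Uq_E * Uq_Kinv)"
    and "Uq_antipode (Uq_F :: 'p Uq) = - (Uq_K * Uq_F)"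
    and "Uq_antipode (Uq_K :: 'p Uq) = Uq_Kinv"
    and "Uq_antipode (Uq_Kinv :: 'p Uq) = Uq_K"
proof -
  define E F K Kinv :: "'p Uq" where "E = Uq_E" "F = Uq_F" "K = Uq_K" "Kinv = Uq_Kinv"
  note defs = this
  note rel = Uq_relations [where 'p = 'p, folded defs] Uq_commute [where 'p = 'p, folded defs]
  define p where "p = CARD('p)"
  let ?f = "\<lambda>g :: 'p Uq_gen. case g of
      Gen_E \<Rightarrow> - (E * Kinv) | Gen_F \<Rightarrow> - (K * F) | Gen_K \<Rightarrow> Kinv | Gen_Kinv \<Rightarrow> K"
  have KKinv: "K * (Kinv * x) = x" "Kinv * (K * x) = x" for x
    by (simp_all add: rel(1,2) flip: mult.assoc)
  have "K * - (E * Kinv) * Kinv = qpow p 2 *\<^sub>C - (E * Kinv)"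
    using rel(3) by (simp add: p_def flip: mult.assoc)
  moreover have "K * - (K * F) * Kinv = qpow p (- 2) *\<^sub>C - (K * F)"
    using rel(4) by (simp add: p_def mult.assoc)
  moreover have "K * F * (E * Kinv) - E * Kinv * (K * F)
      = (1 / (qpow p 1 - qpow p (- 1))) *\<^sub>C (Kinv - K)"
  proof -
    have "K * F * (E * Kinv) = (K * F * Kinv) * (K * E * Kinv)"
      by (simp add: mult.assoc KKinv)
    also have "\<dots> = F * E"
      by (simp add: rel(3,4))
    finally have "K * F * (E * Kinv) - E * Kinv * (K * F) = - (E * F - F * E)"
      by (simp add: mult.assoc KKinv)
    then show ?thesis
      by (simp add: rel(5) p_def scaleC_diff_right)
  qed
  moreover have "(- (E * Kinv)) ^ p = 0" "(- (K * F)) ^ p = 0"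
  proof -
    have neg: "(- x) ^ n = 0" if "x ^ n = 0" for x :: "'p Uq" and n
    proof -
      have "(- x) ^ n = x ^ n \<or> (- x) ^ n = - (x ^ n)" for n
        by (induction n) auto
      from this [of n] that show ?thesis by auto
    qed
    show "(- (E * Kinv)) ^ p = 0"
      using q_commute_mult_power [OF rel(13), of p] rel(6) by (intro neg) (auto simp: p_def)
    show "(- (K * F)) ^ p = 0"
      using q_commute_mult_power [OF rel(12), of p] rel(7) by (intro neg) (auto simp: p_def)
  qed
  moreover have "Kinv ^ (2 * p) = 1"
  proof -
    have "K ^ n * Kinv ^ n = 1" for n
    proof (induction n)
      case (Suc n)
      have "K ^ Suc n * Kinv ^ Suc n = K ^ n * (K * (Kinv * Kinv ^ n))"
        by (simp add: power_Suc2 mult.assoc flip: power_Suc)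
      then show ?case by (simp add: KKinv Suc)
    qed simp
    from this [of "2 * p"] show ?thesis by (simp add: rel(8) p_def)
  qed
  ultimately have *: "free_antilift ?f r = 0" if "r \<in> relators" for r
    using that rel(1,2) unfolding relators_Uq_gen_def Let_def p_def
    by (auto simp: free_antilift_simps mult.assoc)
  have def: "Uq_antipode = presented_antilift ?f"
    unfolding Uq_antipode_def defs by (rule refl)
  show "clinear (Uq_antipode :: 'p::finite Uq \<Rightarrow> _)" "Uq_antipode (1 :: 'p Uq) = 1"
    "Uq_antipode (x * y :: 'p Uq) = Uq_antipode y * Uq_antipode x"
    unfolding def by (rule presented_antilift_antihom [OF *]; assumption)+
  have val: "presented_antilift ?f (gen g) = ?f g" for g
    by (rule presented_antilift_gen [OF *])
  show "Uq_antipode (Uq_E :: 'p Uq) = - (Uq_E * Uq_Kinv)"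
    "Uq_antipode (Uq_F :: 'p Uq) = - (Uq_K * Uq_F)"
    "Uq_antipode (Uq_K :: 'p Uq) = Uq_Kinv"
    "Uq_antipode (Uq_Kinv :: 'p Uq) = Uq_K"
    using val [of Gen_E] val [of Gen_F] val [of Gen_K] val [of Gen_Kinv]
    unfolding def by (simp_all only: defs Uq_gen.case)
qed

section \<open>The algebras \<open>\<complex>\<^sub>q[z, \<partial>]\<close> and \<open>H\<^sub>q = \<complex>\<^sub>q[z, \<partial>] \<otimes> \<complex>[\<lambda>] / (\<lambda>\<^sup>2\<^sup>p - 1)\<close>\<close>

datatype 'p Cq_gen = Gen_z | Gen_d

instantiation Cq_gen :: (finite) presentation
begin
definition relators_Cq_gen :: "'a Cq_gen free_algebra set" where
  "relators_Cq_gen =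
    (let p = CARD('a); z = free_gen Gen_z; d = free_gen Gen_d
     in {z ^ p, d ^ p,
         d * z - (qpow p 1 - qpow p (- 1)) *\<^sub>C 1 - qpow p (- 2) *\<^sub>C (z * d)})"
instance ..
end

datatype 'p Lq_gen = Gen_lambda

instantiation Lq_gen :: (finite) presentation
begin
definition relators_Lq_gen :: "'a Lq_gen free_algebra set" where
  "relators_Lq_gen = {free_gen Gen_lambda ^ (2 * CARD('a)) - 1}"
instance ..
end

type_synonym 'p Cq = "'p Cq_gen presented"
type_synonym 'p Hq = "('p Cq_gen presented, 'p Lq_gen presented) tensor"

abbreviation Cq_z :: "'p::finite Cq" where "Cq_z \<equiv> gen Gen_z"
abbreviation Cq_d :: "'p::finite Cq" where "Cq_d \<equiv> gen Gen_d"
abbreviation Hq_z :: "'p::finite Hq" where "Hq_z \<equiv> Cq_z \<otimes> 1"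
abbreviation Hq_d :: "'p::finite Hq" where "Hq_d \<equiv> Cq_d \<otimes> 1"
abbreviation Hq_lambda :: "'p::finite Hq" where "Hq_lambda \<equiv> 1 \<otimes> gen Gen_lambda"

text \<open>For \<open>n = 0\<close> the truncated exponent \<open>n - 1\<close> is harmless, since then \<open>[n] = 0\<close>.\<close>

definition zd_action ::
  "('p::finite Uq \<Rightarrow> 'x::complex_algebra \<Rightarrow> 'x) \<Rightarrow> 'x \<Rightarrow> 'x \<Rightarrow> bool" where
  "zd_action act z d \<longleftrightarrow> (let p = CARD('p) in \<forall>n.
      act Uq_E (z ^ n) = (- qpow p (real n) * qnum p (real n)) *\<^sub>C z ^ (n + 1) \<and>
      act Uq_K (z ^ n) = qpow p (2 * real n) *\<^sub>C z ^ n \<and>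
      act Uq_F (z ^ n) = (qnum p (real n) * qpow p (1 - real n)) *\<^sub>C z ^ (n - 1) \<and>
      act Uq_E (d ^ n) = (qpow p (1 - real n) * qnum p (real n)) *\<^sub>C d ^ (n - 1) \<and>
      act Uq_K (d ^ n) = qpow p (- 2 * real n) *\<^sub>C d ^ n \<and>
      act Uq_F (d ^ n) = (- qpow p (real n) * qnum p (real n)) *\<^sub>C d ^ (n + 1))"

definition lambda_action ::
  "('p::finite Uq \<Rightarrow> 'x::complex_algebra \<Rightarrow> 'x) \<Rightarrow> 'x \<Rightarrow> 'x \<Rightarrow> 'x \<Rightarrow> bool" where
  "lambda_action act z d l \<longleftrightarrow> (let p = CARD('p) in \<forall>n.
      act Uq_E (l ^ n) = (qpow p (- real n / 2) * qnum p (real n / 2)) *\<^sub>C (l ^ n * z) \<and>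
      act Uq_K (l ^ n) = qpow p (- real n) *\<^sub>C l ^ n \<and>
      act Uq_F (l ^ n) = (- qpow p (real n / 2) * qnum p (real n / 2)) *\<^sub>C (l ^ n * d))"

text \<open>The \<open>q\<close>-binomial coefficients, and hence these formulas, are restricted to \<open>m \<le> p - 1\<close>.\<close>

definition zd_coaction ::
  "('x::complex_algebra \<Rightarrow> ('p::finite Uq, 'x) tensor) \<Rightarrow> 'x \<Rightarrow> 'x \<Rightarrow> bool" where
  "zd_coaction coact z d \<longleftrightarrow> (let p = CARD('p); w = qpow p 1 - qpow p (- 1) in \<forall>m<p.
      coact (z ^ m) = (\<Sum>s=0..m.
        ((- 1) ^ s * qpow p (real s * (1 - real m)) * w ^ s * qbinom p m s) *\<^sub>C
          ((Uq_E ^ s * Uq_Kinv ^ m) \<otimes> z ^ (m - s))) \<and>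
      coact (d ^ m) = (\<Sum>s=0..m.
        (qpow p (real s * (real m - real s)) * w ^ s * qbinom p m s) *\<^sub>C
          ((Uq_F ^ s * Uq_Kinv ^ (m - s)) \<otimes> d ^ (m - s))))"

definition Cq_action :: "('p::finite Uq \<Rightarrow> 'p Cq \<Rightarrow> 'p Cq) \<Rightarrow> bool" where
  "Cq_action act \<longleftrightarrow> zd_action act Cq_z Cq_d"

definition Cq_coaction :: "('p::finite Cq \<Rightarrow> ('p Uq, 'p Cq) tensor) \<Rightarrow> bool" where
  "Cq_coaction coact \<longleftrightarrow> zd_coaction coact Cq_z Cq_d"

definition Hq_action :: "('p::finite Uq \<Rightarrow> 'p Hq \<Rightarrow> 'p Hq) \<Rightarrow> bool" where
  "Hq_action act \<longleftrightarrow> zd_action act Hq_z Hq_d \<and> lambda_action act Hq_z Hq_d Hq_lambda"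

definition Hq_coaction :: "('p::finite Hq \<Rightarrow> ('p Uq, 'p Hq) tensor) \<Rightarrow> bool" where
  "Hq_coaction coact \<longleftrightarrow> zd_coaction coact Hq_z Hq_d \<and> coact Hq_lambda = 1 \<otimes> Hq_lambda"

end

theory Submission
  imports Defs
begin

text \<open>Braided commutativity \<open>y x = (y\<^sub>(\<^sub>-\<^sub>1\<^sub>) \<triangleright> x) y\<^sub>(\<^sub>0\<^sub>)\<close> for \<open>y = z\<close> and \<open>y = \<partial>\<close> leaves no choice for the
  actions of \<open>E\<close> and \<open>F\<close>: with \<open>w = q - q\<^sup>-\<^sup>1\<close> they must be the inner skew derivations
  \<open>E \<triangleright> x = (x z - z (K \<triangleright> x)) / w\<close> and \<open>F \<triangleright> x = (\<partial> x - (K\<^sup>-\<^sup>1 \<triangleright> x) \<partial>) / w\<close>. Conversely, an automorphism \<open>K\<close>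
  with \<open>K \<triangleright> z = q\<^sup>2 z\<close>, \<open>K \<triangleright> \<partial> = q\<^sup>-\<^sup>2 \<partial>\<close> and these formulas satisfy the relations of the quantum group:
  \<open>[E, F]\<close> comes from the relation between \<open>\<partial>\<close> and \<open>z\<close>, and \<open>E\<^sup>p = F\<^sup>p = 0\<close> from the \<open>q\<close>-binomial theorem,
  since left and right multiplications \<open>q\<close>-commute. The Yetter--Drinfeld condition for \<open>E\<close> and \<open>F\<close> then
  follows, for all \<open>x\<close> at once, from the one for \<open>K\<close>, which compares two algebra morphisms; and braided
  commutativity is multiplicative in \<open>y\<close>, so it holds because it holds for the generators. The central
  generator \<open>\<lambda>\<close> is coinvariant and needs no separate computation.\<close>

section \<open>Linear algebra of tensor products\<close>

lemma cbilinearI: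
  assumes "\<And>a a' b. f (a + a') b = f a b + f a' b" "\<And>a b b'. f a (b + b') = f a b + f a b'"
    and "\<And>c a b. f (c *\<^sub>C a) b = c *\<^sub>C f a b" "\<And>c a b. f a (c *\<^sub>C b) = c *\<^sub>C f a b"
  shows "cbilinear f"
  using assms by (simp add: cbilinear_def clinear_def)

lemma clinear_tensor_lift_comp:
  assumes "clinear g" "cbilinear f"
  shows "g (tensor_lift f t) = tensor_lift (\<lambda>a b. g (f a b)) t"
  by (rule sym, rule tensor_lift_unique)
    (use assms clinear_compose [OF assms(1) clinear_tensor_lift [OF assms(2)]] in simp_all)

lemma alg_hom_linear: "alg_hom f \<Longrightarrow> clinear f"
  and alg_hom_one: "alg_hom f \<Longrightarrow> f 1 = 1"
  and alg_hom_mult: "alg_hom f \<Longrightarrow> f (x * y) = f x * f y"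
  by (simp_all add: alg_hom_def)

lemmas alg_hom_add = clinear_add [OF alg_hom_linear]
  and alg_hom_diff = clinear_diff [OF alg_hom_linear]
  and alg_hom_minus = clinear_minus [OF alg_hom_linear]
  and alg_hom_scaleC = clinear_scaleC [OF alg_hom_linear]

lemmas alg_hom_simps = alg_hom_one alg_hom_mult alg_hom_add alg_hom_diff alg_hom_minus
  alg_hom_scaleC

lemma alg_hom_compose: "alg_hom f \<Longrightarrow> alg_hom g \<Longrightarrow> alg_hom (\<lambda>x. f (g x))"
  by (simp add: alg_hom_def clinear_def)

lemma alg_hom_id: "alg_hom (\<lambda>x. x)"
  by (simp add: alg_hom_def clinear_def)

lemma alg_hom_tens_one: "alg_hom (\<lambda>x. x \<otimes> 1)" and alg_hom_one_tens: "alg_hom (\<lambda>x. 1 \<otimes> x)"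
  by (simp_all add: alg_hom_def clinear_def tens_linear one_tensor_def)

lemma alg_hom_funpow: "alg_hom (f :: 'a::complex_algebra \<Rightarrow> 'a) \<Longrightarrow> alg_hom (f ^^ n)"
  by (induction n) (simp_all add: alg_hom_def clinear_def)

context
  fixes f :: "'a::complex_algebra \<Rightarrow> 'c::complex_algebra" and g :: "'b::complex_algebra \<Rightarrow> 'c"
  assumes f: "alg_hom f" and g: "alg_hom g"
begin

lemma cbilinear_alg_hom_mult: "cbilinear (\<lambda>a b. f a * g b)"
  by (rule cbilinearI) (simp_all add: alg_hom_simps [OF f] alg_hom_simps [OF g] algebra_simps)

text \<open>The universal property of the tensor product of algebras. On pure tensors
  multiplicativity only needs the middle factors \<open>f c\<close> and \<open>g b\<close> to be
  swapped; it then extends additively in each argument.\<close>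

lemma alg_hom_tensor_lift_mult:
  assumes comm: "\<And>a b. f a * g b = g b * f a"
  shows "alg_hom (tensor_lift (\<lambda>a b. f a * g b))"
proof -
  let ?h = "tensor_lift (\<lambda>a b. f a * g b)"
  note bil = cbilinear_alg_hom_mult
  note lin = clinear_tensor_lift [OF bil]
  have "?h ((a \<otimes> b) * (c \<otimes> e)) = ?h (a \<otimes> b) * ?h (c \<otimes> e)" for a b c e
  proof -
    have "f a * f c * (g b * g e) = f a * (f c * g b) * g e"
      by (simp only: mult.assoc)
    also have "\<dots> = f a * (g b * f c) * g e"
      by (simp only: comm)
    also have "\<dots> = f a * g b * (f c * g e)"
      by (simp only: mult.assoc)
    finally show ?thesis
      by (simp add: bil alg_hom_mult [OF f] alg_hom_mult [OF g])
  qed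
  then have 1: "?h ((a \<otimes> b) * y) = ?h (a \<otimes> b) * ?h y" for a b y
    by (induction y) (simp_all add: distrib_left clinear_add [OF lin] del: tens_mult)
  have "?h (x * y) = ?h x * ?h y" for x y
    by (induction x) (simp_all add: 1 distrib_right clinear_add [OF lin] del: tensor_lift_tens)
  then show ?thesis
    by (simp add: alg_hom_def lin one_tensor_def bil alg_hom_one [OF f] alg_hom_one [OF g])
qed

end

definition tensor_map :: "('a::complex_vector \<Rightarrow> 'c::complex_vector) \<Rightarrow>
    ('b::complex_vector \<Rightarrow> 'd::complex_vector) \<Rightarrow> ('a, 'b) tensor \<Rightarrow> ('c, 'd) tensor" where
  "tensor_map f g = tensor_lift (\<lambda>a b. f a \<otimes> g b)"

lemma cbilinear_tens_compose: "clinear f \<Longrightarrow> clinear g \<Longrightarrow> cbilinear (\<lambda>a b. f a \<otimes> g b)"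
  by (rule cbilinearI) (simp_all add: clinear_def tens_linear)

lemma tensor_map_tens [simp]: "clinear f \<Longrightarrow> clinear g \<Longrightarrow> tensor_map f g (a \<otimes> b) = f a \<otimes> g b"
  by (simp add: tensor_map_def cbilinear_tens_compose)

lemma clinear_tensor_map: "clinear f \<Longrightarrow> clinear g \<Longrightarrow> clinear (tensor_map f g)"
  by (simp add: tensor_map_def cbilinear_tens_compose clinear_tensor_lift)

lemma alg_hom_tensor_map:
  assumes "alg_hom f" "alg_hom g"
  shows "alg_hom (tensor_map f g)"
proof -
  have "alg_hom (tensor_lift (\<lambda>a b. (f a \<otimes> 1) * (1 \<otimes> g b)))"
    by (rule alg_hom_tensor_lift_mult)
      (simp_all add: alg_hom_compose [OF alg_hom_tens_one] alg_hom_compose [OF alg_hom_one_tens] assms)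
  then show ?thesis
    by (simp add: tensor_map_def)
qed

lemma clinear_id: "clinear (\<lambda>x. x)"
  by (simp add: clinear_def)

text \<open>The map \<open>D \<otimes> id\<close> followed by reassociation, in the form used by the coassociativity axioms.\<close>

definition reassoc :: "('h::complex_algebra \<Rightarrow> ('h, 'h) tensor) \<Rightarrow> ('h, 'x::complex_algebra) tensor
    \<Rightarrow> ('h, ('h, 'x) tensor) tensor" where
  "reassoc D = tensor_lift (\<lambda>a y. tensor_lift (\<lambda>c d. c \<otimes> (d \<otimes> y)) (D a))"

lemma cbilinear_reassoc_inner: "cbilinear (\<lambda>c d. c \<otimes> (d \<otimes> y))"
  by (rule cbilinearI) (simp_all add: tens_linear)

text \<open>Coassociativity is to be compared on generators, so its left side must be an algebra
  morphism. \<open>reassoc D\<close> is built from \<open>?f\<close> and \<open>?g\<close>, whose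
  images commute: by \<open>1\<close>, multiplying by \<open>?g y\<close> on either side just puts
  \<open>y\<close> into the last tensor slot.\<close>

lemma
  fixes D :: "'h::complex_algebra \<Rightarrow> ('h, 'h) tensor" and y :: "'x::complex_algebra"
  assumes D: "alg_hom D"
  shows alg_hom_reassoc: "alg_hom (reassoc D :: ('h, 'x) tensor \<Rightarrow> _)"
    and reassoc_tens: "reassoc D (a \<otimes> y) = tensor_lift (\<lambda>c d. c \<otimes> (d \<otimes> y)) (D a)"
proof -
  let ?f = "\<lambda>a. tensor_map (\<lambda>x. x) (\<lambda>x. x \<otimes> (1 :: 'x)) (D a)" and ?g = "\<lambda>y :: 'x. 1 \<otimes> (1 \<otimes> y)"
  have f: "alg_hom ?f"
    by (intro alg_hom_compose [OF _ D] alg_hom_tensor_map alg_hom_id alg_hom_tens_one)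
  have g: "alg_hom ?g"
    by (intro alg_hom_compose [OF alg_hom_one_tens] alg_hom_one_tens)
  note lin = clinear_tensor_lift [OF cbilinear_reassoc_inner]
    clinear_tensor_map [OF clinear_id alg_hom_linear [OF alg_hom_tens_one]]
  have 1: "tensor_map (\<lambda>x. x) (\<lambda>x. x \<otimes> 1) t * (1 \<otimes> (1 \<otimes> y)) = tensor_lift (\<lambda>c d. c \<otimes> (d \<otimes> y)) t"
    "(1 \<otimes> (1 \<otimes> y)) * tensor_map (\<lambda>x. x) (\<lambda>x. x \<otimes> 1) t = tensor_lift (\<lambda>c d. c \<otimes> (d \<otimes> y)) t"
    for t :: "('h, 'h) tensor" and y :: 'x
    by (induction t)
      (simp_all add: distrib_right distrib_left clinear_add [OF lin(1)] clinear_add [OF lin(2)]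
        cbilinear_reassoc_inner clinear_id alg_hom_linear alg_hom_tens_one)
  have bil: "cbilinear (\<lambda>a (y :: 'x). tensor_lift (\<lambda>c d. c \<otimes> (d \<otimes> y)) (D a))"
    using cbilinear_alg_hom_mult [OF f g] by (simp add: 1)
  then show "reassoc D (a \<otimes> y) = tensor_lift (\<lambda>c d. c \<otimes> (d \<otimes> y)) (D a)"
    by (simp add: reassoc_def)
  have "alg_hom (tensor_lift (\<lambda>a (y :: 'x). ?f a * ?g y))"
    by (rule alg_hom_tensor_lift_mult [OF f g]) (simp add: 1)
  then show "alg_hom (reassoc D :: ('h, 'x) tensor \<Rightarrow> _)"
    by (simp add: 1 reassoc_def)
qed

section \<open>Generating sets of algebras\<close>

inductive_set generated :: "'a::complex_algebra set \<Rightarrow> 'a set" for G where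
  generated_base: "x \<in> G \<Longrightarrow> x \<in> generated G"
| generated_one: "1 \<in> generated G"
| generated_add: "x \<in> generated G \<Longrightarrow> y \<in> generated G \<Longrightarrow> x + y \<in> generated G"
| generated_scaleC: "x \<in> generated G \<Longrightarrow> c *\<^sub>C x \<in> generated G"
| generated_mult: "x \<in> generated G \<Longrightarrow> y \<in> generated G \<Longrightarrow> x * y \<in> generated G"

text \<open>Every class is represented by a linear combination of words, and a word is a product of
  generators.\<close>

lemma generated_range_gen: "x \<in> generated (range gen)"
proof -
  have word: "abs_presented (Poly_Mapping.single (Word ws) 1) \<in> generated (range gen)"
    for ws :: "'a::presentation list"
  proof (induction ws)
    case Nil
    show ?case
      using generated_one [of "range gen"] by (simp add: one_presented_def flip: zero_free_monoid_def)
  next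
    case (Cons g ws)
    have "Poly_Mapping.single (Word (g # ws)) 1 = free_gen g * Poly_Mapping.single (Word ws) 1"
      by (simp add: free_gen_def mult_single plus_free_monoid_def)
    with Cons show ?case
      by (simp add: generated_mult generated_base flip: gen.abs_eq times_presented.abs_eq)
  qed
  have "abs_presented y \<in> generated (range gen)" for y :: "'a free_algebra"
  proof (induction y rule: poly_mapping_single_induct)
    case zero
    show ?case
      using generated_scaleC [OF generated_one, of 0 "range gen"] by (simp add: zero_presented_def)
  next
    case (add w v y)
    have "Poly_Mapping.single w v = v *\<^sub>C Poly_Mapping.single (Word (letters w)) 1"
      by (simp add: scaleC_complex_def)
    then have "abs_presented (Poly_Mapping.single w v + y)
        = v *\<^sub>C abs_presented (Poly_Mapping.single (Word (letters w)) 1) + abs_presented y"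
      by (simp only: plus_presented.abs_eq scaleC_presented.abs_eq)
    then show ?case
      by (simp only: generated_add generated_scaleC word add)
  qed
  from this [of "rep_presented x"] show ?thesis
    by (simp add: abs_rep_presented)
qed

lemma alg_hom_eq_on_generated:
  assumes "alg_hom f" "alg_hom g" "\<And>x. x \<in> G \<Longrightarrow> f x = g x" "x \<in> generated G"
  shows "f x = g x"
  using assms(4) by induction (simp_all add: alg_hom_simps assms(1-3))

lemma generated_alg_hom_image:
  assumes "alg_hom f" "x \<in> generated G"
  shows "f x \<in> generated (f ` G)"
  using assms(2) by induction (simp_all add: alg_hom_simps [OF assms(1)] generated.intros)

lemma generated_mono: "x \<in> generated G \<Longrightarrow> G \<subseteq> G' \<Longrightarrow> x \<in> generated G'"
  by (induction rule: generated.induct) (auto intro: generated.intros)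

lemma range_gen_Uq: "range gen = {Uq_E, Uq_F, Uq_K, Uq_Kinv :: 'p::finite Uq}"
proof -
  have "UNIV = {Gen_E, Gen_F, Gen_K, Gen_Kinv :: 'p Uq_gen}"
    by (auto intro: Uq_gen.exhaust)
  then show ?thesis
    by (metis (no_types) image_empty image_insert)
qed

lemma generated_Uq: "h \<in> generated {Uq_E, Uq_F, Uq_K, Uq_Kinv :: 'p::finite Uq}"
  using generated_range_gen [of h] by (simp add: range_gen_Uq)

section \<open>The Hopf algebra structure of the quantum group\<close>

lemma hopf_algebra_Uq: "hopf_algebra Uq_comult Uq_counit (Uq_antipode :: 'p::finite Uq \<Rightarrow> _)"
proof
  note com = Uq_comult_well_defined [where 'p = 'p] and cou = Uq_counit_well_defined [where 'p = 'p]
    and ant = Uq_antipode_well_defined [where 'p = 'p] and rel = Uq_relations [where 'p = 'p]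
  note eqI = alg_hom_eq_on_generated [OF _ _ _ generated_Uq]
  show "alg_hom (Uq_comult :: 'p Uq \<Rightarrow> _)" "alg_hom (Uq_counit :: 'p Uq \<Rightarrow> _)"
    "clinear (Uq_antipode :: 'p Uq \<Rightarrow> _)"
    by (rule com cou ant)+
  have KinvK: "Uq_Kinv * (Uq_K * x) = x" for x :: "'p Uq"
    by (simp add: rel flip: mult.assoc)
  fix h :: "'p Uq"
  show "tensor_lift (\<lambda>a b. tensor_lift (\<lambda>c d. c \<otimes> (d \<otimes> b)) (Uq_comult a)) (Uq_comult h)
      = tensor_lift (\<lambda>a b. a \<otimes> Uq_comult b) (Uq_comult h)"
  proof -
    have "reassoc Uq_comult (Uq_comult h) = tensor_map (\<lambda>x. x) Uq_comult (Uq_comult h)"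
    proof (rule eqI)
      show "alg_hom (\<lambda>h :: 'p Uq. reassoc Uq_comult (Uq_comult h))"
        "alg_hom (\<lambda>h :: 'p Uq. tensor_map (\<lambda>x. x) Uq_comult (Uq_comult h))"
        by (intro alg_hom_compose [OF _ com(1)] alg_hom_reassoc alg_hom_tensor_map alg_hom_id com(1))+
    qed (auto simp: com reassoc_tens cbilinear_reassoc_inner clinear_id alg_hom_linear tens_linear
        alg_hom_simps [OF alg_hom_reassoc [OF com(1)]] one_tensor_def add.assoc
        alg_hom_simps [OF alg_hom_tensor_map [OF alg_hom_id com(1)]] alg_hom_one [OF com(1)]
        clinear_add [OF clinear_tensor_lift [OF cbilinear_reassoc_inner]])
    then show ?thesis
      by (simp add: reassoc_def tensor_map_def)
  qed
  have bil: "cbilinear (\<lambda>(a :: 'p Uq) b :: 'p Uq. Uq_counit a *\<^sub>C b)"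
    "cbilinear (\<lambda>(a :: 'p Uq) b :: 'p Uq. Uq_counit b *\<^sub>C a)"
    by (rule cbilinearI; simp add: alg_hom_simps [OF cou(1)] scaleC_add_left scaleC_add_right scaleC_complex_def mult.commute)+
  have unit: "alg_hom (\<lambda>h :: 'p Uq. Uq_counit h *\<^sub>C (1 :: 'p Uq))"
    by (simp add: alg_hom_def clinear_def alg_hom_simps [OF cou(1)] scaleC_add_left scaleC_complex_def mult.commute)
  have hom: "alg_hom (tensor_lift (\<lambda>(a :: 'p Uq) b :: 'p Uq. Uq_counit a *\<^sub>C b))"
    "alg_hom (tensor_lift (\<lambda>(a :: 'p Uq) b :: 'p Uq. Uq_counit b *\<^sub>C a))"
    using alg_hom_tensor_lift_mult [OF unit alg_hom_id]
      alg_hom_tensor_lift_mult [OF alg_hom_id unit] by simp_all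
  show "tensor_lift (\<lambda>a b. Uq_counit a *\<^sub>C b) (Uq_comult h) = h"
    by (rule eqI [OF alg_hom_compose [OF hom(1) com(1)] alg_hom_id])
      (auto simp: com cou bil alg_hom_simps [OF hom(1)] alg_hom_one [OF cou(1)])
  show "tensor_lift (\<lambda>a b. Uq_counit b *\<^sub>C a) (Uq_comult h) = h"
    by (rule eqI [OF alg_hom_compose [OF hom(2) com(1)] alg_hom_id])
      (auto simp: com cou bil alg_hom_simps [OF hom(2)] alg_hom_one [OF cou(1)])
  let ?S = "Uq_antipode :: 'p Uq \<Rightarrow> 'p Uq"
  define M where "M = tensor_lift (\<lambda>a b. ?S a * b)"
  define N where "N = tensor_lift (\<lambda>a b. a * ?S b)"
  have bilM: "cbilinear (\<lambda>a b. ?S a * b)" and bilN: "cbilinear (\<lambda>a b. a * ?S b)"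
    by (rule cbilinearI; simp add: clinear_add [OF ant(1)] clinear_scaleC [OF ant(1)] algebra_simps)+
  have M: "M (a \<otimes> b) = ?S a * b" "clinear M" and N: "N (a \<otimes> b) = a * ?S b" "clinear N" for a b
    by (simp_all add: M_def N_def bilM bilN clinear_tensor_lift)
  note linM = clinear_add [OF M(2)] clinear_scaleC [OF M(2)]
    and linN = clinear_add [OF N(2)] clinear_scaleC [OF N(2)]
  \<comment> \<open>\<open>M\<close> and \<open>N\<close> are not multiplicative, so the antipode
    axioms cannot be compared as morphisms. Since the antipode reverses products, the value on one
    factor ends up sandwiched inside the other; once that value is a scalar it can be pulled out
    (\<open>M3\<close>, \<open>N3\<close>), and the axioms pass to products.\<close>
  have M2: "M (t * (a \<otimes> b)) = ?S a * M t * b" and N2: "N ((a \<otimes> b) * t) = a * N t * ?S b" for t a b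
    by (induction t) (simp_all add: M N ant mult.assoc distrib_left distrib_right linM linN)
  have M3: "M (t * u) = e *\<^sub>C M u" if "M t = e *\<^sub>C 1" for t u e
    using that by (induction u) (simp_all add: M M2 distrib_left linM scaleC_add_right)
  have N3: "N (u * t) = e *\<^sub>C N u" if "N t = e *\<^sub>C 1" for t u e
    using that by (induction u) (simp_all add: N N2 distrib_right linN scaleC_add_right)
  have "M (Uq_comult h) = Uq_counit h *\<^sub>C 1 \<and> N (Uq_comult h) = Uq_counit h *\<^sub>C 1"
    using generated_Uq [of h]
  proof induction
    case (generated_base x)
    then show ?case
      by (auto simp: com cou M N ant linM linN rel mult.assoc KinvK)
  qed (simp_all add: alg_hom_simps [OF com(1)] alg_hom_simps [OF cou(1)] linM linN M3 N3 scaleC_add_left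
        one_tensor_def M N ant scaleC_complex_def mult.commute)
  then show "tensor_lift (\<lambda>a b. ?S a * b) (Uq_comult h) = Uq_counit h *\<^sub>C 1"
    "tensor_lift (\<lambda>a b. a * ?S b) (Uq_comult h) = Uq_counit h *\<^sub>C 1"
    by (simp_all add: M_def N_def)
qed

section \<open>The algebra of linear endomorphisms\<close>

text \<open>A representation of a presented algebra is an algebra morphism into this algebra. As a
  type of class \<open>complex_algebra\<close> it can be the target of
  \<open>presented_lift\<close>, which is how the action is defined.\<close>

typedef (overloaded) 'x endo = "{f :: 'x::complex_vector \<Rightarrow> 'x. clinear f}"
  morphisms endo_apply Endo
  using clinear_id by blast

setup_lifting type_definition_endo

instantiation endo :: (complex_vector) complex_algebra
begin

lift_definition zero_endo :: "'a endo" is "\<lambda>x. 0" by (simp add: clinear_def)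
lift_definition one_endo :: "'a endo" is "\<lambda>x. x" by (rule clinear_id)
lift_definition plus_endo :: "'a endo \<Rightarrow> 'a endo \<Rightarrow> 'a endo" is "\<lambda>f g x. f x + g x"
  by (simp add: clinear_def scaleC_add_right)
lift_definition minus_endo :: "'a endo \<Rightarrow> 'a endo \<Rightarrow> 'a endo" is "\<lambda>f g x. f x - g x"
  by (simp add: clinear_def scaleC_diff_right)
lift_definition uminus_endo :: "'a endo \<Rightarrow> 'a endo" is "\<lambda>f x. - f x"
  by (simp add: clinear_def)
lift_definition times_endo :: "'a endo \<Rightarrow> 'a endo \<Rightarrow> 'a endo" is "\<lambda>f g x. f (g x)"
  by (rule clinear_compose)
lift_definition scaleC_endo :: "complex \<Rightarrow> 'a endo \<Rightarrow> 'a endo" is "\<lambda>c f x. c *\<^sub>C f x"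
  by (simp add: clinear_def scaleC_add_right mult.commute)

instance
  by standard (transfer; simp add: fun_eq_iff scaleC_add_right scaleC_add_left clinear_add clinear_scaleC)+

end

lemmas endo_apply_simps [simp] = zero_endo.rep_eq one_endo.rep_eq plus_endo.rep_eq
  minus_endo.rep_eq uminus_endo.rep_eq times_endo.rep_eq scaleC_endo.rep_eq

lemma clinear_endo_apply: "clinear (endo_apply f)"
  using endo_apply by blast

lemma endo_eqI: "(\<And>x. endo_apply f x = endo_apply g x) \<Longrightarrow> f = g"
  by (simp add: fun_eq_iff flip: endo_apply_inject)

lemma endo_apply_Endo: "clinear f \<Longrightarrow> endo_apply (Endo f) = f"
  by (simp add: Endo_inverse)

lemma endo_apply_power: "endo_apply (f ^ n) = endo_apply f ^^ n"
  by (induction n) (simp_all add: fun_eq_iff)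

lift_definition left_mult :: "'x::complex_algebra \<Rightarrow> 'x endo" is "\<lambda>a x. a * x"
  by (simp add: clinear_def distrib_left)

lift_definition right_mult :: "'x::complex_algebra \<Rightarrow> 'x endo" is "\<lambda>a x. x * a"
  by (simp add: clinear_def distrib_right)

lemmas mult_endo_apply [simp] = left_mult.rep_eq right_mult.rep_eq

lemma left_mult_power: "left_mult a ^ n = left_mult (a ^ n)"
  by (induction n) (simp_all add: endo_eqI mult.assoc)

lemma right_mult_power: "right_mult a ^ n = right_mult (a ^ n)"
  by (induction n) (simp_all add: endo_eqI mult.assoc power_commutes)

section \<open>Verifying the axioms on generators\<close>

text \<open>The elements \<open>h\<close> obeying both laws form a subalgebra. For a product
  \<open>g * h\<close>, the law of \<open>g\<close> is applied inside the sum that the law of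
  \<open>h\<close> produces, and \<open>M_mult\<close> identifies the result with the value at
  \<open>comult g * comult h\<close>.\<close>

lemma left_module_algebraI:
  fixes act :: "'h::complex_algebra \<Rightarrow> 'x::complex_algebra \<Rightarrow> 'x"
  assumes com: "alg_hom comult" and cou: "alg_hom counit" and bil: "cbilinear act"
    and one: "\<And>x. act 1 x = x" and mult: "\<And>g h x. act (g * h) x = act g (act h x)"
    and gen: "\<And>h. h \<in> generated G"
    and act_mult: "\<And>h x y. h \<in> G \<Longrightarrow>
      act h (x * y) = tensor_lift (\<lambda>h' h''. act h' x * act h'' y) (comult h)"
    and act_one: "\<And>h. h \<in> G \<Longrightarrow> act h 1 = counit h *\<^sub>C 1"
  shows "left_module_algebra comult counit act"
proof
  note actr = bil [unfolded cbilinear_def, THEN conjunct2, THEN spec]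
    and actl = bil [unfolded cbilinear_def, THEN conjunct1, THEN spec]
  note act_simps = clinear_add [OF actr] clinear_add [OF actl] clinear_scaleC [OF actr]
    clinear_scaleC [OF actl]
  define M where "M x y = tensor_lift (\<lambda>h' h''. act h' x * act h'' y)" for x y
  have bilM: "cbilinear (\<lambda>h' h''. act h' x * act h'' y)" for x y
    by (rule cbilinearI) (simp_all add: act_simps algebra_simps)
  have M: "M x y (a \<otimes> b) = act a x * act b y" "clinear (M x y)" for x y a b
    by (simp_all add: M_def bilM clinear_tensor_lift)
  note linM = clinear_add [OF M(2)] clinear_scaleC [OF M(2)]
  have M_add: "M (x + x') y t = M x y t + M x' y t" "M x (y + y') t = M x y t + M x y' t"
    "M (c *\<^sub>C x) y t = c *\<^sub>C M x y t" "M x (c *\<^sub>C y) t = c *\<^sub>C M x y t" for x x' y y' t c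
    by (induction t; simp add: M linM act_simps algebra_simps scaleC_add_right)+
  have bilM2: "cbilinear (\<lambda>c d. M (act c x) (act d y) s)" for x y s
    by (rule cbilinearI) (simp_all add: act_simps M_add)
  have M_mult: "M x y (s * t) = tensor_lift (\<lambda>c d. M (act c x) (act d y) s) t" for x y s t
  proof (induction t)
    case (tens c d)
    show ?case
      unfolding tensor_lift_tens [OF bilM2]
      by (induction s) (simp_all add: M linM mult distrib_right)
  qed (simp add: distrib_left linM tensor_lift_add [OF bilM2])
  have *: "(\<forall>x y. act h (x * y) = M x y (comult h)) \<and> act h 1 = counit h *\<^sub>C 1" for h
    using gen [of h]
  proof induction
    case (generated_base x)
    then show ?case
      by (simp add: act_mult act_one M_def)
  next
    case (generated_mult g h)
    have "act (g * h) (x * y) = M x y (comult (g * h))" for x y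
    proof -
      have "act (g * h) (x * y) = act g (tensor_lift (\<lambda>a b. act a x * act b y) (comult h))"
        using generated_mult by (simp add: mult M_def)
      also have "\<dots> = tensor_lift (\<lambda>a b. act g (act a x * act b y)) (comult h)"
        by (rule clinear_tensor_lift_comp [OF actr bilM])
      also have "\<dots> = M x y (comult (g * h))"
        using generated_mult by (simp add: M_mult alg_hom_mult [OF com])
      finally show ?thesis .
    qed
    then show ?case
      using generated_mult by (simp add: mult act_simps alg_hom_simps [OF cou] mult.commute)
  qed (simp_all add: one act_simps alg_hom_simps [OF com] alg_hom_simps [OF cou] one_tensor_def M linM
      scaleC_add_left scaleC_complex_def)
  then show "act h (x * y) = tensor_lift (\<lambda>h' h''. act h' x * act h'' y) (comult h)"
    "act h 1 = counit h *\<^sub>C 1" for h x y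
    by (simp_all add: M_def)
qed (fact bil one mult)+

text \<open>The coproducts dictate the order. \<open>Uq_K\<close> is grouplike, so its action is
  fixed by the values on \<open>G\<close>; then \<open>Uq_Kinv\<close> acts by the inverse;
  \<open>Uq_E\<close> and \<open>Uq_F\<close> act as derivations twisted by these two, so they too
  are fixed by their values on \<open>G\<close>.\<close>

lemma left_module_algebra_Uq_unique:
  fixes act act' :: "'p::finite Uq \<Rightarrow> 'x::complex_algebra \<Rightarrow> 'x"
  assumes "left_module_algebra Uq_comult Uq_counit act"
    and "left_module_algebra Uq_comult Uq_counit act'"
    and gen: "\<And>x. x \<in> generated G"
    and eq: "\<And>g. g \<in> G \<Longrightarrow> act Uq_E g = act' Uq_E g"
      "\<And>g. g \<in> G \<Longrightarrow> act Uq_F g = act' Uq_F g" "\<And>g. g \<in> G \<Longrightarrow> act Uq_K g = act' Uq_K g"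
  shows "act = act'"
proof -
  interpret A: left_module_algebra Uq_comult Uq_counit act by fact
  interpret B: left_module_algebra Uq_comult Uq_counit act' by fact
  note com = Uq_comult_well_defined [where 'p = 'p] and cou = Uq_counit_well_defined [where 'p = 'p]
    and rel = Uq_relations [where 'p = 'p]
  note lin = A.act_bilinear [unfolded cbilinear_def, THEN conjunct1, THEN spec]
    A.act_bilinear [unfolded cbilinear_def, THEN conjunct2, THEN spec]
    B.act_bilinear [unfolded cbilinear_def, THEN conjunct1, THEN spec]
    B.act_bilinear [unfolded cbilinear_def, THEN conjunct2, THEN spec]
  note add = lin [THEN clinear_add] and scale = lin [THEN clinear_scaleC]
  have bil: "cbilinear (\<lambda>h' h''. act h' x * act h'' y)" "cbilinear (\<lambda>h' h''. act' h' x * act' h'' y)"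
    for x y
    by (rule cbilinearI; simp add: add scale algebra_simps)+
  have K: "act Uq_K x = act' Uq_K x" for x
    using gen [of x]
    by induction (simp_all add: eq add scale A.act_one B.act_one A.act_mult B.act_mult com bil)
  have inv: "act Uq_Kinv (act Uq_K x) = x" "act' Uq_K (act' Uq_Kinv x) = x" for x
    by (simp_all add: A.act_one_left B.act_one_left rel flip: A.act_mult_left B.act_mult_left)
  have Kinv: "act Uq_Kinv x = act' Uq_Kinv x" for x
    using inv(1) [of "act' Uq_Kinv x"] by (simp add: K inv)
  have E: "act Uq_E x = act' Uq_E x" for x
    using gen [of x]
    by induction (simp_all add: eq add scale A.act_one B.act_one A.act_mult B.act_mult com bil K
        tensor_lift_add [OF bil(1)] tensor_lift_add [OF bil(2)] A.act_one_left B.act_one_left)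
  have F: "act Uq_F x = act' Uq_F x" for x
    using gen [of x]
    by induction (simp_all add: eq add scale A.act_one B.act_one A.act_mult B.act_mult com bil Kinv
        tensor_lift_add [OF bil(1)] tensor_lift_add [OF bil(2)] A.act_one_left B.act_one_left)
  have "act h x = act' h x" for h x
    using generated_Uq [of h]
    by (induction arbitrary: x)
      (auto simp: K Kinv E F add scale A.act_one_left B.act_one_left A.act_mult_left B.act_mult_left)
  then show ?thesis
    by (simp add: fun_eq_iff)
qed

text \<open>The Yetter--Drinfeld condition, with the inner tensor lifts written as products in \<open>H \<otimes> X\<close>.\<close>

lemma yetter_drinfeldI:
  fixes comult :: "'h::complex_algebra \<Rightarrow> ('h, 'h) tensor"
    and act :: "'h \<Rightarrow> 'x::complex_algebra \<Rightarrow> 'x" and coact :: "'x \<Rightarrow> ('h, 'x) tensor"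
  assumes com: "alg_hom comult" and bil: "cbilinear act" and coact: "clinear coact"
    and one: "\<And>x. act 1 x = x" and mult: "\<And>g h x. act (g * h) x = act g (act h x)"
    and gen: "\<And>h. h \<in> generated G"
    and base: "\<And>h x. h \<in> G \<Longrightarrow>
      tensor_lift (\<lambda>a b. coact (act a x) * (b \<otimes> 1)) (comult h)
        = tensor_lift (\<lambda>a b. (a \<otimes> 1) * tensor_map (\<lambda>x. x) (act b) (coact x)) (comult h)"
  shows "tensor_lift (\<lambda>a b. coact (act a x) * (b \<otimes> 1)) (comult h)
    = tensor_lift (\<lambda>a b. (a \<otimes> 1) * tensor_map (\<lambda>x. x) (act b) (coact x)) (comult h)"
proof -
  note actr = bil [unfolded cbilinear_def, THEN conjunct2, THEN spec]
    and actl = bil [unfolded cbilinear_def, THEN conjunct1, THEN spec]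
  note act_simps = clinear_add [OF actr] clinear_add [OF actl] clinear_scaleC [OF actr]
    clinear_scaleC [OF actl]
  note coact_simps = clinear_add [OF coact] clinear_scaleC [OF coact]
  define m where "m b = tensor_map (\<lambda>x :: 'h. x) (act b)" for b
  have m: "m b (g \<otimes> y) = g \<otimes> act b y" "clinear (m b)" for b g y
    by (simp_all add: m_def actr clinear_id clinear_tensor_map)
  note m_simps = clinear_add [OF m(2)] clinear_scaleC [OF m(2)]
  have m_add: "m (b + b') t = m b t + m b' t" "m (c *\<^sub>C b) t = c *\<^sub>C m b t"
    "m (b * b') t = m b (m b' t)" "m 1 t = t" "m b ((g \<otimes> 1) * t) = (g \<otimes> 1) * m b t"
    "m b (t * (g \<otimes> 1)) = m b t * (g \<otimes> 1)" for b b' t c g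
    by (induction t; simp add: m m_simps act_simps tens_linear scaleC_add_right mult one
          distrib_left distrib_right)+
  define L where "L x = tensor_lift (\<lambda>a b. coact (act a x) * (b \<otimes> 1))" for x
  define R where "R u = tensor_lift (\<lambda>a b. (a \<otimes> 1) * m b u)" for u
  have bilL: "cbilinear (\<lambda>a b. coact (act a x) * (b \<otimes> 1))" for x
    by (rule cbilinearI) (simp_all add: act_simps coact_simps tens_linear distrib_left distrib_right)
  have bilR: "cbilinear (\<lambda>a b. (a \<otimes> 1) * m b u)" for u
    by (rule cbilinearI) (simp_all add: m_add tens_linear distrib_left distrib_right)
  have L: "L x (a \<otimes> b) = coact (act a x) * (b \<otimes> 1)" "clinear (L x)" for x a b
    by (simp_all add: L_def bilL clinear_tensor_lift)
  have R: "R u (a \<otimes> b) = (a \<otimes> 1) * m b u" "clinear (R u)" for u a b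
    by (simp_all add: R_def bilR clinear_tensor_lift)
  note linL = clinear_add [OF L(2)] clinear_scaleC [OF L(2)]
    and linR = clinear_add [OF R(2)] clinear_scaleC [OF R(2)]
  have R_add: "R (u + v) s = R u s + R v s" for u v s
    by (induction s) (simp_all add: R linR m_simps distrib_left algebra_simps)
  have L_right: "L x (s * (c \<otimes> d)) = L (act c x) s * (d \<otimes> 1)" for x s c d
    by (induction s) (simp_all add: L linL mult mult.assoc distrib_right)
  have R_right: "R u s * (d \<otimes> 1) = R (u * (d \<otimes> 1)) s" for u s d
    by (induction s) (simp_all add: R linR mult.assoc m_add(6) distrib_right)
  \<comment> \<open>With \<open>s\<close> and \<open>t\<close> the coproducts of \<open>g\<close>
    and \<open>h\<close>, the condition for \<open>s\<close> turns its part into the right-hand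
    form, then the condition for \<open>t\<close> applies inside, and \<open>R_mult\<close> merges
    the two. Hence the condition passes to products.\<close>
  have L_mult: "L x (s * t) = R (L x t) s" if s: "\<And>x. L x s = R (coact x) s" for x s t
    by (induction t) (simp_all add: L_right s R_right L(1) R_add distrib_left linL)
  have R_mult: "R u (s * t) = R (R u t) s" for u s t
  proof (induction s)
    case (tens a b)
    show ?case
      by (induction t) (simp_all add: R linR R_add m_add m_simps distrib_left flip: mult.assoc)
  qed (simp add: distrib_right linR)
  have "\<forall>x. L x (comult h) = R (coact x) (comult h)"
    using gen [of h]
  proof induction
    case (generated_base h)
    then show ?case
      using base by (simp add: L_def R_def m_def)
  next
    case (generated_mult g h)
    then show ?case
      by (simp add: alg_hom_mult [OF com] L_mult R_mult)
  next
    case generated_one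
    show ?case
      using L(1) [of _ 1 1] R(1) [of _ 1 1]
      by (simp add: one m_add alg_hom_one [OF com] flip: one_tensor_def)
  qed (simp_all add: alg_hom_simps [OF com] linL linR)
  then show ?thesis
    by (simp add: L_def R_def m_def)
qed

section \<open>\<open>q\<close>-binomial coefficients\<close>

lemma qpow_diff_nonzero:
  assumes "2 \<le> p"
  shows "qpow p 1 - qpow p (- 1) \<noteq> 0"
proof
  assume "qpow p 1 - qpow p (- 1) = 0"
  then have "qpow p 1 * qpow p 1 = qpow p (- 1) * qpow p 1"
    by simp
  then have "qpow p 2 ^ 1 = 1"
    by (simp flip: qpow_add)
  then show False
    using qpow_2_order(3) [of p 1] assms by simp
qed

lemma qnum_add: "qnum p (x + y) = qpow p y * qnum p x + qpow p (- x) * qnum p y"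
  by (simp add: qnum_def algebra_simps add_divide_distrib diff_divide_distrib flip: qpow_add)

lemma qnum_nonzero:
  assumes "2 \<le> p" "0 < k" "k < p"
  shows "qnum p (real k) \<noteq> 0"
proof
  assume "qnum p (real k) = 0"
  then have "qpow p (real k) = qpow p (- real k)"
    using qpow_diff_nonzero [OF assms(1)] by (simp add: qnum_def)
  then have "qpow p (real k) * qpow p (real k) = 1"
    by (metis qpow_mult_minus(1))
  then have "qpow p 2 ^ k = 1"
    by (simp add: qpow_power mult.commute flip: qpow_add)
  then show False
    using qpow_2_order(3) [of p k] assms by simp
qed

lemma qfact_0 [simp]: "qfact p 0 = 1" and qfact_Suc: "qfact p (Suc n) = qfact p n * qnum p (real (Suc n))"
  by (simp_all add: qfact_def)

lemma qfact_nonzero: "2 \<le> p \<Longrightarrow> n < p \<Longrightarrow> qfact p n \<noteq> 0"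
  by (induction n) (simp_all add: qfact_Suc qnum_nonzero del: of_nat_Suc)

lemma qbinom_0: "2 \<le> p \<Longrightarrow> m < p \<Longrightarrow> qbinom p m 0 = 1"
  and qbinom_diag: "2 \<le> p \<Longrightarrow> m < p \<Longrightarrow> qbinom p m m = 1"
  by (simp_all add: qbinom_def qfact_nonzero)

text \<open>Both rules come from splitting [m+1] into [m-s] and [s+1] by \<open>qnum_add\<close>, in
  its two orders. The bound \<open>Suc m < p\<close> keeps all denominators nonzero. The first rule
  serves the coaction on powers of z, the second that on powers of the derivative.\<close>

lemma qbinom_pascal:
  assumes "2 \<le> p" "Suc m < p" "s < m"
  shows "qbinom p (Suc m) (Suc s)
      = qpow p (real (Suc s)) * qbinom p m (Suc s) + qpow p (- real (m - s)) * qbinom p m s"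
    and "qbinom p (Suc m) (Suc s)
      = qpow p (- real (Suc s)) * qbinom p m (Suc s) + qpow p (real (m - s)) * qbinom p m s"
proof -
  obtain j where m: "m = Suc (s + j)"
    using assms(3) less_iff_Suc_add by auto
  define a b where "a = qnum p (real (Suc s))" and "b = qnum p (real (Suc j))"
  have nz: "a \<noteq> 0" "b \<noteq> 0" "qfact p s \<noteq> 0" "qfact p j \<noteq> 0"
    unfolding a_def b_def by (rule qfact_nonzero qnum_nonzero; use assms m in simp)+
  have minus: "m - s = Suc j" "Suc m - Suc s = Suc j" "m - Suc s = j"
    by (simp_all add: m)
  have "real (Suc m) = real (Suc j) + real (Suc s)"
    by (simp add: m)
  then have sum: "qnum p (real (Suc m)) = qpow p (real (Suc s)) * b + qpow p (- real (Suc j)) * a"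
    "qnum p (real (Suc m)) = qpow p (- real (Suc s)) * b + qpow p (real (Suc j)) * a"
    using qnum_add [of p "real (Suc j)" "real (Suc s)"] qnum_add [of p "real (Suc s)" "real (Suc j)"]
    by (simp_all add: a_def b_def add.commute del: of_nat_Suc)
  show "qbinom p (Suc m) (Suc s)
      = qpow p (real (Suc s)) * qbinom p m (Suc s) + qpow p (- real (m - s)) * qbinom p m s"
    unfolding qbinom_def minus qfact_Suc [of _ s] qfact_Suc [of _ j] qfact_Suc [of _ m] sum(1)
      a_def [symmetric] b_def [symmetric]
    using nz by (simp add: field_simps del: of_nat_Suc)
  show "qbinom p (Suc m) (Suc s)
      = qpow p (- real (Suc s)) * qbinom p m (Suc s) + qpow p (real (m - s)) * qbinom p m s"
    unfolding qbinom_def minus qfact_Suc [of _ s] qfact_Suc [of _ j] qfact_Suc [of _ m] sum(2)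
      a_def [symmetric] b_def [symmetric]
    using nz by (simp add: field_simps del: of_nat_Suc)
qed

text \<open>The end terms are kept apart because \<open>qbinom p m (Suc m)\<close> is not 0: the
  truncated difference makes it the inverse of [m+1], so the Pascal rule fails at
  \<open>s = m\<close>.\<close>

lemma sum_pascal:
  fixes t u v :: "nat \<Rightarrow> 'a::comm_monoid_add"
  assumes "t 0 = u 0" "t (Suc m) = v m" "\<And>s. s < m \<Longrightarrow> t (Suc s) = u (Suc s) + v s"
  shows "(\<Sum>s=0..Suc m. t s) = (\<Sum>s=0..m. u s) + (\<Sum>s=0..m. v s)"
proof -
  have "(\<Sum>s=0..Suc m. t s) = t 0 + ((\<Sum>s<m. t (Suc s)) + t (Suc m))"
    unfolding atLeast0AtMost lessThan_Suc_atMost [symmetric] sum.lessThan_Suc_shift [of t]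
    by (simp only: sum.lessThan_Suc)
  also have "\<dots> = (u 0 + (\<Sum>s<m. u (Suc s))) + ((\<Sum>s<m. v s) + v m)"
    by (simp add: assms sum.distrib ac_simps)
  also have "\<dots> = (\<Sum>s=0..m. u s) + (\<Sum>s=0..m. v s)"
    unfolding atLeast0AtMost lessThan_Suc_atMost [symmetric] sum.lessThan_Suc_shift [of u]
    by (simp only: sum.lessThan_Suc)
  finally show ?thesis .
qed

section \<open>Powers of q-commuting elements\<close>

lemma q_commute_power_left:
  fixes A B :: "'a::complex_algebra"
  assumes "B * A = r *\<^sub>C (A * B)"
  shows "B ^ n * A = r ^ n *\<^sub>C (A * B ^ n)"
proof (induction n)
  case (Suc n)
  have "B ^ Suc n * A = r ^ n *\<^sub>C ((B * A) * B ^ n)"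
    by (simp add: Suc mult.assoc)
  then show ?case
    by (simp add: assms mult.assoc mult.commute)
qed simp

lemma scaleC_power: "(c *\<^sub>C x) ^ n = c ^ n *\<^sub>C x ^ n" for x :: "'a::complex_algebra"
  by (induction n) (simp_all add: mult.commute)

lemma power_minus_eq_zero: "x ^ n = 0 \<Longrightarrow> (- x) ^ n = 0" for x :: "'a::complex_algebra"
  using scaleC_power [of "- 1" x n] by simp

text \<open>In the application \<open>A\<close> and \<open>C\<close> are multiplications by a
  nilpotent generator from opposite sides, and \<open>D\<close> is an automorphism, not nilpotent
  itself. By q-commutation the p-th power of \<open>C * D\<close> is a multiple of
  \<open>C ^ p * D ^ p\<close>, hence 0, and \<open>q_freshman\<close> removes the mixed
  terms.\<close>

lemma q_sum_nilpotent:
  fixes A C D :: "'a::complex_algebra"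
  assumes "0 < p" "A ^ p = 0" "C ^ p = 0" "D * C = qpow p 2 *\<^sub>C (C * D)"
    and "C * D * A = qpow p 2 *\<^sub>C (A * (C * D))"
  shows "(c *\<^sub>C (A + C * D)) ^ p = 0"
proof -
  obtain e where "(C * D) ^ p = e *\<^sub>C (C ^ p * D ^ p)"
    using q_commute_mult_power [OF assms(4)] by blast
  moreover have "(A + C * D) ^ p = A ^ p + (C * D) ^ p"
    by (rule q_freshman [OF assms(5)]) (simp_all add: assms(1) qpow_2_order)
  ultimately show ?thesis
    by (simp add: scaleC_power assms(2,3))
qed

section \<open>Inner Yetter--Drinfeld structures\<close>

text \<open>One setting for both algebras: \<open>L\<close> is empty for \<open>Cq\<close> and
  consists of lambda for \<open>Hq\<close>. The map \<open>\<kappa>\<close> is the future action of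
  K, and the values of \<open>coact\<close> on z and d are the case m = 1 of the prescribed
  formulas.\<close>

locale quantum_plane =
  fixes z d :: "'x::complex_algebra" and L :: "'x set" and \<kappa> :: "'x \<Rightarrow> 'x"
    and coact :: "'x \<Rightarrow> ('p::finite Uq, 'x) tensor" and p :: nat and w :: complex
  assumes p_def: "p = CARD('p)" and p_ge_2: "2 \<le> p" and w_def: "w = qpow p 1 - qpow p (- 1)"
    and generated: "x \<in> generated ({z, d} \<union> L)"
    and \<kappa>_hom: "alg_hom \<kappa>"
    and \<kappa>_z: "\<kappa> z = qpow p 2 *\<^sub>C z" and \<kappa>_d: "\<kappa> d = qpow p (- 2) *\<^sub>C d"
    and \<kappa>_L: "l \<in> L \<Longrightarrow> \<exists>c. \<kappa> l = c *\<^sub>C l \<and> c ^ (2 * p) = 1"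
    and central: "l \<in> L \<Longrightarrow> x * l = l * x"
    and z_power: "z ^ p = 0" and d_power: "d ^ p = 0"
    and dz: "d * z = w *\<^sub>C 1 + qpow p (- 2) *\<^sub>C (z * d)"
    and coact_hom: "alg_hom coact"
    and coact_z: "coact z
      = Uq_Kinv \<otimes> z - w *\<^sub>C ((Uq_E * Uq_Kinv) \<otimes> 1)"
    and coact_d: "coact d
      = Uq_Kinv \<otimes> d + w *\<^sub>C (Uq_F \<otimes> 1)"
    and coact_L: "l \<in> L \<Longrightarrow> coact l = 1 \<otimes> l"
begin

lemma w_nonzero: "w \<noteq> 0"
  using qpow_diff_nonzero [OF p_ge_2] by (simp add: w_def)

lemma p_pos: "0 < p"
  using p_ge_2 by simp

section \<open>The automorphism \<open>\<kappa>\<close> and its inverse\<close>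

lemma alg_hom_eqI:
  fixes f g :: "'x \<Rightarrow> 'b::complex_algebra"
  assumes "alg_hom f" "alg_hom g" "f z = g z" "f d = g d" "\<And>l. l \<in> L \<Longrightarrow> f l = g l"
  shows "f x = g x"
  by (rule alg_hom_eq_on_generated [OF assms(1,2) _ generated]) (use assms in auto)

text \<open>By \<open>\<kappa>_order\<close> the 2p-th power of \<open>\<kappa>\<close> is the
  identity, so this power is the inverse; being an iterate, it is visibly an algebra
  morphism.\<close>

definition \<kappa>inv :: "'x \<Rightarrow> 'x" where
  "\<kappa>inv = \<kappa> ^^ (2 * p - 1)"

lemma \<kappa>inv_hom: "alg_hom \<kappa>inv"
  by (simp add: \<kappa>inv_def alg_hom_funpow \<kappa>_hom)

lemma \<kappa>_order: "(\<kappa> ^^ (2 * p)) x = x"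
proof (rule alg_hom_eqI [OF alg_hom_funpow [OF \<kappa>_hom] alg_hom_id])
  have pow: "(\<kappa> ^^ n) y = c ^ n *\<^sub>C y" if "\<kappa> y = c *\<^sub>C y" for n y c
    by (induction n) (simp_all add: that alg_hom_scaleC [OF \<kappa>_hom] mult.commute)
  show "(\<kappa> ^^ (2 * p)) z = z" "(\<kappa> ^^ (2 * p)) d = d"
    unfolding pow [OF \<kappa>_z] pow [OF \<kappa>_d]
    by (simp_all add: mult.commute [of 2] power_mult qpow_2_order p_pos)
  show "(\<kappa> ^^ (2 * p)) l = l" if "l \<in> L" for l
    using \<kappa>_L [OF that] pow by auto
qed

lemma \<kappa>_\<kappa>inv [simp]: "\<kappa> (\<kappa>inv x) = x" and \<kappa>inv_\<kappa> [simp]: "\<kappa>inv (\<kappa> x) = x"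
proof -
  have "2 * p = Suc (2 * p - 1)"
    using p_pos by simp
  then show "\<kappa> (\<kappa>inv x) = x"
    using \<kappa>_order [of x] unfolding \<kappa>inv_def by (metis funpow.simps(2) comp_apply)
  then show "\<kappa>inv (\<kappa> x) = x"
    by (simp add: \<kappa>inv_def funpow_swap1)
qed

lemma \<kappa>inv_z: "\<kappa>inv z = qpow p (- 2) *\<^sub>C z" and \<kappa>inv_d: "\<kappa>inv d = qpow p 2 *\<^sub>C d"
proof -
  have "\<kappa>inv (\<kappa> z) = qpow p 2 *\<^sub>C \<kappa>inv z" "\<kappa>inv (\<kappa> d) = qpow p (- 2) *\<^sub>C \<kappa>inv d"
    by (simp_all only: \<kappa>_z \<kappa>_d alg_hom_scaleC [OF \<kappa>inv_hom])
  then have "z = qpow p 2 *\<^sub>C \<kappa>inv z" "d = qpow p (- 2) *\<^sub>C \<kappa>inv d"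
    by simp_all
  from arg_cong [OF this(1), of "scaleC (qpow p (- 2))"] arg_cong [OF this(2), of "scaleC (qpow p 2)"]
  show "\<kappa>inv z = qpow p (- 2) *\<^sub>C z" "\<kappa>inv d = qpow p 2 *\<^sub>C d"
    by simp_all
qed

lemmas \<kappa>_simps = alg_hom_simps [OF \<kappa>_hom] \<kappa>_z \<kappa>_d alg_hom_simps [OF \<kappa>inv_hom] \<kappa>inv_z \<kappa>inv_d

section \<open>The action of the quantum group and the module algebra laws\<close>

definition act_K :: "'x endo" where "act_K = Endo \<kappa>"
definition act_Kinv :: "'x endo" where "act_Kinv = Endo \<kappa>inv"
text \<open>The sign sits inside the multiplication operator so that the bracket has the shape
  \<open>A + C * D\<close> of \<open>q_sum_nilpotent\<close>; the same holds for
  \<open>act_F\<close>.\<close>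

definition act_E :: "'x endo" where
  "act_E = (1 / w) *\<^sub>C (right_mult z + left_mult (- z) * act_K)"
definition act_F :: "'x endo" where
  "act_F = (1 / w) *\<^sub>C (left_mult d + right_mult (- d) * act_Kinv)"

lemma endo_apply_act:
  "endo_apply act_K x = \<kappa> x" "endo_apply act_Kinv x = \<kappa>inv x"
  "endo_apply act_E x = (1 / w) *\<^sub>C (x * z - z * \<kappa> x)"
  "endo_apply act_F x = (1 / w) *\<^sub>C (d * x - \<kappa>inv x * d)"
  by (simp_all add: act_K_def act_Kinv_def act_E_def act_F_def endo_apply_Endo alg_hom_linear
      \<kappa>_hom \<kappa>inv_hom)

definition gen_act :: "'p Uq_gen \<Rightarrow> 'x endo" where
  "gen_act g = (case g of Gen_E \<Rightarrow> act_E | Gen_F \<Rightarrow> act_F | Gen_K \<Rightarrow> act_K | Gen_Kinv \<Rightarrow> act_Kinv)"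

lemma gen_act_relators:
  assumes "r \<in> relators"
  shows "free_lift gen_act r = 0"
proof -
  have "act_K * act_Kinv = 1" "act_Kinv * act_K = 1"
    by (rule endo_eqI; simp add: endo_apply_act)+
  moreover have "act_K * act_E * act_Kinv = qpow p 2 *\<^sub>C act_E"
    by (rule endo_eqI) (simp add: endo_apply_act \<kappa>_simps scaleC_diff_right mult.commute)
  moreover have "act_K * act_F * act_Kinv = qpow p (- 2) *\<^sub>C act_F"
    by (rule endo_eqI) (simp add: endo_apply_act \<kappa>_simps scaleC_diff_right mult.commute)
  moreover have "act_E * act_F - act_F * act_E = (1 / w) *\<^sub>C (act_K - act_Kinv)"
  proof (rule endo_eqI)
    fix x
    have dz': "d * (z * y) = w *\<^sub>C y + qpow p (- 2) *\<^sub>C (z * (d * y))" for y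
      using dz by (simp add: distrib_right flip: mult.assoc)
    \<comment> \<open>The terms d x z and z x d cancel. What is left is d z - q^(-2) z d multiplied
      by \<open>\<kappa> x\<close> on the right, minus the same element multiplied by
      \<open>\<kappa>inv x\<close> on the left, and by \<open>dz\<close> that element is the scalar
      w.\<close>
    have "(d * x - \<kappa>inv x * d) * z - z * \<kappa> (d * x - \<kappa>inv x * d)
        - (d * (x * z - z * \<kappa> x) - \<kappa>inv (x * z - z * \<kappa> x) * d) = w *\<^sub>C (\<kappa> x - \<kappa>inv x)"
      by (simp add: \<kappa>_simps dz dz' mult.assoc distrib_left left_diff_distrib right_diff_distrib
          scaleC_diff_right)
    moreover have "endo_apply (act_E * act_F - act_F * act_E) x = (1 / w) *\<^sub>C (1 / w) *\<^sub>C
      ((d * x - \<kappa>inv x * d) * z - z * \<kappa> (d * x - \<kappa>inv x * d)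
        - (d * (x * z - z * \<kappa> x) - \<kappa>inv (x * z - z * \<kappa> x) * d))"
      by (simp add: endo_apply_act alg_hom_scaleC [OF \<kappa>_hom] alg_hom_scaleC [OF \<kappa>inv_hom]
          flip: scaleC_diff_right)
    ultimately show "endo_apply (act_E * act_F - act_F * act_E) x
        = endo_apply ((1 / w) *\<^sub>C (act_K - act_Kinv)) x"
      using w_nonzero by (simp add: endo_apply_act)
  qed
  moreover have "act_E ^ p = 0"
    unfolding act_E_def
    by (rule q_sum_nilpotent)
      (auto intro!: endo_eqI
        simp: p_pos left_mult_power right_mult_power power_minus_eq_zero z_power endo_apply_act \<kappa>_simps mult.assoc)
  moreover have "act_F ^ p = 0"
    unfolding act_F_def
    by (rule q_sum_nilpotent)
      (auto intro!: endo_eqI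
        simp: p_pos left_mult_power right_mult_power power_minus_eq_zero d_power endo_apply_act \<kappa>_simps mult.assoc)
  moreover have "act_K ^ (2 * p) = 1"
  proof (rule endo_eqI)
    have "endo_apply act_K = \<kappa>"
      by (simp add: fun_eq_iff endo_apply_act)
    then show "endo_apply (act_K ^ (2 * p)) x = endo_apply 1 x" for x
      by (simp only: endo_apply_power \<kappa>_order one_endo.rep_eq)
  qed
  ultimately show ?thesis
    using assms unfolding relators_Uq_gen_def Let_def p_def [symmetric] w_def [symmetric]
    by (auto simp: free_lift_simps gen_act_def)
qed

definition act :: "'p Uq \<Rightarrow> 'x \<Rightarrow> 'x" where
  "act h = endo_apply (presented_lift gen_act h)"

lemma act_hom: "alg_hom (presented_lift gen_act :: 'p Uq \<Rightarrow> 'x endo)"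
  by (rule alg_hom_presented_lift [OF gen_act_relators])

lemma clinear_act: "clinear (act h)"
  by (simp add: act_def clinear_endo_apply)

lemma act_add: "act (g + h) x = act g x + act h x"
  and act_scaleC: "act (c *\<^sub>C g) x = c *\<^sub>C act g x"
  and act_one_left: "act 1 x = x"
  and act_mult_left: "act (g * h) x = act g (act h x)"
  by (simp_all add: act_def alg_hom_simps [OF act_hom])

lemma act_gen:
  "act Uq_K x = \<kappa> x" "act Uq_Kinv x = \<kappa>inv x"
  "act Uq_E x = (1 / w) *\<^sub>C (x * z - z * \<kappa> x)"
  "act Uq_F x = (1 / w) *\<^sub>C (d * x - \<kappa>inv x * d)"
  by (simp_all add: act_def presented_lift_gen [OF gen_act_relators] gen_act_def endo_apply_act)

lemma cbilinear_act: "cbilinear act"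
  by (rule cbilinearI)
    (simp_all add: act_add act_scaleC clinear_add [OF clinear_act] clinear_scaleC [OF clinear_act])

text \<open>The twisted Leibniz rules telescope: for E the two occurrences of
  \<open>x * z * \<kappa> y\<close> cancel, for F those of
  \<open>\<kappa>inv x * d * y\<close>.\<close>

lemma left_module_algebra_act: "left_module_algebra Uq_comult Uq_counit act"
proof (rule left_module_algebraI [OF Uq_comult_well_defined(1) Uq_counit_well_defined(1)
      cbilinear_act act_one_left act_mult_left generated_Uq])
  fix h :: "'p Uq" and x y
  assume h: "h \<in> {Uq_E, Uq_F, Uq_K, Uq_Kinv}"
  have bil: "cbilinear (\<lambda>h' h''. act h' x * act h'' y)"
    by (rule cbilinearI) (simp_all add: act_add act_scaleC algebra_simps)
  show "act h (x * y) = tensor_lift (\<lambda>h' h''. act h' x * act h'' y) (Uq_comult h)"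
    using h by (auto simp: Uq_comult_well_defined bil tensor_lift_add [OF bil] act_gen act_one_left
        \<kappa>_simps mult.assoc left_diff_distrib right_diff_distrib scaleC_diff_right)
  show "act h 1 = Uq_counit h *\<^sub>C 1"
    using h by (auto simp: Uq_counit_well_defined act_gen \<kappa>_simps)
qed

section \<open>The action on powers of z, d and lambda\<close>

text \<open>The recurrence for the lower-order coefficient in \<open>dz_power\<close> and
  \<open>d_power_z\<close>: exchanging d with one more z, or z with one more d, contributes w
  q^(-2n).\<close>

lemma commutator_coeff_Suc:
  "w * qnum p (real (Suc n)) * qpow p (1 - real (Suc n))
    = w * qnum p (real n) * qpow p (1 - real n) + w * qpow p (- 2 * real n)"
proof -
  have "qnum p 1 = 1"
    using w_nonzero by (simp add: qnum_def w_def)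
  then have "qnum p (real (Suc n)) = qpow p 1 * qnum p (real n) + qpow p (- real n)"
    using qnum_add [of p "real n" 1] by (simp add: add.commute)
  moreover have "qpow p (1 - real n) = qpow p 1 * qpow p (- real n)"
    "qpow p (- 2 * real n) = qpow p (- real n) * qpow p (- real n)"
    "qpow p (1 - real (Suc n)) = qpow p (- real n)"
    by (simp_all flip: qpow_add)
  ultimately show ?thesis
    by (simp only:) (simp add: algebra_simps)
qed

lemma qpow_neg_Suc: "qpow p (- (2 * real (Suc n))) = qpow p (- 2) * qpow p (- (2 * real n))"
  by (simp add: algebra_simps flip: qpow_add)

lemma dz_power: "d * z ^ n = (w * qnum p (real n) * qpow p (1 - real n)) *\<^sub>C z ^ (n - 1)
    + qpow p (- 2 * real n) *\<^sub>C (z ^ n * d)"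
proof (induction n)
  case 0
  show ?case
    by (simp add: qnum_def)
next
  case (Suc n)
  \<comment> \<open>At \<open>n = 0\<close> the truncated exponent makes the powers of z on the two
    sides differ, but both carry the coefficient [0] = 0.\<close>
  have z: "(w * qnum p (real n) * qpow p (1 - real n)) *\<^sub>C z ^ (n - 1) * z
      = (w * qnum p (real n) * qpow p (1 - real n)) *\<^sub>C z ^ n"
    by (cases n) (simp_all add: qnum_def flip: power_Suc2)
  have "d * z ^ Suc n = (d * z ^ n) * z"
    by (simp only: power_Suc2 mult.assoc)
  also have "\<dots> = (w * qnum p (real n) * qpow p (1 - real n) + w * qpow p (- 2 * real n)) *\<^sub>C z ^ n
      + qpow p (- 2 * real (Suc n)) *\<^sub>C (z ^ Suc n * d)"
    unfolding Suc distrib_right z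
    by (simp add: mult.assoc dz distrib_left scaleC_add_left scaleC_add_right power_Suc2 qpow_neg_Suc
        mult.commute [of w] mult.commute [of "qpow p (- 2)"] del: power_Suc of_nat_Suc)
  finally show ?case
    by (simp only: commutator_coeff_Suc diff_Suc_1)
qed

lemma d_power_z: "d ^ n * z = (w * qnum p (real n) * qpow p (1 - real n)) *\<^sub>C d ^ (n - 1)
    + qpow p (- 2 * real n) *\<^sub>C (z * d ^ n)"
proof (induction n)
  case 0
  show ?case
    by (simp add: qnum_def)
next
  case (Suc n)
  have d: "d * ((w * qnum p (real n) * qpow p (1 - real n)) *\<^sub>C d ^ (n - 1))
      = (w * qnum p (real n) * qpow p (1 - real n)) *\<^sub>C d ^ n"
    by (cases n) (simp_all add: qnum_def)
  have dz': "d * (z * y) = w *\<^sub>C y + qpow p (- 2) *\<^sub>C (z * (d * y))" for y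
    using dz by (simp add: distrib_right flip: mult.assoc)
  have "d ^ Suc n * z = d * (d ^ n * z)"
    by (simp only: power_Suc mult.assoc)
  also have "\<dots> = (w * qnum p (real n) * qpow p (1 - real n) + w * qpow p (- 2 * real n)) *\<^sub>C d ^ n
      + qpow p (- 2 * real (Suc n)) *\<^sub>C (z * d ^ Suc n)"
    unfolding Suc distrib_left d
    by (simp add: dz' scaleC_add_left scaleC_add_right qpow_neg_Suc
        mult.commute [of w] mult.commute [of "qpow p (- 2)"] del: of_nat_Suc)
  finally show ?case
    by (simp only: commutator_coeff_Suc diff_Suc_1)
qed

text \<open>For E on powers of z and F on powers of d only the factor 1 - q^(2n) = -q^n w [n]
  appears. In the two crossed cases the twist by \<open>\<kappa>\<close> or
  \<open>\<kappa>inv\<close> cancels exactly the second term of \<open>d_power_z\<close> or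
  \<open>dz_power\<close>.\<close>

lemma zd_action_act: "zd_action act z d"
proof -
  have \<kappa>_pow: "\<kappa> (z ^ n) = qpow p (2 * real n) *\<^sub>C z ^ n" "\<kappa> (d ^ n) = qpow p (- 2 * real n) *\<^sub>C d ^ n"
    "\<kappa>inv (z ^ n) = qpow p (- 2 * real n) *\<^sub>C z ^ n" "\<kappa>inv (d ^ n) = qpow p (2 * real n) *\<^sub>C d ^ n" for n
    unfolding alg_hom_power [OF \<kappa>_hom] alg_hom_power [OF \<kappa>inv_hom] \<kappa>_z \<kappa>_d \<kappa>inv_z \<kappa>inv_d scaleC_power
      qpow_power by (simp_all add: mult.commute)
  have coeff: "- qpow p (real n) * qnum p (real n) = (1 / w) * (1 - qpow p (2 * real n))" for n
    using w_nonzero by (simp add: qnum_def w_def [symmetric] field_simps flip: qpow_add)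
  have shift: "z ^ n * z = z ^ (n + 1)" "z * z ^ n = z ^ (n + 1)" "d ^ n * d = d ^ (n + 1)"
    "d * d ^ n = d ^ (n + 1)" for n
    by (simp_all add: power_commutes)
  have "act Uq_E (z ^ n) = (- qpow p (real n) * qnum p (real n)) *\<^sub>C z ^ (n + 1)"
    "act Uq_F (d ^ n) = (- qpow p (real n) * qnum p (real n)) *\<^sub>C d ^ (n + 1)" for n
    unfolding coeff act_gen \<kappa>_pow mult_scaleC_left mult_scaleC_right shift
    by (simp_all add: scaleC_diff_left diff_divide_distrib scaleC_diff_right)
  moreover have "act Uq_F (z ^ n) = (qnum p (real n) * qpow p (1 - real n)) *\<^sub>C z ^ (n - 1)" for n
    using w_nonzero by (simp add: act_gen \<kappa>_pow dz_power)
  moreover have "act Uq_E (d ^ n) = (qpow p (1 - real n) * qnum p (real n)) *\<^sub>C d ^ (n - 1)" for n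
    using w_nonzero by (simp add: act_gen \<kappa>_pow d_power_z mult.commute)
  ultimately show ?thesis
    unfolding zd_action_def Let_def p_def [symmetric] by (simp add: act_gen \<kappa>_pow)
qed

text \<open>As l is central, the inner formulas give l^n z and l^n d with factors (1 - q^(-n)) / w
  and (1 - q^n) / w. The half-integer q-numbers arise from factoring out q^(-n/2) and
  q^(n/2).\<close>

lemma lambda_action_act:
  assumes l: "l \<in> L" "\<kappa> l = qpow p (- 1) *\<^sub>C l"
  shows "lambda_action act z d l"
proof -
  have \<kappa>inv_l: "\<kappa>inv l = qpow p 1 *\<^sub>C l"
  proof -
    have "l = qpow p (- 1) *\<^sub>C \<kappa>inv l"
      using \<kappa>inv_\<kappa> [of l] unfolding l(2) alg_hom_scaleC [OF \<kappa>inv_hom] by simp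
    from arg_cong [OF this, of "scaleC (qpow p 1)"] show ?thesis
      by simp
  qed
  have \<kappa>_pow: "\<kappa> (l ^ n) = qpow p (- real n) *\<^sub>C l ^ n" "\<kappa>inv (l ^ n) = qpow p (real n) *\<^sub>C l ^ n" for n
    unfolding alg_hom_power [OF \<kappa>_hom] alg_hom_power [OF \<kappa>inv_hom] \<kappa>inv_l l(2) scaleC_power
      qpow_power by simp_all
  have comm: "x * l ^ n = l ^ n * x" for x n
    using power_commuting_commutes [of l x n] central [OF l(1), of x] by simp
  have coeff: "qpow p (- real n / 2) * qnum p (real n / 2) = (1 / w) * (1 - qpow p (- real n))"
    "- qpow p (real n / 2) * qnum p (real n / 2) = (1 / w) * (1 - qpow p (real n))" for n
    using w_nonzero by (simp_all add: qnum_def w_def [symmetric] field_simps flip: qpow_add)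
  show ?thesis
    unfolding lambda_action_def Let_def p_def [symmetric] coeff
    by (simp add: act_gen \<kappa>_pow comm scaleC_diff_left diff_divide_distrib scaleC_diff_right)
qed

section \<open>The coaction on powers of z and d\<close>

text \<open>Multiplying the m-th formula by \<open>coact z\<close> sends the term of index s to the
  indices s and s + 1; the latter picks up q^(-2m) from moving K^(-m) past E. The first Pascal rule
  recombines the two contributions.\<close>

lemma coact_z_power:
  assumes "m < p"
  shows "coact (z ^ m) = (\<Sum>s=0..m.
      ((- 1) ^ s * qpow p (real s * (1 - real m)) * w ^ s * qbinom p m s) *\<^sub>C
        ((Uq_E ^ s * Uq_Kinv ^ m) \<otimes> z ^ (m - s)))"
  using assms
proof (induction m)
  case 0
  show ?case
    using qbinom_0 [OF p_ge_2 0] by (simp add: alg_hom_one [OF coact_hom] one_tensor_def)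
next
  case (Suc m)
  let ?c = "\<lambda>m s. (- 1) ^ s * qpow p (real s * (1 - real m)) * w ^ s * qbinom p m s"
  let ?e = "\<lambda>s j. (Uq_E ^ s * Uq_Kinv ^ Suc m) \<otimes> z ^ j :: ('p Uq, 'x) tensor"
  have KE: "Uq_Kinv ^ m * (Uq_E * Uq_Kinv) = qpow p (- 2 * real m) *\<^sub>C (Uq_E * Uq_Kinv ^ Suc m :: 'p Uq)"
  proof -
    have "Uq_Kinv ^ m * (Uq_E * Uq_Kinv) = (Uq_Kinv ^ m * Uq_E) * (Uq_Kinv :: 'p Uq)"
      by (simp only: mult.assoc)
    also have "\<dots> = qpow p (- 2) ^ m *\<^sub>C (Uq_E * Uq_Kinv ^ m) * Uq_Kinv"
      using q_commute_power_left [OF Uq_commute(5) [where 'p = 'p], of m] by (simp only: p_def)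
    finally show ?thesis
      by (simp only: qpow_power mult_scaleC_left mult.assoc power_Suc2 mult.commute [of "- 2 :: real"])
  qed
  have E: "((Uq_E ^ s * Uq_Kinv ^ m) \<otimes> z ^ (m - s)) * coact z
      = ?e s (Suc m - s) - (w * qpow p (- 2 * real m)) *\<^sub>C ?e (Suc s) (m - s)" if "s \<le> m" for s
  proof -
    have "Uq_E ^ s * Uq_Kinv ^ m * (Uq_E * Uq_Kinv)
        = qpow p (- 2 * real m) *\<^sub>C (Uq_E ^ Suc s * Uq_Kinv ^ Suc m :: 'p Uq)"
      by (simp only: mult.assoc KE mult_scaleC_right power_Suc2 [of _ s])
    then show ?thesis
      using that by (simp add: coact_z right_diff_distrib tens_linear mult.assoc Suc_diff_le
          power_commutes del: power_Suc) (simp add: power_commutes mult.assoc)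
  qed
  have "coact (z ^ Suc m) = coact (z ^ m) * coact z"
    by (simp only: power_Suc2 alg_hom_mult [OF coact_hom])
  also have "\<dots> = (\<Sum>s=0..m. ?c m s *\<^sub>C ?e s (Suc m - s)
      + (- ?c m s * w * qpow p (- 2 * real m)) *\<^sub>C ?e (Suc s) (m - s))"
    unfolding Suc.IH [OF Suc_lessD [OF Suc.prems]] sum_distrib_right mult_scaleC_left
    by (rule sum.cong [OF refl]) (subst E; simp add: scaleC_diff_right mult.assoc)
  also have "\<dots> = (\<Sum>s=0..m. ?c m s *\<^sub>C ?e s (Suc m - s))
      + (\<Sum>s=0..m. (- ?c m s * w * qpow p (- 2 * real m)) *\<^sub>C ?e (Suc s) (m - s))"
    by (rule sum.distrib)
  also have "\<dots> = (\<Sum>s=0..Suc m. ?c (Suc m) s *\<^sub>C ?e s (Suc m - s))"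
  proof (rule sum_pascal [symmetric])
    show "?c (Suc m) 0 *\<^sub>C ?e 0 (Suc m - 0) = ?c m 0 *\<^sub>C ?e 0 (Suc m - 0)"
      using Suc by (simp add: qbinom_0 p_ge_2)
    have exp: "qpow p (real (Suc m) * (1 - real (Suc m)))
        = qpow p (real m * (1 - real m)) * qpow p (- 2 * real m)"
      unfolding qpow_add [symmetric] by (simp add: algebra_simps)
    then show "?c (Suc m) (Suc m) *\<^sub>C ?e (Suc m) (Suc m - Suc m)
        = (- ?c m m * w * qpow p (- 2 * real m)) *\<^sub>C ?e (Suc m) (m - m)"
      using Suc by (simp add: qbinom_diag p_ge_2 exp mult.assoc mult.left_commute mult.commute del: of_nat_Suc)
    fix s assume s: "s < m"
    have exp: "qpow p (real (Suc s) * (1 - real (Suc m))) * qpow p (real (Suc s))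
        = qpow p (real (Suc s) * (1 - real m))"
      "qpow p (real (Suc s) * (1 - real (Suc m))) * qpow p (- real (m - s))
        = qpow p (real s * (1 - real m)) * qpow p (- 2 * real m)"
      unfolding qpow_add [symmetric] using s by (simp_all add: algebra_simps of_nat_diff)
    have "?c (Suc m) (Suc s) = (- 1) ^ Suc s * w ^ Suc s *
        (qpow p (real (Suc s) * (1 - real (Suc m))) * qpow p (real (Suc s)) * qbinom p m (Suc s)
        + qpow p (real (Suc s) * (1 - real (Suc m))) * qpow p (- real (m - s)) * qbinom p m s)"
      unfolding qbinom_pascal(1) [OF p_ge_2 Suc.prems s] by (simp only: algebra_simps)
    also have "\<dots> = ?c m (Suc s) - ?c m s * w * qpow p (- 2 * real m)"
      unfolding exp by (simp add: algebra_simps)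
    finally show "?c (Suc m) (Suc s) *\<^sub>C ?e (Suc s) (Suc m - Suc s)
        = ?c m (Suc s) *\<^sub>C ?e (Suc s) (Suc m - Suc s)
          + (- ?c m s * w * qpow p (- 2 * real m)) *\<^sub>C ?e (Suc s) (m - s)"
      by (simp add: scaleC_diff_left del: power_Suc of_nat_Suc)
  qed
  finally show ?case .
qed

text \<open>Here only K^(-(m-s)) has to pass F, which yields q^(2(m-s)), and the second Pascal rule
  recombines the terms.\<close>

lemma coact_d_power:
  assumes "m < p"
  shows "coact (d ^ m) = (\<Sum>s=0..m.
      (qpow p (real s * (real m - real s)) * w ^ s * qbinom p m s) *\<^sub>C
        ((Uq_F ^ s * Uq_Kinv ^ (m - s)) \<otimes> d ^ (m - s)))"
  using assms
proof (induction m)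
  case 0
  show ?case
    using qbinom_0 [OF p_ge_2 0] by (simp add: alg_hom_one [OF coact_hom] one_tensor_def)
next
  case (Suc m)
  let ?c = "\<lambda>m s. qpow p (real s * (real m - real s)) * w ^ s * qbinom p m s"
  let ?e = "\<lambda>s j. (Uq_F ^ s * Uq_Kinv ^ j) \<otimes> d ^ j :: ('p Uq, 'x) tensor"
  have KF: "Uq_Kinv ^ j * Uq_F = qpow p (2 * real j) *\<^sub>C (Uq_F * Uq_Kinv ^ j :: 'p Uq)" for j
    using q_commute_power_left [OF Uq_commute(6) [where 'p = 'p], of j]
    by (simp only: p_def qpow_power mult.commute [of 2])
  have F: "?e s (m - s) * coact d
      = ?e s (Suc m - s) + (w * qpow p (2 * real (m - s))) *\<^sub>C ?e (Suc s) (m - s)" if "s \<le> m" for s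
  proof -
    have "Uq_F ^ s * Uq_Kinv ^ (m - s) * Uq_F
        = qpow p (2 * real (m - s)) *\<^sub>C (Uq_F ^ Suc s * Uq_Kinv ^ (m - s) :: 'p Uq)"
      by (simp only: mult.assoc KF mult_scaleC_right power_Suc2 [of _ s])
    then show ?thesis
      using that by (simp add: coact_d distrib_left tens_linear mult.assoc Suc_diff_le
          power_commutes del: power_Suc) (simp add: power_commutes mult.assoc)
  qed
  have "coact (d ^ Suc m) = coact (d ^ m) * coact d"
    by (simp only: power_Suc2 alg_hom_mult [OF coact_hom])
  also have "\<dots> = (\<Sum>s=0..m. ?c m s *\<^sub>C ?e s (Suc m - s)
      + (?c m s * w * qpow p (2 * real (m - s))) *\<^sub>C ?e (Suc s) (m - s))"
    unfolding Suc.IH [OF Suc_lessD [OF Suc.prems]] sum_distrib_right mult_scaleC_left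
    by (rule sum.cong [OF refl]) (subst F; simp add: scaleC_add_right mult.assoc)
  also have "\<dots> = (\<Sum>s=0..m. ?c m s *\<^sub>C ?e s (Suc m - s))
      + (\<Sum>s=0..m. (?c m s * w * qpow p (2 * real (m - s))) *\<^sub>C ?e (Suc s) (m - s))"
    by (rule sum.distrib)
  also have "\<dots> = (\<Sum>s=0..Suc m. ?c (Suc m) s *\<^sub>C ?e s (Suc m - s))"
  proof (rule sum_pascal [symmetric])
    show "?c (Suc m) 0 *\<^sub>C ?e 0 (Suc m - 0) = ?c m 0 *\<^sub>C ?e 0 (Suc m - 0)"
      using Suc by (simp add: qbinom_0 p_ge_2)
    show "?c (Suc m) (Suc m) *\<^sub>C ?e (Suc m) (Suc m - Suc m)
        = (?c m m * w * qpow p (2 * real (m - m))) *\<^sub>C ?e (Suc m) (m - m)"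
      using Suc by (simp add: qbinom_diag p_ge_2 mult.commute)
    fix s assume s: "s < m"
    have exp: "qpow p (real (Suc s) * (real (Suc m) - real (Suc s))) * qpow p (- real (Suc s))
        = qpow p (real (Suc s) * (real m - real (Suc s)))"
      "qpow p (real (Suc s) * (real (Suc m) - real (Suc s))) * qpow p (real (m - s))
        = qpow p (real s * (real m - real s)) * qpow p (2 * real (m - s))"
      unfolding qpow_add [symmetric] using s by (simp_all add: algebra_simps of_nat_diff)
    have "?c (Suc m) (Suc s) = w ^ Suc s *
        (qpow p (real (Suc s) * (real (Suc m) - real (Suc s))) * qpow p (- real (Suc s)) * qbinom p m (Suc s)
        + qpow p (real (Suc s) * (real (Suc m) - real (Suc s))) * qpow p (real (m - s)) * qbinom p m s)"
      unfolding qbinom_pascal(2) [OF p_ge_2 Suc.prems s] by (simp only: algebra_simps)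
    also have "\<dots> = ?c m (Suc s) + ?c m s * w * qpow p (2 * real (m - s))"
      unfolding exp by (simp add: algebra_simps)
    finally show "?c (Suc m) (Suc s) *\<^sub>C ?e (Suc s) (Suc m - Suc s)
        = ?c m (Suc s) *\<^sub>C ?e (Suc s) (Suc m - Suc s)
          + (?c m s * w * qpow p (2 * real (m - s))) *\<^sub>C ?e (Suc s) (m - s)"
      by (simp add: scaleC_add_left del: power_Suc of_nat_Suc)
  qed
  finally show ?case .
qed

lemma zd_coaction_coact: "zd_coaction coact z d"
  using coact_z_power coact_d_power
  unfolding zd_coaction_def Let_def p_def [symmetric] w_def [symmetric] by blast

section \<open>The comodule algebra axioms\<close>

lemma left_comodule_algebra_coact: "left_comodule_algebra Uq_comult Uq_counit coact"
proof
  note com = Uq_comult_well_defined [where 'p = 'p] and cou = Uq_counit_well_defined [where 'p = 'p]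
  show "alg_hom coact"
    by (rule coact_hom)
  fix x
  show "tensor_lift (\<lambda>a y. tensor_lift (\<lambda>c d. c \<otimes> (d \<otimes> y)) (Uq_comult a)) (coact x)
      = tensor_lift (\<lambda>a y. a \<otimes> coact y) (coact x)"
  proof -
    note hom = alg_hom_reassoc [OF com(1), where 'x = 'x] alg_hom_tensor_map [OF alg_hom_id coact_hom]
    have "reassoc Uq_comult (coact x) = tensor_map (\<lambda>a. a) coact (coact x)"
      by (rule alg_hom_eqI [OF alg_hom_compose [OF hom(1) coact_hom]
            alg_hom_compose [OF hom(2) coact_hom]])
        (simp_all add: coact_z coact_d coact_L alg_hom_simps [OF hom(1)] alg_hom_simps [OF hom(2)]
          reassoc_tens com cbilinear_reassoc_inner clinear_id alg_hom_linear coact_hom tens_linear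
          alg_hom_simps [OF com(1)] alg_hom_one [OF coact_hom] one_tensor_def distrib_right
          clinear_add [OF clinear_tensor_lift [OF cbilinear_reassoc_inner]] scaleC_add_right
          Uq_relations)
    then show ?thesis
      by (simp add: reassoc_def tensor_map_def)
  qed
  have bil: "cbilinear (\<lambda>(a :: 'p Uq) y :: 'x. Uq_counit a *\<^sub>C y)"
    by (rule cbilinearI)
      (simp_all add: alg_hom_simps [OF cou(1)] scaleC_add_left scaleC_add_right scaleC_complex_def mult.commute)
  have "alg_hom (\<lambda>h :: 'p Uq. Uq_counit h *\<^sub>C (1 :: 'x))"
    by (simp add: alg_hom_def clinear_def alg_hom_simps [OF cou(1)] scaleC_add_left scaleC_complex_def mult.commute)
  from alg_hom_tensor_lift_mult [OF this alg_hom_id]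
  have hom: "alg_hom (tensor_lift (\<lambda>(a :: 'p Uq) y :: 'x. Uq_counit a *\<^sub>C y))"
    by simp
  show "tensor_lift (\<lambda>a y. Uq_counit a *\<^sub>C y) (coact x) = x"
    by (rule alg_hom_eqI [OF alg_hom_compose [OF hom coact_hom] alg_hom_id])
      (simp_all add: coact_z coact_d coact_L alg_hom_simps [OF hom] bil cou alg_hom_simps [OF cou(1)])
qed

section \<open>The Yetter--Drinfeld condition\<close>

definition map_act :: "'p Uq \<Rightarrow> ('p Uq, 'x) tensor \<Rightarrow> ('p Uq, 'x) tensor" where
  "map_act h = tensor_map (\<lambda>a. a) (act h)"

lemma map_act_tens: "map_act h (a \<otimes> y) = a \<otimes> act h y"
  by (simp add: map_act_def clinear_id clinear_act)

lemma clinear_map_act: "clinear (map_act h)"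
  by (simp add: map_act_def clinear_tensor_map clinear_id clinear_act)

lemmas map_act_simps = clinear_add [OF clinear_map_act] clinear_scaleC [OF clinear_map_act]

lemma map_act_mult_tens_one: "map_act h (t * (a \<otimes> 1)) = map_act h t * (a \<otimes> 1)"
  by (induction t) (simp_all add: map_act_tens map_act_simps distrib_right)

lemma map_act_add: "map_act (g + h) t = map_act g t + map_act h t"
  by (induction t) (simp_all add: map_act_tens map_act_simps act_add tens_linear)

lemma map_act_scaleC: "map_act (c *\<^sub>C h) t = c *\<^sub>C map_act h t"
  by (induction t)
    (simp_all add: map_act_tens map_act_simps act_scaleC tens_linear scaleC_add_right)

lemma map_act_one: "map_act 1 t = t"
  by (induction t) (simp_all add: map_act_tens map_act_simps act_one_left)

text \<open>This is the condition for K. Multiplied by the inverse of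
  \<open>Uq_K \<otimes> 1\<close>, it says that \<open>coact\<close> intertwines
  \<open>\<kappa>\<close> with conjugation by K tensored with \<open>\<kappa>\<close>; both sides
  are then algebra morphisms in x and can be compared on generators.\<close>

lemma coact_\<kappa>: "coact (\<kappa> x) * (Uq_K \<otimes> 1) = (Uq_K \<otimes> 1) * map_act Uq_K (coact x)"
proof -
  note rel = Uq_relations [where 'p = 'p, folded p_def]
  define ad where "ad h = Uq_K * h * (Uq_Kinv :: 'p Uq)" for h
  have KinvK: "Uq_Kinv * (Uq_K * h) = h" for h :: "'p Uq"
    by (simp add: rel flip: mult.assoc)
  have ad: "alg_hom ad"
    by (simp add: ad_def alg_hom_def clinear_def distrib_left distrib_right rel mult.assoc KinvK)
  note hom = alg_hom_tensor_map [OF ad \<kappa>_hom]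
  have ad_gen: "ad Uq_Kinv = Uq_Kinv" "ad (Uq_E * Uq_Kinv) = qpow p 2 *\<^sub>C (Uq_E * Uq_Kinv)"
    "ad Uq_F = qpow p (- 2) *\<^sub>C Uq_F"
    using arg_cong [OF rel(3), of "\<lambda>h. h * Uq_Kinv"] rel(4) by (simp_all add: ad_def rel mult.assoc)
  have "coact (\<kappa> x) = tensor_map ad \<kappa> (coact x)"
  proof (rule alg_hom_eqI [OF alg_hom_compose [OF coact_hom \<kappa>_hom] alg_hom_compose [OF hom coact_hom]])
    note simps = alg_hom_simps [OF coact_hom] alg_hom_simps [OF hom] alg_hom_linear [OF ad]
      alg_hom_linear [OF \<kappa>_hom] alg_hom_one [OF ad] alg_hom_one [OF \<kappa>_hom] ad_gen tens_linear
    show "coact (\<kappa> z) = tensor_map ad \<kappa> (coact z)" "coact (\<kappa> d) = tensor_map ad \<kappa> (coact d)"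
      by (simp_all add: coact_z coact_d \<kappa>_z \<kappa>_d simps scaleC_diff_right scaleC_add_right
          mult.commute [of w])
    fix l
    assume l: "l \<in> L"
    then obtain c where "\<kappa> l = c *\<^sub>C l"
      using \<kappa>_L by blast
    then show "coact (\<kappa> l) = tensor_map ad \<kappa> (coact l)"
      by (simp add: coact_L [OF l] simps)
  qed
  moreover have "tensor_map ad \<kappa> t * (Uq_K \<otimes> 1) = (Uq_K \<otimes> 1) * map_act Uq_K t" for t
  proof (induction t)
    case (tens a y)
    have "tensor_map ad \<kappa> (a \<otimes> y) = (Uq_K * a * Uq_Kinv) \<otimes> \<kappa> y"
      by (simp add: alg_hom_linear ad \<kappa>_hom ad_def [of a])
    moreover have "map_act Uq_K (a \<otimes> y) = a \<otimes> \<kappa> y"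
      by (simp only: map_act_tens act_gen)
    ultimately show ?case
      by (simp only: tens_mult mult.assoc rel mult_1_right mult_1_left)
  qed (simp add: alg_hom_add [OF hom] map_act_simps distrib_left distrib_right)
  ultimately show ?thesis
    by simp
qed

lemma yetter_drinfeld_generator:
  assumes "h \<in> {Uq_E, Uq_F, Uq_K, Uq_Kinv}"
  shows "tensor_lift (\<lambda>a b. coact (act a x) * (b \<otimes> 1)) (Uq_comult h)
    = tensor_lift (\<lambda>a b. (a \<otimes> 1) * map_act b (coact x)) (Uq_comult h)"
proof -
  note com = Uq_comult_well_defined [where 'p = 'p] and rel = Uq_relations [where 'p = 'p, folded p_def]
  have bil: "cbilinear (\<lambda>a b. coact (act a x) * (b \<otimes> 1))"
    "cbilinear (\<lambda>a b. (a \<otimes> 1) * map_act b (coact x))"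
    by (rule cbilinearI; simp add: act_add act_scaleC alg_hom_simps [OF coact_hom] tens_linear map_act_add map_act_scaleC map_act_one
        distrib_left distrib_right)+
  \<comment> \<open>The inner formulas carry over to the second tensor factor: E and F act there as
    twisted commutators with \<open>1 \<otimes> z\<close> and \<open>1 \<otimes> d\<close>.\<close>
  have map_E: "map_act Uq_E t = (1 / w) *\<^sub>C (t * (1 \<otimes> z) - (1 \<otimes> z) * map_act Uq_K t)" for t
    by (induction t) (simp_all add: map_act_tens map_act_simps act_gen tens_linear distrib_left
        distrib_right scaleC_diff_right scaleC_add_right)
  have map_F: "map_act Uq_F t = (1 / w) *\<^sub>C ((1 \<otimes> d) * t - map_act Uq_Kinv t * (1 \<otimes> d))" for t
    by (induction t) (simp_all add: map_act_tens map_act_simps act_gen tens_linear distrib_left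
        distrib_right scaleC_diff_right scaleC_add_right)
  have Kinv: "coact (\<kappa>inv x) * (Uq_Kinv \<otimes> 1) = (Uq_Kinv \<otimes> 1) * map_act Uq_Kinv (coact x)"
  proof -
    have inv: "map_act Uq_Kinv (map_act Uq_K t) = t" for t
      by (induction t) (simp_all add: map_act_tens map_act_simps act_gen)
    have left: "map_act Uq_Kinv ((a \<otimes> 1) * t) = (a \<otimes> 1) * map_act Uq_Kinv t" for a t
      by (induction t) (simp_all add: map_act_tens map_act_simps distrib_left)
    \<comment> \<open>The case of K at the point \<open>\<kappa>inv x\<close>. Applying
      \<open>map_act Uq_Kinv\<close>, which commutes with multiplication by
      \<open>a \<otimes> 1\<close>, and multiplying by \<open>Uq_Kinv \<otimes> 1\<close> on both
      sides gives the case of the inverse.\<close>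
    have "coact x * (Uq_K \<otimes> 1) = (Uq_K \<otimes> 1) * map_act Uq_K (coact (\<kappa>inv x))"
      using coact_\<kappa> [of "\<kappa>inv x"] by simp
    from arg_cong [OF this, of "map_act Uq_Kinv"]
    have "map_act Uq_Kinv (coact x) * (Uq_K \<otimes> 1) = (Uq_K \<otimes> 1) * coact (\<kappa>inv x)"
      by (simp only: map_act_mult_tens_one inv left)
    then have "(Uq_Kinv \<otimes> 1) * (map_act Uq_Kinv (coact x) * (Uq_K \<otimes> 1)) * (Uq_Kinv \<otimes> 1)
        = (Uq_Kinv \<otimes> 1) * ((Uq_K \<otimes> 1) * coact (\<kappa>inv x)) * (Uq_Kinv \<otimes> 1)"
      by simp
    moreover have "u * (Uq_K \<otimes> 1) * (Uq_Kinv \<otimes> 1) = u"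
      "(Uq_Kinv \<otimes> 1) * ((Uq_K \<otimes> 1) * u) = u" for u :: "('p Uq, 'x) tensor"
      by (simp add: mult.assoc rel flip: one_tensor_def, simp add: rel flip: mult.assoc one_tensor_def)
    ultimately show ?thesis
      by (simp add: mult.assoc)
  qed
  have E: "coact (act Uq_E x) * (Uq_K \<otimes> 1) + coact x * (Uq_E \<otimes> 1)
      = (Uq_E \<otimes> 1) * map_act Uq_K (coact x) + map_act Uq_E (coact x)"
  proof -
    \<comment> \<open>The factor \<open>Uq_K \<otimes> 1\<close> cancels the inverse of K in
      \<open>coact z\<close>. In the expansion below, the \<open>1 \<otimes> z\<close> part
      reassembles into \<open>map_act Uq_E (coact x)\<close>, and the
      \<open>Uq_E \<otimes> 1\<close> part gives the two remaining terms.\<close>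
    have zK: "coact z * (Uq_K \<otimes> 1) = 1 \<otimes> z - w *\<^sub>C (Uq_E \<otimes> 1)"
      by (simp add: coact_z left_diff_distrib rel mult.assoc)
    then have zK_mult: "coact z * ((Uq_K \<otimes> 1) * t) = (1 \<otimes> z - w *\<^sub>C (Uq_E \<otimes> 1)) * t" for t
      by (simp only: mult.assoc [symmetric])
    have "coact (act Uq_E x) * (Uq_K \<otimes> 1) = (1 / w) *\<^sub>C
        (coact x * (coact z * (Uq_K \<otimes> 1)) - coact z * (coact (\<kappa> x) * (Uq_K \<otimes> 1)))"
      by (simp only: act_gen alg_hom_simps [OF coact_hom] mult_scaleC_left left_diff_distrib mult.assoc)
    also have "\<dots> = (1 / w) *\<^sub>C (coact x * (1 \<otimes> z - w *\<^sub>C (Uq_E \<otimes> 1))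
        - (1 \<otimes> z - w *\<^sub>C (Uq_E \<otimes> 1)) * map_act Uq_K (coact x))"
      by (simp only: coact_\<kappa> zK_mult zK)
    also have "\<dots> = map_act Uq_E (coact x) - coact x * (Uq_E \<otimes> 1)
        + (Uq_E \<otimes> 1) * map_act Uq_K (coact x)"
      using w_nonzero unfolding map_E
      by (simp add: left_diff_distrib right_diff_distrib scaleC_diff_right)
    finally show ?thesis
      by simp
  qed
  have F: "coact (act Uq_F x) + coact (\<kappa>inv x) * (Uq_F \<otimes> 1)
      = (Uq_F \<otimes> 1) * coact x + (Uq_Kinv \<otimes> 1) * map_act Uq_F (coact x)"
  proof -
    have d: "coact d = (Uq_Kinv \<otimes> 1) * (1 \<otimes> d) + w *\<^sub>C (Uq_F \<otimes> 1)"
      by (simp add: coact_d)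
    have "coact (act Uq_F x) = (1 / w) *\<^sub>C (coact d * coact x - coact (\<kappa>inv x) * coact d)"
      by (simp only: act_gen alg_hom_simps [OF coact_hom])
    also have "coact (\<kappa>inv x) * coact d = (Uq_Kinv \<otimes> 1) * (map_act Uq_Kinv (coact x) * (1 \<otimes> d))
        + w *\<^sub>C (coact (\<kappa>inv x) * (Uq_F \<otimes> 1))"
      unfolding d distrib_left mult.assoc [symmetric] Kinv by simp
    finally show ?thesis
      using w_nonzero unfolding map_F d
      by (simp add: distrib_right right_diff_distrib scaleC_diff_right scaleC_add_right mult.assoc del: tens_mult)
  qed
  from assms consider "h = Uq_E" | "h = Uq_F" | "h = Uq_K" | "h = Uq_Kinv"
    by blast
  then show ?thesis
    using E F Kinv coact_\<kappa> [of x]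
    by cases (simp_all add: com bil tensor_lift_add [OF bil(1)] tensor_lift_add [OF bil(2)] act_gen(1,2)
        act_one_left map_act_add map_act_scaleC map_act_one flip: one_tensor_def)
qed

lemma yetter_drinfeld_act_coact:
  "tensor_lift (\<lambda>h' h''. tensor_lift (\<lambda>a y. (a * h'') \<otimes> y) (coact (act h' x))) (Uq_comult h)
    = tensor_lift (\<lambda>h' h''. tensor_lift (\<lambda>a y. (h' * a) \<otimes> act h'' y) (coact x)) (Uq_comult h)"
proof -
  have bil: "cbilinear (\<lambda>(a :: 'p Uq) y :: 'x. (a * h) \<otimes> y)" "cbilinear (\<lambda>a y. (g * a) \<otimes> act h y)"
    for g h :: "'p Uq"
    by (rule cbilinearI; simp add: clinear_add [OF clinear_act] clinear_scaleC [OF clinear_act]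
        tens_linear distrib_left distrib_right)+
  have right: "tensor_lift (\<lambda>(a :: 'p Uq) y :: 'x. (a * h) \<otimes> y) t = t * (h \<otimes> 1)" for h t
    by (induction t) (simp_all add: bil(1) tensor_lift_add [OF bil(1)] distrib_right)
  have left: "tensor_lift (\<lambda>a y. (g * a) \<otimes> act h y) t = (g \<otimes> 1) * map_act h t" for g h t
    by (induction t)
      (simp_all add: bil(2) tensor_lift_add [OF bil(2)] map_act_tens map_act_simps distrib_left)
  show ?thesis
    unfolding right left map_act_def
    by (rule yetter_drinfeldI [OF Uq_comult_well_defined(1) cbilinear_act alg_hom_linear [OF coact_hom]
          act_one_left act_mult_left generated_Uq yetter_drinfeld_generator [unfolded map_act_def]])
qed

section \<open>Braided commutativity and the full structure\<close>

text \<open>For generators y = z and y = d the law is the inner formula for E or F solved for y x.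
  In the step to products \<open>x\<close> is replaced by \<open>act b x\<close> (see
  \<open>B_right\<close>), so the induction must treat all x at once.\<close>

lemma braided_commutative_act_coact: "y * x = tensor_lift (\<lambda>a y\<^sub>0. act a x * y\<^sub>0) (coact y)"
proof -
  have bil: "cbilinear (\<lambda>a y. act a x * y)" for x
    by (rule cbilinearI) (simp_all add: act_add act_scaleC distrib_left distrib_right)
  define B where "B x = tensor_lift (\<lambda>a y. act a x * y)" for x
  have B: "B x (a \<otimes> y) = act a x * y" "clinear (B x)" for x a y
    by (simp_all add: B_def bil clinear_tensor_lift)
  note linB = clinear_add [OF B(2)] clinear_scaleC [OF B(2)] clinear_diff [OF B(2)]
  have B_right: "B x (s * (b \<otimes> v)) = B (act b x) s * v" for x s b v
    by (induction s) (simp_all add: B linB act_mult_left distrib_right mult.assoc)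
  have B_mult: "B x (coact y * t) = y * B x t" if "\<And>x. y * x = B x (coact y)" for x y t
    by (induction t) (simp_all add: B_right B linB distrib_left mult.assoc flip: that)
  have "\<forall>x. y * x = B x (coact y)"
    using generated [of y]
  proof induction
    case (generated_base y)
    then consider "y = z" | "y = d" | "y \<in> L"
      by blast
    then show ?case
    proof cases
      case 3
      then show ?thesis
        by (simp add: coact_L B act_one_left central [OF 3])
    qed (use w_nonzero in \<open>simp_all add: coact_z coact_d linB B act_gen act_mult_left \<kappa>_simps\<close>)
  next
    case (generated_mult y y')
    then have "B x (coact y * coact y') = y * (y' * x)" for x
      using B_mult [of y x "coact y'"] by simp
    then show ?case
      by (simp add: alg_hom_mult [OF coact_hom] mult.assoc)
  qed (simp_all add: alg_hom_simps [OF coact_hom] linB distrib_right one_tensor_def B act_one_left)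
  then show ?thesis
    by (simp add: B_def)
qed

lemma braided_commutative_yetter_drinfeld:
  "braided_commutative_yetter_drinfeld_module_algebra Uq_comult Uq_counit Uq_antipode act coact"
proof -
  interpret hopf_algebra "Uq_comult :: 'p Uq \<Rightarrow> _" Uq_counit Uq_antipode
    by (rule hopf_algebra_Uq)
  interpret left_module_algebra Uq_comult Uq_counit act
    by (rule left_module_algebra_act)
  interpret left_comodule_algebra Uq_comult Uq_counit coact
    by (rule left_comodule_algebra_coact)
  show ?thesis
    by unfold_locales (rule yetter_drinfeld_act_coact braided_commutative_act_coact)+
qed

section \<open>Uniqueness of the action and the coaction\<close>

lemma act_unique:
  assumes "left_module_algebra Uq_comult Uq_counit a" "zd_action a z d"
    and "\<And>l. l \<in> L \<Longrightarrow> lambda_action a z d l \<and> \<kappa> l = qpow p (- 1) *\<^sub>C l"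
  shows "a = act"
proof (rule left_module_algebra_Uq_unique [OF assms(1) left_module_algebra_act generated])
  note zd = assms(2) [unfolded zd_action_def Let_def, THEN spec, of 1]
    zd_action_act [unfolded zd_action_def Let_def, THEN spec, of 1]
  fix g
  assume "g \<in> {z, d} \<union> L"
  then consider "g = z" | "g = d" | "g \<in> L"
    by blast
  then have "a Uq_E g = act Uq_E g \<and> a Uq_F g = act Uq_F g \<and> a Uq_K g = act Uq_K g"
  proof cases
    case 3
    then have "lambda_action a z d g" "lambda_action act z d g"
      using assms(3) lambda_action_act by blast+
    from this [unfolded lambda_action_def Let_def, THEN spec, of 1] show ?thesis
      by (simp only: power_one_right)
  qed (use zd in \<open>simp_all only: power_one_right\<close>)
  then show "a Uq_E g = act Uq_E g" "a Uq_F g = act Uq_F g" "a Uq_K g = act Uq_K g"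
    by simp_all
qed

lemma coact_unique:
  assumes "alg_hom c" "zd_coaction c z d" "\<And>l. l \<in> L \<Longrightarrow> c l = 1 \<otimes> l"
  shows "c = coact"
proof
  \<comment> \<open>The coaction formulas are prescribed for m < p, so p >= 2 is what makes them
    available at m = 1, on the generators themselves.\<close>
  have "1 < CARD('p)"
    using p_ge_2 p_def by simp
  note zd = assms(2) [unfolded zd_coaction_def Let_def, THEN spec, THEN mp, OF this]
    zd_coaction_coact [unfolded zd_coaction_def Let_def, THEN spec, THEN mp, OF this]
  have "c z = coact z" "c d = coact d"
    using zd by (simp_all only: power_one_right)
  then show "c x = coact x" for x
    by (rule alg_hom_eqI [OF assms(1) coact_hom]) (simp add: assms(3) coact_L)
qed

end

section \<open>The two algebras\<close>

lemma abs_presented_power: "abs_presented x ^ n = abs_presented (x ^ n)"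
  by (induction n) (simp_all add: one_presented_def times_presented.abs_eq)

lemma Cq_relations:
  fixes z d :: "'p::finite Cq"
  defines "z \<equiv> Cq_z" and "d \<equiv> Cq_d"
  shows "z ^ CARD('p) = 0" "d ^ CARD('p) = 0"
    "d * z = (qpow CARD('p) 1 - qpow CARD('p) (- 1)) *\<^sub>C 1 + qpow CARD('p) (- 2) *\<^sub>C (z * d)"
proof -
  note rel = presented_relator [where 'a = "'p Cq_gen", unfolded relators_Cq_gen_def Let_def]
  note abs = gen.abs_eq abs_presented_power one_presented_def minus_presented.abs_eq
    times_presented.abs_eq scaleC_presented.abs_eq
  have "z ^ CARD('p) = 0" "d ^ CARD('p) = 0" "d * z - (qpow CARD('p) 1 - qpow CARD('p) (- 1)) *\<^sub>C 1
      - qpow CARD('p) (- 2) *\<^sub>C (z * d) = 0"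
    unfolding z_def d_def abs by (rule rel; blast)+
  then show "z ^ CARD('p) = 0" "d ^ CARD('p) = 0"
    "d * z = (qpow CARD('p) 1 - qpow CARD('p) (- 1)) *\<^sub>C 1 + qpow CARD('p) (- 2) *\<^sub>C (z * d)"
    by (simp_all add: diff_diff_eq)
qed

lemma Lq_relation: "gen Gen_lambda ^ (2 * CARD('p)) = (1 :: 'p::finite Lq_gen presented)"
proof -
  note rel = presented_relator [where 'a = "'p Lq_gen", unfolded relators_Lq_gen_def]
  note abs = gen.abs_eq abs_presented_power one_presented_def minus_presented.abs_eq
  have "gen Gen_lambda ^ (2 * CARD('p)) - (1 :: 'p Lq_gen presented) = 0"
    unfolding abs by (rule rel) blast
  then show ?thesis
    by simp
qed

lemma generated_Cq: "x \<in> generated {Cq_z, Cq_d :: 'p::finite Cq}"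
proof -
  have "UNIV = {Gen_z, Gen_d :: 'p Cq_gen}"
    by (auto intro: Cq_gen.exhaust)
  then have "range gen = {Cq_z, Cq_d :: 'p Cq}"
    by (metis (no_types) image_empty image_insert)
  then show ?thesis
    using generated_range_gen [of x] by simp
qed

lemma generated_Lq: "x \<in> generated {gen Gen_lambda :: 'p::finite Lq_gen presented}"
proof -
  have "UNIV = {Gen_lambda :: 'p Lq_gen}"
    by (auto intro: Lq_gen.exhaust)
  then have "range gen = {gen Gen_lambda :: 'p Lq_gen presented}"
    by (metis (no_types) image_empty image_insert)
  then show ?thesis
    using generated_range_gen [of x] by simp
qed

section \<open>The K-automorphisms and the coactions of the two algebras\<close>

definition Cq_K :: "'p::finite Cq \<Rightarrow> 'p Cq" where
  "Cq_K = presented_lift (\<lambda>g. case g of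
      Gen_z \<Rightarrow> qpow CARD('p) 2 *\<^sub>C Cq_z | Gen_d \<Rightarrow> qpow CARD('p) (- 2) *\<^sub>C Cq_d)"

definition Cq_delta :: "'p::finite Cq \<Rightarrow> ('p Uq, 'p Cq) tensor" where
  "Cq_delta = presented_lift (\<lambda>g. case g of
      Gen_z \<Rightarrow> Uq_Kinv \<otimes> Cq_z
        - (qpow CARD('p) 1 - qpow CARD('p) (- 1)) *\<^sub>C ((Uq_E * Uq_Kinv) \<otimes> 1)
    | Gen_d \<Rightarrow> Uq_Kinv \<otimes> Cq_d + (qpow CARD('p) 1 - qpow CARD('p) (- 1)) *\<^sub>C (Uq_F \<otimes> 1))"

definition Lq_K :: "'p::finite Lq_gen presented \<Rightarrow> 'p Lq_gen presented" where
  "Lq_K = presented_lift (\<lambda>g. qpow CARD('p) (- 1) *\<^sub>C gen Gen_lambda)"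

definition Hq_K :: "'p::finite Hq \<Rightarrow> 'p Hq" where
  "Hq_K = tensor_map Cq_K Lq_K"

text \<open>A product of two commuting morphisms, so that \<open>alg_hom_tensor_lift_mult\<close>
  applies; the lambda factor is coinvariant.\<close>

definition Hq_delta :: "'p::finite Hq \<Rightarrow> ('p Uq, 'p Hq) tensor" where
  "Hq_delta = tensor_lift (\<lambda>x r. tensor_map (\<lambda>h. h) (\<lambda>y. y \<otimes> 1) (Cq_delta x) * (1 \<otimes> (1 \<otimes> r)))"

lemma Cq_K_well_defined:
  shows "alg_hom (Cq_K :: 'p::finite Cq \<Rightarrow> _)"
    and "Cq_K (Cq_z :: 'p Cq) = qpow CARD('p) 2 *\<^sub>C Cq_z"
    and "Cq_K (Cq_d :: 'p Cq) = qpow CARD('p) (- 2) *\<^sub>C Cq_d"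
proof -
  let ?f = "\<lambda>g :: 'p Cq_gen. case g of
      Gen_z \<Rightarrow> qpow CARD('p) 2 *\<^sub>C Cq_z :: 'p Cq | Gen_d \<Rightarrow> qpow CARD('p) (- 2) *\<^sub>C Cq_d"
  have *: "free_lift ?f r = 0" if "r \<in> relators" for r
    using that Cq_relations [where 'p = 'p]
    by (auto simp: relators_Cq_gen_def Let_def free_lift_simps scaleC_power mult.commute)
  show "alg_hom (Cq_K :: 'p::finite Cq \<Rightarrow> _)"
    unfolding Cq_K_def by (rule alg_hom_presented_lift [OF *])
  show "Cq_K (Cq_z :: 'p Cq) = qpow CARD('p) 2 *\<^sub>C Cq_z"
    "Cq_K (Cq_d :: 'p Cq) = qpow CARD('p) (- 2) *\<^sub>C Cq_d"
    unfolding Cq_K_def by (simp_all add: presented_lift_gen [OF *])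
qed

lemma Lq_K_well_defined:
  shows "alg_hom (Lq_K :: 'p::finite Lq_gen presented \<Rightarrow> _)"
    and "Lq_K (gen Gen_lambda :: 'p Lq_gen presented) = qpow CARD('p) (- 1) *\<^sub>C gen Gen_lambda"
proof -
  let ?f = "\<lambda>g :: 'p Lq_gen. qpow CARD('p) (- 1) *\<^sub>C gen Gen_lambda :: 'p Lq_gen presented"
  \<comment> \<open>q^(-1) is a 2p-th root of unity, so rescaling lambda by it respects the relation
    lambda^(2p) = 1.\<close>
  have "qpow CARD('p) (- 1) ^ (2 * CARD('p)) = 1"
    using qpow_2_order(2) [of "CARD('p)"] by (simp add: qpow_power mult.commute)
  then have *: "free_lift ?f r = 0" if "r \<in> relators" for r
    using that Lq_relation [where 'p = 'p]
    by (auto simp: relators_Lq_gen_def free_lift_simps scaleC_power)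
  show "alg_hom (Lq_K :: 'p::finite Lq_gen presented \<Rightarrow> _)"
    unfolding Lq_K_def by (rule alg_hom_presented_lift [OF *])
  show "Lq_K (gen Gen_lambda :: 'p Lq_gen presented) = qpow CARD('p) (- 1) *\<^sub>C gen Gen_lambda"
    unfolding Lq_K_def by (rule presented_lift_gen [OF *])
qed

text \<open>The p-th powers vanish by \<open>q_freshman\<close>, the two summands of each image
  being q-commuting and nilpotent; for \<open>E * Kinv\<close> the nilpotency comes from
  \<open>q_commute_mult_power\<close>.\<close>

lemma Cq_delta_well_defined:
  assumes "2 \<le> CARD('p::finite)"
  shows "alg_hom (Cq_delta :: 'p::finite Cq \<Rightarrow> _)"
    and "Cq_delta (Cq_z :: 'p Cq) = Uq_Kinv \<otimes> Cq_z
      - (qpow CARD('p) 1 - qpow CARD('p) (- 1)) *\<^sub>C ((Uq_E * Uq_Kinv) \<otimes> 1)"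
    and "Cq_delta (Cq_d :: 'p Cq) = Uq_Kinv \<otimes> Cq_d
      + (qpow CARD('p) 1 - qpow CARD('p) (- 1)) *\<^sub>C (Uq_F \<otimes> 1)"
proof -
  define p where "p = CARD('p)"
  define w where "w = qpow p 1 - qpow p (- 1)"
  define E F K Kinv :: "'p Uq" where "E = Uq_E" and "F = Uq_F" and "K = Uq_K" and "Kinv = Uq_Kinv"
  define z d :: "'p Cq" where "z = Cq_z" and "d = Cq_d"
  note rel = Uq_relations [where 'p = 'p, folded E_def F_def K_def Kinv_def p_def, folded w_def]
    and com = Uq_commute [where 'p = 'p, folded E_def F_def K_def Kinv_def p_def]
    and rel_C = Cq_relations [where 'p = 'p, folded z_def d_def p_def, folded w_def]
  have p: "0 < p"
    by (simp add: p_def)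
  let ?z = "Kinv \<otimes> z - w *\<^sub>C ((E * Kinv) \<otimes> 1)" and ?d = "Kinv \<otimes> d + w *\<^sub>C (F \<otimes> 1)"
  let ?f = "\<lambda>g :: 'p Cq_gen. case g of Gen_z \<Rightarrow> ?z | Gen_d \<Rightarrow> ?d"
  have "?z ^ p = 0"
  proof -
    have "(Kinv \<otimes> z + (- w) *\<^sub>C ((E * Kinv) \<otimes> 1)) ^ p = (Kinv \<otimes> z) ^ p + ((- w) *\<^sub>C ((E * Kinv) \<otimes> 1)) ^ p"
    proof (rule q_freshman [where r = "qpow p 2"])
      show "(- w) *\<^sub>C ((E * Kinv) \<otimes> 1) * (Kinv \<otimes> z) = qpow p 2 *\<^sub>C (Kinv \<otimes> z * (- w) *\<^sub>C ((E * Kinv) \<otimes> 1))"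
        by (simp add: com(7) tens_linear mult.assoc mult.commute)
    qed (simp_all add: p qpow_2_order)
    moreover obtain c where "(E * Kinv) ^ p = c *\<^sub>C (E ^ p * Kinv ^ p)"
      using q_commute_mult_power [OF com(5)] by blast
    ultimately show ?thesis
      by (simp add: tens_power scaleC_power rel rel_C tens_linear power_minus_eq_zero)
  qed
  moreover have "?d ^ p = 0"
  proof -
    have "?d ^ p = (Kinv \<otimes> d) ^ p + (w *\<^sub>C (F \<otimes> 1)) ^ p"
    proof (rule q_freshman [where r = "qpow p (- 2)"])
      show "w *\<^sub>C (F \<otimes> 1) * (Kinv \<otimes> d) = qpow p (- 2) *\<^sub>C (Kinv \<otimes> d * w *\<^sub>C (F \<otimes> 1))"
        by (simp add: com(6) tens_linear mult.assoc mult.commute [of w])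
          (simp flip: mult.assoc)
    qed (simp_all add: p qpow_2_order)
    then show ?thesis
      using p by (simp add: tens_power scaleC_power rel rel_C tens_linear)
  qed
  \<comment> \<open>The mixed terms containing z or d alone cancel by q-commutation. The relation of
    d and z leaves w K^(-2), the commutator of E and F leaves w (1 - K^(-2)), and together they give
    the required w.\<close>
  moreover have "?d * ?z - w *\<^sub>C 1 - qpow p (- 2) *\<^sub>C (?z * ?d) = 0"
  proof -
    have w: "w \<noteq> 0"
      using qpow_diff_nonzero [OF assms] by (simp add: w_def p_def)
    have KinvE: "Kinv * (E * Kinv) = qpow p (- 2) *\<^sub>C (E * (Kinv * Kinv))"
      by (simp only: mult.assoc [symmetric] com(5) mult_scaleC_left)
    have EF: "E * (F * Kinv) = F * (E * Kinv) + (1 / w) *\<^sub>C (1 - Kinv * Kinv)"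
    proof -
      have "(E * F - F * E) * Kinv = (1 / w) *\<^sub>C ((K - Kinv) * Kinv)"
        by (simp only: rel(5) mult_scaleC_left)
      then have "E * (F * Kinv) - F * (E * Kinv) = (1 / w) *\<^sub>C (1 - Kinv * Kinv)"
        by (simp only: left_diff_distrib mult.assoc rel(1))
      then show ?thesis
        by (simp only: diff_eq_eq add.commute)
    qed
    have cancel: "qpow p (- 2) * (w * qpow p 2) = w" "qpow p (- 2) * (w * (w * qpow p 2)) = w * w"
      "qpow p (- 2) * w = w * qpow p (- 2)"
      by (simp_all add: mult.left_commute [of "qpow p (- 2)" w] mult.commute [of "qpow p (- 2)" w])
    show ?thesis
      using w by (simp add: distrib_left distrib_right left_diff_distrib right_diff_distrib rel_C com(6) KinvE EF
          mult.assoc tens_linear scaleC_add_right scaleC_diff_right scaleC_add_left one_tensor_def cancel)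
  qed
  ultimately have *: "free_lift ?f r = 0" if "r \<in> relators" for r
    using that unfolding relators_Cq_gen_def Let_def p_def [symmetric] w_def [symmetric]
    by (auto simp: free_lift_simps)
  have def: "Cq_delta = presented_lift ?f"
    unfolding Cq_delta_def E_def F_def Kinv_def z_def d_def w_def p_def by (rule refl)
  show "alg_hom (Cq_delta :: 'p::finite Cq \<Rightarrow> _)"
    unfolding def by (rule alg_hom_presented_lift [OF *])
  have val: "presented_lift ?f (gen g) = ?f g" for g
    by (rule presented_lift_gen [OF *])
  show "Cq_delta (Cq_z :: 'p Cq) = Uq_Kinv \<otimes> Cq_z
      - (qpow CARD('p) 1 - qpow CARD('p) (- 1)) *\<^sub>C ((Uq_E * Uq_Kinv) \<otimes> 1)"
    "Cq_delta (Cq_d :: 'p Cq) = Uq_Kinv \<otimes> Cq_d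
      + (qpow CARD('p) 1 - qpow CARD('p) (- 1)) *\<^sub>C (Uq_F \<otimes> 1)"
    using val [of Gen_z] val [of Gen_d]
    unfolding def by (simp_all only: E_def F_def Kinv_def z_def d_def w_def p_def Cq_gen.case)
qed

section \<open>The two instances of the inner structure\<close>

lemma quantum_plane_Cq:
  assumes "2 \<le> CARD('p::finite)"
  shows "quantum_plane (Cq_z :: 'p Cq) Cq_d {} Cq_K Cq_delta CARD('p) (qpow CARD('p) 1 - qpow CARD('p) (- 1))"
  by unfold_locales
    (use assms Cq_delta_well_defined [OF assms] in
      \<open>simp_all add: generated_Cq Cq_K_well_defined Cq_relations\<close>)

lemma alg_hom_incl: "alg_hom (tensor_map (\<lambda>h :: 'p::finite Uq. h) (\<lambda>y :: 'p Cq. y \<otimes> (1 :: 'p Lq_gen presented)))"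
  by (intro alg_hom_tensor_map alg_hom_id alg_hom_tens_one)

lemma Hq_delta_well_defined:
  assumes "2 \<le> CARD('p::finite)"
  shows "alg_hom (Hq_delta :: 'p::finite Hq \<Rightarrow> _)"
    and "Hq_delta (x \<otimes> r :: 'p Hq)
      = tensor_map (\<lambda>h. h) (\<lambda>y. y \<otimes> 1) (Cq_delta x) * (1 \<otimes> (1 \<otimes> r))"
proof -
  let ?f = "\<lambda>x :: 'p Cq. tensor_map (\<lambda>h :: 'p Uq. h) (\<lambda>y. y \<otimes> (1 :: 'p Lq_gen presented)) (Cq_delta x)"
    and ?g = "\<lambda>r :: 'p Lq_gen presented. (1 :: 'p Uq) \<otimes> ((1 :: 'p Cq) \<otimes> r)"
  have f: "alg_hom ?f"
    by (rule alg_hom_compose [OF alg_hom_incl Cq_delta_well_defined(1) [OF assms]])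
  have g: "alg_hom ?g"
    by (intro alg_hom_compose [OF alg_hom_one_tens] alg_hom_one_tens)
  have "tensor_map (\<lambda>h :: 'p Uq. h) (\<lambda>y :: 'p Cq. y \<otimes> (1 :: 'p Lq_gen presented)) t * ?g r
      = ?g r * tensor_map (\<lambda>h. h) (\<lambda>y. y \<otimes> 1) t" for t r
    by (induction t) (simp_all add: alg_hom_add [OF alg_hom_incl] clinear_id alg_hom_linear
        alg_hom_tens_one distrib_left distrib_right)
  then show "alg_hom (Hq_delta :: 'p::finite Hq \<Rightarrow> _)"
    unfolding Hq_delta_def by (intro alg_hom_tensor_lift_mult f g)
  show "Hq_delta (x \<otimes> r :: 'p Hq) = ?f x * ?g r"
    unfolding Hq_delta_def by (rule tensor_lift_tens [OF cbilinear_alg_hom_mult [OF f g]])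
qed

lemma generated_Hq: "x \<in> generated {Hq_z, Hq_d, Hq_lambda :: 'p::finite Hq}"
proof (induction x)
  case (tens x r)
  have "x \<otimes> 1 \<in> generated ((\<lambda>x. x \<otimes> 1) ` {Cq_z, Cq_d :: 'p Cq} :: 'p Hq set)"
    by (rule generated_alg_hom_image [OF alg_hom_tens_one generated_Cq])
  moreover have "1 \<otimes> r \<in> generated ((\<lambda>r. 1 \<otimes> r) ` {gen Gen_lambda} :: 'p Hq set)"
    by (rule generated_alg_hom_image [OF alg_hom_one_tens generated_Lq])
  ultimately have "(x \<otimes> 1) * (1 \<otimes> r) \<in> generated {Hq_z, Hq_d, Hq_lambda :: 'p Hq}"
    by (intro generated_mult) (auto elim!: generated_mono)
  then show ?case
    by simp
next
  case (add x y)
  then show ?case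
    by (rule generated_add)
qed

text \<open>The second tensor factor is presented by a single generator; that this generator
  commutes with every element is an induction over the products it generates.\<close>

lemma Hq_lambda_central: "x * Hq_lambda = Hq_lambda * (x :: 'p::finite Hq)"
proof (induction x)
  case (tens x r)
  have "r * gen Gen_lambda = gen Gen_lambda * r"
    using generated_Lq [of r]
  proof induction
    case (generated_mult r s)
    then have "r * (s * gen Gen_lambda) = gen Gen_lambda * r * s"
      by (simp flip: mult.assoc)
    then show ?case
      by (simp add: mult.assoc)
  qed (simp_all add: distrib_left distrib_right)
  then show ?case
    by simp
qed (simp add: distrib_left distrib_right)

lemma Hq_K_tens: "Hq_K (x \<otimes> r) = Cq_K x \<otimes> Lq_K (r :: 'p::finite Lq_gen presented)"
  by (simp add: Hq_K_def alg_hom_linear Cq_K_well_defined Lq_K_well_defined)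

lemma Hq_K_lambda: "Hq_K (Hq_lambda :: 'p::finite Hq) = qpow CARD('p) (- 1) *\<^sub>C Hq_lambda"
  by (simp add: Hq_K_tens Lq_K_well_defined alg_hom_one [OF Cq_K_well_defined(1)] tens_linear)

lemma quantum_plane_Hq:
  assumes "2 \<le> CARD('p::finite)"
  shows "quantum_plane (Hq_z :: 'p Hq) Hq_d {Hq_lambda} Hq_K Hq_delta CARD('p)
    (qpow CARD('p) 1 - qpow CARD('p) (- 1))"
proof unfold_locales
  note one = alg_hom_one [OF Cq_K_well_defined(1)] alg_hom_one [OF Lq_K_well_defined(1)]
    alg_hom_one [OF Cq_delta_well_defined(1) [OF assms]] alg_hom_one [OF alg_hom_incl]
  note incl = alg_hom_simps [OF alg_hom_incl [where 'p = 'p]] clinear_id alg_hom_linear alg_hom_tens_one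
  show "CARD('p) = CARD('p)" "2 \<le> CARD('p)"
    "qpow CARD('p) 1 - qpow CARD('p) (- 1) = qpow CARD('p) 1 - qpow CARD('p) (- 1)"
    using assms by simp_all
  show "x \<in> generated ({Hq_z, Hq_d} \<union> {Hq_lambda})" for x :: "'p Hq"
    using generated_Hq [of x] by (simp add: insert_commute)
  show "alg_hom (Hq_K :: 'p Hq \<Rightarrow> _)" "alg_hom (Hq_delta :: 'p Hq \<Rightarrow> _)"
    by (simp_all add: Hq_K_def alg_hom_tensor_map Cq_K_well_defined Lq_K_well_defined Hq_delta_well_defined [OF assms])
  show "Hq_K (Hq_z :: 'p Hq) = qpow CARD('p) 2 *\<^sub>C Hq_z"
    "Hq_K (Hq_d :: 'p Hq) = qpow CARD('p) (- 2) *\<^sub>C Hq_d"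
    by (simp_all add: Hq_K_tens Cq_K_well_defined one tens_linear)
  have "qpow CARD('p) (- 1) ^ (2 * CARD('p)) = 1"
    using qpow_2_order(2) [of "CARD('p)"] by (simp add: qpow_power mult.commute)
  then show "\<exists>c. Hq_K l = c *\<^sub>C l \<and> c ^ (2 * CARD('p)) = 1" if "l \<in> {Hq_lambda :: 'p Hq}" for l
    using that Hq_K_lambda by blast
  show "x * l = l * x" if "l \<in> {Hq_lambda}" for x l :: "'p Hq"
    using that Hq_lambda_central by simp
  show "Hq_z ^ CARD('p) = (0 :: 'p Hq)" "Hq_d ^ CARD('p) = (0 :: 'p Hq)"
    by (simp_all add: tens_power Cq_relations tens_linear)
  show "(Hq_d * Hq_z :: 'p Hq) = (qpow CARD('p) 1 - qpow CARD('p) (- 1)) *\<^sub>C 1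
      + qpow CARD('p) (- 2) *\<^sub>C (Hq_z * Hq_d)"
    by (simp add: Cq_relations tens_linear one_tensor_def)
  show "Hq_delta (Hq_z :: 'p Hq) = Uq_Kinv \<otimes> Hq_z
      - (qpow CARD('p) 1 - qpow CARD('p) (- 1)) *\<^sub>C ((Uq_E * Uq_Kinv) \<otimes> 1)"
    "Hq_delta (Hq_d :: 'p Hq) = Uq_Kinv \<otimes> Hq_d
      + (qpow CARD('p) 1 - qpow CARD('p) (- 1)) *\<^sub>C (Uq_F \<otimes> 1)"
    by (simp_all add: Hq_delta_well_defined [OF assms] Cq_delta_well_defined [OF assms] incl flip: one_tensor_def)
  show "Hq_delta l = 1 \<otimes> l" if "l \<in> {Hq_lambda :: 'p Hq}" for l
    using that by (simp add: Hq_delta_well_defined [OF assms] one)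
qed

text \<open>"Determined by" is expressed by uniqueness among module algebra actions and among
  algebra morphisms with the given values. The clauses on \<open>x \<otimes> 1\<close> say that the
  structure on \<open>Cq\<close> is the restriction of the one on \<open>Hq\<close>.\<close>

theorem mainTheorem5:
  assumes "CARD('p::finite) \<ge> 2"
  shows "\<exists>(act :: 'p Uq \<Rightarrow> 'p Hq \<Rightarrow> 'p Hq) (coact :: 'p Hq \<Rightarrow> ('p Uq, 'p Hq) tensor)
           (act\<^sub>C :: 'p Uq \<Rightarrow> 'p Cq \<Rightarrow> 'p Cq) (coact\<^sub>C :: 'p Cq \<Rightarrow> ('p Uq, 'p Cq) tensor).
      Hq_action act \<and> Hq_coaction coact \<and>
      (\<forall>a. left_module_algebra Uq_comult Uq_counit a \<and> Hq_action a \<longrightarrow> a = act) \<and>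
      (\<forall>c. alg_hom c \<and> Hq_coaction c \<longrightarrow> c = coact) \<and>
      braided_commutative_yetter_drinfeld_module_algebra
        Uq_comult Uq_counit Uq_antipode act coact \<and>
      Cq_action act\<^sub>C \<and> Cq_coaction coact\<^sub>C \<and>
      (\<forall>a. left_module_algebra Uq_comult Uq_counit a \<and> Cq_action a \<longrightarrow> a = act\<^sub>C) \<and>
      (\<forall>c. alg_hom c \<and> Cq_coaction c \<longrightarrow> c = coact\<^sub>C) \<and>
      (\<forall>h x. act h (x \<otimes> 1) = act\<^sub>C h x \<otimes> 1) \<and>
      (\<forall>x. coact (x \<otimes> 1) = tensor_lift (\<lambda>h y. h \<otimes> (y \<otimes> 1)) (coact\<^sub>C x)) \<and>
      braided_commutative_yetter_drinfeld_module_algebra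
        Uq_comult Uq_counit Uq_antipode act\<^sub>C coact\<^sub>C"
proof -
  interpret H: quantum_plane "Hq_z :: 'p Hq" Hq_d "{Hq_lambda}" Hq_K Hq_delta "CARD('p)"
    "qpow CARD('p) 1 - qpow CARD('p) (- 1)"
    by (rule quantum_plane_Hq [OF assms])
  interpret C: quantum_plane "Cq_z :: 'p Cq" Cq_d "{}" Cq_K Cq_delta "CARD('p)"
    "qpow CARD('p) 1 - qpow CARD('p) (- 1)"
    by (rule quantum_plane_Cq [OF assms])
  have act: "H.act h (x \<otimes> 1) = C.act h x \<otimes> 1" for h x
  proof -
    have K: "Hq_K (x \<otimes> 1) = Cq_K x \<otimes> 1" for x :: "'p Cq"
      by (simp add: Hq_K_tens alg_hom_one [OF Lq_K_well_defined(1)])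
    \<comment> \<open>Both inverses are iterates of the same exponent 2p - 1, so the compatibility
      of \<open>Hq_K\<close> with \<open>Cq_K\<close> carries over.\<close>
    have Kinv: "H.\<kappa>inv (x \<otimes> 1) = C.\<kappa>inv x \<otimes> 1" for x
    proof -
      have "(Hq_K ^^ n) (x \<otimes> 1) = (Cq_K ^^ n) x \<otimes> 1" for n
        by (induction n) (simp_all add: K)
      then show ?thesis
        by (simp add: H.\<kappa>inv_def C.\<kappa>inv_def)
    qed
    show ?thesis
      using generated_Uq [of h]
    proof (induction arbitrary: x)
      case (generated_base h)
      then show ?case
        by (auto simp: H.act_gen C.act_gen K Kinv tens_linear)
    qed (simp_all add: H.act_one_left C.act_one_left H.act_add C.act_add H.act_scaleC C.act_scaleC
        H.act_mult_left C.act_mult_left tens_linear)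
  qed
  have coact: "Hq_delta (x \<otimes> 1) = tensor_lift (\<lambda>h y. h \<otimes> (y \<otimes> 1)) (Cq_delta x)" for x :: "'p Cq"
    by (simp add: Hq_delta_well_defined [OF assms] tensor_map_def flip: one_tensor_def)
  note lambda = Hq_K_lambda [where 'p = 'p]
  show ?thesis
  proof (rule exI [of _ H.act], rule exI [of _ Hq_delta], rule exI [of _ C.act], rule exI [of _ Cq_delta],
      intro conjI allI impI)
    show "Hq_action H.act"
      unfolding Hq_action_def by (intro conjI H.zd_action_act H.lambda_action_act singletonI lambda)
    show "Hq_coaction (Hq_delta :: 'p Hq \<Rightarrow> _)"
      unfolding Hq_coaction_def by (intro conjI H.zd_coaction_coact H.coact_L singletonI)
    show "a = H.act" if a: "left_module_algebra Uq_comult Uq_counit a \<and> Hq_action a" for a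
    proof (rule H.act_unique)
      show "left_module_algebra Uq_comult Uq_counit a"
        by (rule conjunct1 [OF a])
      note action = conjunct2 [OF a, unfolded Hq_action_def]
      show "zd_action a Hq_z Hq_d"
        by (rule conjunct1 [OF action])
      show "lambda_action a Hq_z Hq_d l \<and> Hq_K l = qpow CARD('p) (- 1) *\<^sub>C l"
        if "l \<in> {Hq_lambda}" for l
        unfolding singletonD [OF that] by (rule conjI [OF conjunct2 [OF action] lambda])
    qed
    show "c = Hq_delta" if c: "alg_hom c \<and> Hq_coaction c" for c :: "'p Hq \<Rightarrow> _"
    proof (rule H.coact_unique)
      show "alg_hom c"
        by (rule conjunct1 [OF c])
      note coaction = conjunct2 [OF c, unfolded Hq_coaction_def]
      show "zd_coaction c Hq_z Hq_d"
        by (rule conjunct1 [OF coaction])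
      show "c l = 1 \<otimes> l" if "l \<in> {Hq_lambda}" for l
        unfolding singletonD [OF that] by (rule conjunct2 [OF coaction])
    qed
    show "Cq_action C.act"
      unfolding Cq_action_def by (rule C.zd_action_act)
    show "Cq_coaction (Cq_delta :: 'p Cq \<Rightarrow> _)"
      unfolding Cq_coaction_def by (rule C.zd_coaction_coact)
    show "a = C.act" if a: "left_module_algebra Uq_comult Uq_counit a \<and> Cq_action a" for a
      by (rule C.act_unique [OF conjunct1 [OF a] conjunct2 [OF a, unfolded Cq_action_def]]) simp
    show "c = Cq_delta" if c: "alg_hom c \<and> Cq_coaction c" for c :: "'p Cq \<Rightarrow> _"
      by (rule C.coact_unique [OF conjunct1 [OF c] conjunct2 [OF c, unfolded Cq_coaction_def]]) simp
  qed (rule act coact H.braided_commutative_yetter_drinfeld C.braided_commutative_yetter_drinfeld)+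
qed

end
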